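(* Let $n$ be a positive integer, $k\in\mathbb{C}$, and let $\rho: S_n\ltimes\mathbb{Z}^n\rightarrow \mathrm{GL}_{\mathbb{C}}(M)$ be a representation on a complex vector space $M$. Fix $\lambda\in\mathbb{C}^n$ such that $\lambda_i\neq\lambda_j$ for $i\neq j$, and choose $m_w\in M$ for every $w\in S_n$. Then there exists a unique $M$-valued continuous function $f_\lambda$ on $\mathbb{R}^n$ satisfying: (i) $f_\lambda$ is an eigenfunction, in the weak sense, of $$\mathcal{H}_k^M=-\Delta-k\sum_{1\leq i<j\leq n,\ m\in\mathbb{Z}}\delta(x_i-x_j+m)\rho(s_{i,j;m})$$ with eigenvalue $-\lambda^2:=-\sum_{j=1}^n\lambda_j^2$; (ii) on each $S_n\ltimes\mathbb{Z}^n$-translate of $C_+$, $f_\lambda$ can be expressed as a sum of plane waves $e^{w\lambda}$ ($w\in S_n$) with coefficients in $M$; (iii) $f_\lambda|_{C_+}=\sum_{w\in S_n}m_we^{w\lambda}|_{C_+}$.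
   Context: $S_n\ltimes\mathbb{Z}^n$ acts on $\mathbb{R}^n$ by permutations of coordinates and translations. $\Delta$ is the Laplacian on $\mathbb{R}^n$. $s_{i,j;m}\in S_n\ltimes\mathbb{Z}^n$ is the orthogonal reflection in the affine hyperplane $H_{i,j;m}=\{x\in\mathbb{R}^n \mid x_j-x_i=m\}$. The fundamental domain is $$C_+=\{x\in\mathbb{R}^n \mid x_1>x_2>\cdots>x_n>x_1-1\}.$$ For $\mu\in\mathbb{C}^n$, $e^{\mu}$ is the function $x\mapsto e^{\sum_j\mu_jx_j}$ on $\mathbb{R}^n$; $S_n$ acts on $\mathbb{C}^n$ by permuting coordinates. A function $f:\mathbb{R}^n\to M$ is called continuous if every point of $\mathbb{R}^n$ has an open neighbourhood $U$ with $f|_U\in C(U)\otimes_{\mathbb{C}}M$ (algebraic tensor product). Weak sense: $\delta$ is Dirac's delta function, and a continuous $f:\mathbb{R}^n\to M$ satisfies $\mathcal{H}_k^Mf=Ef$ ($E\in\mathbb{C}$) weakly if for all smooth compactly supported $\phi:\mathbb{R}^n\to\mathbb{C}$, $$-\int_{\mathbb{R}^n}f(x)(\Delta\phi)(x)\,dx-k\sum_{1\le i<j\le n,\ m\in\mathbb{Z}}\frac{1}{\sqrt2}\int_{H_{i,j;m}}\rho(s_{i,j;m})(f(x))\,\phi(x)\,d\sigma(x)=E\int_{\mathbb{R}^n}f(x)\phi(x)\,dx,$$ where $d\sigma$ is the Euclidean volume measure on the hyperplane (the factor $1/\sqrt2$ is the usual one in the pull-back of Dirac's delta along $x\mapsto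 x_i-x_j+m$). *)

theory Defs
  imports
    "HOL-Analysis.Analysis"
    "HOL-Algebra.Group"
    "HOL-Library.Groups_Big_Fun"
begin

text \<open>
  Conventions.  Coordinates are indexed by a finite linearly ordered type \<open>'n\<close>, so that \<open>n\<close> is
  \<open>CARD('n)\<close> and the indices \<open>1 < \<dots> < n\<close> are the elements of \<open>'n\<close> in increasing order.
  The complex vector space \<open>M\<close> is the universe of a type \<open>'m\<close> with scalar multiplication
  \<open>smul\<close>; it carries no topology and may be infinite-dimensional.
\<close>


section \<open>The group \<open>S\<^sub>n \<ltimes> \<int>\<^sup>n\<close> and its action\<close>

text \<open>Left action, \<open>w e\<^sub>j = e\<^bsub>w j\<^esub>\<close>; hence the inverse in the coordinates.\<close>

definition permute_vec :: "('n::finite \<Rightarrow> 'n) \<Rightarrow> 'a ^ 'n \<Rightarrow> 'a ^ 'n" where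
  "permute_vec w u = (\<chi> j. u $ inv_into UNIV w j)"

definition affine_sym_group :: "(('n::finite \<Rightarrow> 'n) \<times> (int ^ 'n)) monoid" where
  "affine_sym_group =
    \<lparr>carrier = {w. w permutes UNIV} \<times> UNIV,
     mult = (\<lambda>(w, v) (w', v'). (w \<circ> w', v + permute_vec w v')),
     one = (id, 0)\<rparr>"

definition affine_act :: "('n::finite \<Rightarrow> 'n) \<times> (int ^ 'n) \<Rightarrow> real ^ 'n \<Rightarrow> real ^ 'n" where
  "affine_act g x = permute_vec (fst g) x + (\<chi> j. of_int (snd g $ j))"

definition hyperplane :: "'n::finite \<Rightarrow> 'n \<Rightarrow> int \<Rightarrow> (real ^ 'n) set" where
  "hyperplane i j m = {x. x $ j - x $ i = of_int m}"

text \<open>The group element \<open>s\<^bsub>i,j;m\<^esub>\<close>; lemma \<open>affine_act_affine_reflection\<close> below shows that it acts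
  as the orthogonal reflection in \<open>hyperplane i j m\<close>.\<close>

definition affine_reflection :: "'n::finite \<Rightarrow> 'n \<Rightarrow> int \<Rightarrow> ('n \<Rightarrow> 'n) \<times> (int ^ 'n)" where
  "affine_reflection i j m = (Transposition.transpose i j, axis j m - axis i m)"

definition fundamental_alcove :: "(real ^ 'n::{finite,linorder}) set" where
  "fundamental_alcove =
    {x. (\<forall>i j. i < j \<longrightarrow> x $ i > x $ j) \<and> x $ Max UNIV > x $ Min UNIV - 1}"

definition general_linear_group :: "(complex \<Rightarrow> 'm::ab_group_add \<Rightarrow> 'm) \<Rightarrow> ('m \<Rightarrow> 'm) monoid" where
  "general_linear_group smul =
    \<lparr>carrier = {f. Vector_Spaces.linear smul smul f \<and> bij f}, mult = (\<circ>), one = id\<rparr>"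

definition plane_wave :: "complex ^ 'n \<Rightarrow> real ^ 'n \<Rightarrow> complex" where
  "plane_wave \<mu> x = exp (\<Sum>j\<in>UNIV. \<mu> $ j * of_real (x $ j))"


section \<open>Continuity and integration of \<open>M\<close>-valued functions\<close>

text \<open>\<open>f|\<^sub>U \<in> C(U) \<otimes> M\<close> is written out as: \<open>f|\<^sub>U\<close> is a finite sum of terms \<open>g\<^sub>l \<otimes> v\<^sub>l\<close>.\<close>

definition vec_continuous ::
  "(complex \<Rightarrow> 'm::ab_group_add \<Rightarrow> 'm) \<Rightarrow> ('a::topological_space \<Rightarrow> 'm) \<Rightarrow> bool" where
  "vec_continuous smul f \<longleftrightarrow>
    (\<forall>x. \<exists>U. open U \<and> x \<in> U \<and>
      (\<exists>(N::nat) (g :: nat \<Rightarrow> 'a \<Rightarrow> complex) (v :: nat \<Rightarrow> 'm).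
        (\<forall>l<N. continuous_on U (g l)) \<and>
        (\<forall>y\<in>U. f y = (\<Sum>l<N. smul (g l y) (v l)))))"

text \<open>The integral on \<open>L\<^sup>1(\<mu>) \<otimes> M\<close>, i.e. \<open>\<Sum>\<^sub>l g\<^sub>l \<otimes> v\<^sub>l \<mapsto> \<Sum>\<^sub>l (\<integral> g\<^sub>l d\<mu>) v\<^sub>l\<close>.
  It is well defined: see \<open>has_vec_integral_unique\<close>.\<close>

definition has_vec_integral ::
  "(complex \<Rightarrow> 'm::ab_group_add \<Rightarrow> 'm) \<Rightarrow> 'a measure \<Rightarrow> ('a \<Rightarrow> 'm) \<Rightarrow> 'm \<Rightarrow> bool" where
  "has_vec_integral smul \<mu> F I \<longleftrightarrow>
    (\<exists>(N::nat) (g :: nat \<Rightarrow> 'a \<Rightarrow> complex) (v :: nat \<Rightarrow> 'm).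
      (\<forall>l<N. integrable \<mu> (g l)) \<and>
      (\<forall>x\<in>space \<mu>. F x = (\<Sum>l<N. smul (g l x) (v l))) \<and>
      I = (\<Sum>l<N. smul (integral\<^sup>L \<mu> (g l)) (v l)))"

definition vec_integral ::
  "(complex \<Rightarrow> 'm::ab_group_add \<Rightarrow> 'm) \<Rightarrow> 'a measure \<Rightarrow> ('a \<Rightarrow> 'm) \<Rightarrow> 'm" where
  "vec_integral smul \<mu> F = (THE I. has_vec_integral smul \<mu> F I)"

text \<open>Euclidean volume on a (nonempty) affine subspace \<open>H\<close>: Lebesgue measure in orthonormal
  coordinates of \<open>H\<close> (compare the definition of \<open>lborel\<close>), viewed as a Borel measure on the
  ambient space that is concentrated on \<open>H\<close>.  It does not depend on the chosen base point \<open>p\<close> and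
  orthonormal basis \<open>B\<close> of the direction space.\<close>

definition affine_volume :: "'a::euclidean_space set \<Rightarrow> 'a measure" where
  "affine_volume H =
    (let p = (SOME p. p \<in> H);
         B = (SOME B. pairwise orthogonal B \<and> (\<forall>b\<in>B. norm b = 1) \<and>
                      span B = {x - y | x y. x \<in> H \<and> y \<in> H})
     in distr (\<Pi>\<^sub>M b\<in>B. lborel) borel (\<lambda>c. p + (\<Sum>b\<in>B. c b *\<^sub>R b)))"


section \<open>Test functions and weak eigenfunctions\<close>

definition partial :: "'n::finite \<Rightarrow> (real ^ 'n \<Rightarrow> complex) \<Rightarrow> real ^ 'n \<Rightarrow> complex" where
  "partial i \<phi> x = frechet_derivative \<phi> (at x) (axis i 1)"

primrec Ck :: "nat \<Rightarrow> (real ^ 'n::finite \<Rightarrow> complex) \<Rightarrow> bool" where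
  "Ck 0 \<phi> \<longleftrightarrow> continuous_on UNIV \<phi>"
| "Ck (Suc r) \<phi> \<longleftrightarrow> (\<forall>x. \<phi> differentiable at x) \<and> (\<forall>i. Ck r (partial i \<phi>))"

definition test_function :: "(real ^ 'n::finite \<Rightarrow> complex) \<Rightarrow> bool" where
  "test_function \<phi> \<longleftrightarrow> (\<forall>r. Ck r \<phi>) \<and> compact (closure {x. \<phi> x \<noteq> 0})"

definition laplacian :: "(real ^ 'n::finite \<Rightarrow> complex) \<Rightarrow> real ^ 'n \<Rightarrow> complex" where
  "laplacian \<phi> x = (\<Sum>i\<in>UNIV. partial i (partial i \<phi>) x)"

text \<open>The sum over \<open>m \<in> \<int>\<close> has only finitely many nonzero terms, since the support of \<open>\<phi>\<close>
  meets only finitely many hyperplanes; \<open>Sum_any\<close> is the sum over the nonzero terms.\<close>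

definition weak_eigenfunction ::
  "(complex \<Rightarrow> 'm::ab_group_add \<Rightarrow> 'm) \<Rightarrow>
   (('n::{finite,linorder} \<Rightarrow> 'n) \<times> (int ^ 'n::{finite,linorder}) \<Rightarrow> 'm \<Rightarrow> 'm) \<Rightarrow>
   complex \<Rightarrow> complex \<Rightarrow> (real ^ 'n::{finite,linorder} \<Rightarrow> 'm) \<Rightarrow> bool" where
  "weak_eigenfunction smul \<rho> k E f \<longleftrightarrow>
    (\<forall>\<phi>. test_function \<phi> \<longrightarrow>
      - vec_integral smul lborel (\<lambda>x. smul (laplacian \<phi> x) (f x))
      - smul k (\<Sum>(i, j)\<in>{(i, j). i < j}. Sum_any (\<lambda>m.
          smul (of_real (1 / sqrt 2))
            (vec_integral smul (affine_volume (hyperplane i j m))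
              (\<lambda>x. smul (\<phi> x) (\<rho> (affine_reflection i j m) (f x))))))
      = smul E (vec_integral smul lborel (\<lambda>x. smul (\<phi> x) (f x))))"


section \<open>Consistency of the definitions\<close>

lemma permute_vec_comp:
  assumes "w permutes UNIV" "w' permutes UNIV"
  shows "permute_vec (w \<circ> w') u = permute_vec w (permute_vec w' u)"
  using assms by (simp add: permute_vec_def vec_eq_iff o_inv_distrib permutes_bij)

lemma permute_vec_id [simp]: "permute_vec id u = u"
  by (simp add: permute_vec_def vec_eq_iff inv_id)

lemma permute_vec_add: "permute_vec w (u + v) = permute_vec w u + permute_vec w v"
  by (simp add: permute_vec_def vec_eq_iff)

lemma group_affine_sym_group: "Group.group affine_sym_group"
proof (rule groupI)
  fix g :: "('n \<Rightarrow> 'n) \<times> (int ^ 'n)" assume g: "g \<in> carrier affine_sym_group"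
  obtain w v where wv: "g = (w, v)" by force
  have w: "w permutes UNIV" using g wv by (simp add: affine_sym_group_def)
  let ?h = "(inv_into UNIV w, - permute_vec (inv_into UNIV w) v)"
  have "?h \<in> carrier affine_sym_group"
    using permutes_inv[OF w] by (simp add: affine_sym_group_def)
  moreover have "?h \<otimes>\<^bsub>affine_sym_group\<^esub> g = \<one>\<^bsub>affine_sym_group\<^esub>"
    using w wv by (simp add: affine_sym_group_def permutes_inv_o)
  ultimately show "\<exists>h\<in>carrier affine_sym_group. h \<otimes>\<^bsub>affine_sym_group\<^esub> g = \<one>\<^bsub>affine_sym_group\<^esub>"
    by blast
qed (auto simp: affine_sym_group_def permutes_compose permutes_id permute_vec_comp permute_vec_add
      comp_assoc add.assoc)

lemma affine_act_mult:
  assumes "g \<in> carrier affine_sym_group" "h \<in> carrier affine_sym_group"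
  shows "affine_act (g \<otimes>\<^bsub>affine_sym_group\<^esub> h) x = affine_act g (affine_act h x)"
  using assms
  by (auto simp: affine_sym_group_def affine_act_def permute_vec_comp permute_vec_def vec_eq_iff
      o_inv_distrib permutes_bij)

lemma affine_reflection_carrier: "affine_reflection i j m \<in> carrier affine_sym_group"
  by (simp add: affine_reflection_def affine_sym_group_def permutes_swap_id)

text \<open>The vector \<open>e\<^sub>j - e\<^sub>i\<close> is normal to the hyperplane and has squared norm 2.\<close>

lemma affine_act_affine_reflection:
  assumes "i \<noteq> j"
  shows "affine_act (affine_reflection i j m) x =
    x - (2 * (x $ j - x $ i - of_int m) / 2) *\<^sub>R (axis j 1 - axis i 1)"
  using assms
  by (auto simp: affine_act_def affine_reflection_def permute_vec_def vec_eq_iff axis_def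
      Transposition.transpose_def field_simps)

lemma has_vec_integral_unique:
  assumes "vector_space smul" and "has_vec_integral smul \<mu> F I" "has_vec_integral smul \<mu> F J"
  shows "I = J"
proof -
  interpret V: vector_space smul by fact
  obtain B where B: "V.independent B" "V.span B = UNIV"
    by (metis V.maximal_independent_subset[of UNIV] top.extremum_unique)
  define c where "c = V.representation B"
  have c_scale: "c (smul a v) b = a * c v b" for a v b
    using B by (simp add: c_def V.representation_scale)
  have c_sum: "c (\<Sum>l<N. h l) b = (\<Sum>l<N. c (h l) b)" for N :: nat and h b
    using B by (simp add: c_def V.representation_sum)
  have coord: "c I b = (\<integral>x. c (F x) b \<partial>\<mu>)" if H: "has_vec_integral smul \<mu> F I" for I b
  proof -
    obtain N :: nat and g v where g: "\<And>l. l < N \<Longrightarrow> integrable \<mu> (g l)"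
      and F: "\<And>x. x \<in> space \<mu> \<Longrightarrow> F x = (\<Sum>l<N. smul (g l x) (v l))"
      and I: "I = (\<Sum>l<N. smul (integral\<^sup>L \<mu> (g l)) (v l))"
      using H unfolding has_vec_integral_def by blast
    have "(\<integral>x. c (F x) b \<partial>\<mu>) = (\<integral>x. (\<Sum>l<N. g l x * c (v l) b) \<partial>\<mu>)"
      by (rule Bochner_Integration.integral_cong) (simp_all add: F c_sum c_scale)
    also have "\<dots> = (\<Sum>l<N. integral\<^sup>L \<mu> (g l) * c (v l) b)"
      using g by simp
    also have "\<dots> = c I b" by (simp add: I c_sum c_scale)
    finally show ?thesis by simp
  qed
  have "c I = c J" using coord assms(2,3) by fastforce
  then show ?thesis
    using V.unique_representation B V.sum_nonzero_representation_eq unfolding c_def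
    by (metis UNIV_I)
qed

end

theory Submission
  imports Defs
begin

text \<open>On each alcove a solution is a combination of the plane waves, so it is a family of coefficient
  vectors in \<open>M\<close>. By Green's formula the eigenvalue equation says that \<open>f\<close> is continuous and that its
  normal derivative jumps by a multiple of \<open>\<rho>(s) f\<close> across each wall. As the \<open>\<lambda>\<^sub>i\<close> are distinct, this
  determines the coefficients beyond a wall from those in front of it, which gives uniqueness. The
  operators doing so are divided differences twisted by \<open>\<rho>\<close>; they satisfy the inversion, commutation and
  braid relations, so transport along a gallery depends on its end point only, which gives existence.\<close>

section \<open>Alcoves and transport across their walls\<close>

text \<open>Two choices shape the proof. \<open>M\<close> has no topology, so the analysis is done
  for the scalar functions \<psi> o f with \<psi> a linear functional; functionals separate the
  points of \<open>M\<close>, and on compact sets a continuous f takes values in a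
  finite-dimensional subspace. Secondly, an alcove is recorded by the floors of the coordinate
  differences, and its walls are the pairs of neighbours in the periodic set of all numbers x_k + l.
  Crossing a wall exchanges two neighbours, so walking to the fundamental alcove becomes sorting,
  and path independence is a confluence argument in rank two. The factor k / 2 in the crossing
  operator is forced: continuity asks for a correction antisymmetric under exchanging the two plane
  waves that are proportional on the wall, and each of the two contributes half of the derivative
  jump k \<rho>(s) f. Green's formula is obtained line by line in coordinate directions: almost
  every such line meets the hyperplanes one at a time, so one-dimensional integration by parts
  suffices and the corners of the alcoves never enter.\<close>

definition regular :: "real ^ 'n::finite \<Rightarrow> bool" where
  "regular x \<longleftrightarrow> (\<forall>i j. i \<noteq> j \<longrightarrow> x $ i - x $ j \<notin> \<int>)"

text \<open>Two regular points lie in the same alcove iff these tables agree. Both orders of a pair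
  are kept; for regular points and i \<noteq> j the two entries add up to -1.\<close>

definition alc :: "real ^ 'n::finite \<Rightarrow> 'n \<Rightarrow> 'n \<Rightarrow> int" where
  "alc x i j = \<lfloor>x $ i - x $ j\<rfloor>"

text \<open>The action of \<open>affine_reflection i j m\<close> in coordinates (see
  \<open>affine_act_reflection\<close>): it exchanges x_j with x_i + m.\<close>

definition reflect :: "'n::finite \<Rightarrow> 'n \<Rightarrow> int \<Rightarrow> real ^ 'n \<Rightarrow> real ^ 'n" where
  "reflect i j m x =
    (\<chi> a. if a = i then x $ j - of_int m else if a = j then x $ i + of_int m else x $ a)"

text \<open>The hyperplane \<open>x\<^sub>j - x\<^sub>i = m\<close> is a wall of the alcove of \<open>x\<close> iff \<open>x\<^sub>j\<close> and \<open>x\<^sub>i + m\<close> are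
  neighbours among the numbers \<open>x\<^sub>k + l\<close>.\<close>

definition vals :: "real ^ 'n::finite \<Rightarrow> real set" where
  "vals x = {x $ k + of_int l | k l. True}"

definition wall :: "'n::finite \<Rightarrow> 'n \<Rightarrow> int \<Rightarrow> real ^ 'n \<Rightarrow> bool" where
  "wall i j m x \<longleftrightarrow>
    i \<noteq> j \<and> x $ j < x $ i + of_int m \<and> vals x \<inter> {x $ j<..<x $ i + of_int m} = {}"

text \<open>For regular points this is twice the number of hyperplanes separating x from y, as every
  hyperplane is counted for (i, j) and for (j, i).\<close>

definition alc_dist :: "real ^ 'n::finite \<Rightarrow> real ^ 'n \<Rightarrow> nat" where
  "alc_dist x y = (\<Sum>i\<in>UNIV. \<Sum>j\<in>UNIV. nat \<bar>alc x i j - alc y i j\<bar>)"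

section \<open>Reflections, walls and the number of separating hyperplanes\<close>

lemma reflect_nth:
  "reflect i j m x $ a = (if a = i then x $ j - of_int m else if a = j then x $ i + of_int m else x $ a)"
  by (simp add: reflect_def)

lemma regular_nth: "regular x \<Longrightarrow> i \<noteq> j \<Longrightarrow> x $ i \<noteq> x $ j + of_int m"
  unfolding regular_def by (metis Ints_of_int add_diff_cancel_left')

lemma regular_nth': "regular x \<Longrightarrow> i \<noteq> j \<Longrightarrow> x $ i + of_int m \<noteq> x $ j + of_int m'"
  using regular_nth[of x i j "m' - m"] by auto

lemma alc_less_iff: "regular x \<Longrightarrow> i \<noteq> j \<Longrightarrow> x $ j < x $ i + of_int m \<longleftrightarrow> alc x j i < m"
  unfolding alc_def by (metis diff_less_eq floor_less_iff add.commute)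

lemma alc_greater_iff: "regular x \<Longrightarrow> i \<noteq> j \<Longrightarrow> x $ i + of_int m < x $ j \<longleftrightarrow> m \<le> alc x j i"
  using alc_less_iff[of x i j m] regular_nth[of x j i m] by force

lemma alc_self [simp]: "alc x i i = 0"
  by (simp add: alc_def)

lemma valsI: "x $ k + of_int l \<in> vals x"
  by (auto simp: vals_def)

lemma valsI_diff: "x $ k - of_int l \<in> vals x"
  using valsI[of x k "-l"] by simp

lemma vals_shift: "t \<in> vals x \<Longrightarrow> t + of_int m \<in> vals x"
  unfolding vals_def by clarsimp (metis add.assoc of_int_add)

text \<open>The reflection exchanges the classes x_i + \<int> and x_j + \<int> and fixes the others,
  so neighbours may be sought in the same periodic set before and after a crossing.\<close>

lemma vals_reflect:
  assumes "i \<noteq> j"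
  shows "vals (reflect i j m x) = vals x"
proof -
  have sub: "vals (reflect i j m x) \<subseteq> vals x" for x :: "real ^ 'a"
  proof
    fix t assume "t \<in> vals (reflect i j m x)"
    then obtain k l where t: "t = reflect i j m x $ k + of_int l" by (auto simp: vals_def)
    show "t \<in> vals x"
      using valsI_diff[of x j m, THEN vals_shift[of _ _ l]]
        valsI[of x i m, THEN vals_shift[of _ _ l]] valsI[of x k l] t
      by (auto simp: reflect_nth split: if_splits)
  qed
  have "reflect i j m (reflect i j m x) = x"
    using assms by (auto simp: vec_eq_iff reflect_nth)
  with sub[of x] sub[of "reflect i j m x"] show ?thesis by auto
qed

lemma reflect_reflect [simp]: "i \<noteq> j \<Longrightarrow> reflect i j m (reflect i j m x) = x"
  by (auto simp: vec_eq_iff reflect_nth)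

lemma reflect_swap: "i \<noteq> j \<Longrightarrow> reflect j i (-m) x = reflect i j m x"
  by (auto simp: vec_eq_iff reflect_nth)

lemma regular_reflect:
  assumes "i \<noteq> j" "regular x"
  shows "regular (reflect i j m x)"
  unfolding regular_def
proof (intro allI impI notI)
  fix a b :: 'a assume "a \<noteq> b" and "reflect i j m x $ a - reflect i j m x $ b \<in> \<int>"
  then obtain l where l: "reflect i j m x $ a = reflect i j m x $ b + of_int l"
    by (metis Ints_cases add.commute diff_add_cancel)
  define \<sigma> where "\<sigma> = Transposition.transpose i j"
  have *: "\<exists>p. reflect i j m x $ a = x $ \<sigma> a + of_int p" for a
    by (cases "a = i"; cases "a = j")
      (auto simp: reflect_nth \<sigma>_def intro: exI[of _ "-m"] exI[of _ m] exI[of _ 0])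
  obtain p q where "reflect i j m x $ a = x $ \<sigma> a + of_int p" "reflect i j m x $ b = x $ \<sigma> b + of_int q"
    using * by blast
  with l have "x $ \<sigma> a + of_int p = x $ \<sigma> b + of_int (q + l)" by simp
  moreover have "\<sigma> a \<noteq> \<sigma> b"
    using \<open>a \<noteq> b\<close> by (auto simp: \<sigma>_def transpose_eq_iff)
  ultimately show False using regular_nth'[OF assms(2)] by blast
qed

lemma wall_empty: "wall i j m x \<Longrightarrow> x $ j < t \<Longrightarrow> t < x $ i + of_int m \<Longrightarrow> t \<notin> vals x"
  by (auto simp: wall_def)

lemma wall_reflect: "wall i j m x \<Longrightarrow> wall j i (-m) (reflect i j m x)"
proof -
  assume w: "wall i j m x"
  have "t \<notin> vals x" if "x $ j - of_int m < t" "t < x $ i" for t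
    using wall_empty[OF w, of "t + of_int m"] vals_shift[of t x m] that by auto
  then show ?thesis using w by (auto simp: wall_def vals_reflect reflect_nth)
qed

text \<open>The interval of a wall does not contain x_i + (m - 1) either, so its length is below
  one.\<close>

lemma wall_alc:
  assumes "wall i j m x" "regular x"
  shows "alc x j i = m - 1" "alc x i j = - m"
proof -
  have ij: "i \<noteq> j" and lt: "x $ j < x $ i + of_int m"
    using assms(1) by (auto simp: wall_def)
  have "\<not> x $ j < x $ i + of_int (m - 1)"
    using wall_empty[OF assms(1), of "x $ i + of_int (m - 1)"] valsI[of x i "m - 1"] by auto
  then have "x $ i + of_int (m - 1) < x $ j"
    using regular_nth[OF assms(2), of j i "m - 1"] ij by auto
  with lt show "alc x j i = m - 1" "alc x i j = - m"
    unfolding alc_def by (simp_all add: floor_eq_iff)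
qed

text \<open>No third value lies between the neighbours x_j and x_i + m, so exchanging them alters no
  comparison with a value x_k + l for another k.\<close>

lemma alc_reflect_other:
  assumes w: "wall i j m x" and reg: "regular x" and ab: "{a, b} \<noteq> {i, j}"
  shows "alc (reflect i j m x) a b = alc x a b"
proof -
  have ij: "i \<noteq> j" and lt: "x $ j < x $ i + of_int m" using w by (auto simp: wall_def)
  note reg' = regular_reflect[OF ij reg]
  have cmp: "x $ k + of_int l < x $ i + of_int m \<longleftrightarrow> x $ k + of_int l < x $ j"
    if "k \<noteq> i" "k \<noteq> j" for k l
    using wall_empty[OF w, of "x $ k + of_int l"] valsI[of x k l] regular_nth'[OF reg that(2), of l 0]
      lt by fastforce
  have less: "\<And>a b l. \<lbrakk>a \<noteq> b; {a, b} \<noteq> {i, j}\<rbrakk> \<Longrightarrow>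
    reflect i j m x $ a < reflect i j m x $ b + of_int l \<longleftrightarrow> x $ a < x $ b + of_int l"
  proof -
    fix a b l assume ab: "a \<noteq> b" "{a, b} \<noteq> {i, j}"
    have *: "x $ a < x $ k + of_int l \<longleftrightarrow> \<not> x $ k + of_int l < x $ a" if "k \<noteq> a" for k l
      using regular_nth[OF reg that[symmetric], of l] by auto
    consider "a = i" "b \<noteq> i" "b \<noteq> j" | "a = j" "b \<noteq> i" "b \<noteq> j" | "b = i" "a \<noteq> i" "a \<noteq> j"
      | "b = j" "a \<noteq> i" "a \<noteq> j" | "a \<noteq> i" "a \<noteq> j" "b \<noteq> i" "b \<noteq> j"
      using ab by (metis insert_commute)
    then show "reflect i j m x $ a < reflect i j m x $ b + of_int l \<longleftrightarrow> x $ a < x $ b + of_int l"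
    proof cases
      case 1
      have "x $ i < x $ b + of_int l \<longleftrightarrow> \<not> x $ b + of_int (l + m) < x $ i + of_int m"
        using *[of b l] 1 by auto
      also have "\<dots> \<longleftrightarrow> \<not> x $ b + of_int (l + m) < x $ j" using cmp[of b "l+m"] 1 by simp
      also have "\<dots> \<longleftrightarrow> x $ j < x $ b + of_int (l + m)"
        using regular_nth[OF reg, of j b "l+m"] 1 by auto
      finally show ?thesis using 1 ij by (auto simp: reflect_nth)
    next
      case 2
      have "x $ j < x $ b + of_int l \<longleftrightarrow> \<not> x $ b + of_int l < x $ j"
        using *[of b l] 2 by auto
      also have "\<dots> \<longleftrightarrow> \<not> x $ b + of_int l < x $ i + of_int m" using cmp[of b "l"] 2 by simp
      also have "\<dots> \<longleftrightarrow> x $ i + of_int m < x $ b + of_int l"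
        using regular_nth'[OF reg, of i b m "l"] 2 by auto
      finally show ?thesis using 2 ij by (auto simp: reflect_nth)
    next
      case 3
      then show ?thesis using cmp[of a "m - l"] ij by (auto simp: reflect_nth)
    next
      case 4
      then show ?thesis using cmp[of a "- l"] ij by (auto simp: reflect_nth)
    qed (auto simp: reflect_nth)
  qed
  show ?thesis
  proof (cases "a = b")
    case False
    then have ba: "b \<noteq> a" by simp
    have "alc (reflect i j m x) a b < l \<longleftrightarrow> alc x a b < l" for l
      using less[OF False ab, of l] by (simp add: alc_less_iff[OF reg ba] alc_less_iff[OF reg' ba])
    from this[of "alc x a b"] this[of "alc (reflect i j m x) a b"] show ?thesis by linarith
  qed simp
qed

text \<open>A crossing changes side with respect to a single hyperplane: the entry (j, i) rises from
  m - 1 to m, and (i, j) falls from - m to - m - 1.\<close>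

lemma alc_reflect:
  assumes w: "wall i j m x" and reg: "regular x"
  shows "alc (reflect i j m x) a b =
    (if a = j \<and> b = i then m else if a = i \<and> b = j then - m - 1 else alc x a b)"
proof -
  have ij: "i \<noteq> j" using w by (auto simp: wall_def)
  have "alc (reflect i j m x) i j = - m - 1" "alc (reflect i j m x) j i = m"
    using wall_alc[OF wall_reflect[OF w] regular_reflect[OF ij reg]] by simp_all
  then show ?thesis using alc_reflect_other[OF w reg, of a b] ij by (auto simp: doubleton_eq_iff)
qed

lemma alc_reflect_cong:
  assumes "wall i j m x" "regular x" "wall i j m y" "regular y" "alc x = alc y"
  shows "alc (reflect i j m x) = alc (reflect i j m y)"
  using assms by (intro ext) (simp add: alc_reflect)

text \<open>The order of all numbers x_k + l can be recovered from the floors, so having a given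
  wall is a property of the alcove.\<close>

lemma wall_cong:
  assumes "regular x" "regular y" "alc x = alc y"
  shows "wall i j m x \<longleftrightarrow> wall i j m y"
proof -
  have "wall i j m y" if w: "wall i j m x" and reg: "regular x" "regular y" and e: "alc x = alc y" for x y
  proof -
    have ij: "i \<noteq> j" using w by (simp add: wall_def)
    have less: "x $ a + of_int p < x $ b + of_int q \<longleftrightarrow> y $ a + of_int p < y $ b + of_int q" for a b p q
    proof (cases "a = b")
      case False
      then show ?thesis
        using alc_less_iff[OF reg(1), of b a "q - p"] alc_less_iff[OF reg(2), of b a "q - p"] e
        by auto
    qed auto
    have "t \<notin> vals y" if "y $ j < t" "t < y $ i + of_int m" for t
    proof
      assume "t \<in> vals y"
      then obtain k l where t: "t = y $ k + of_int l" by (auto simp: vals_def)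
      then show False
        using that less[of j 0 k l] less[of k l i m] wall_empty[OF w, of "x $ k + of_int l"] valsI[of x k l]
        by auto
    qed
    then show ?thesis using less[of j 0 i m] w ij by (auto simp: wall_def)
  qed
  then show ?thesis using assms by metis
qed

text \<open>The hyperplane separates x from y, so both changed entries move one step towards those
  of y; this is the 2.\<close>

lemma alc_dist_reflect:
  assumes w: "wall i j m x" and reg: "regular x" "regular y" and sep: "y $ i + of_int m < y $ j"
  shows "alc_dist x y = alc_dist (reflect i j m x) y + 2"
proof -
  have ij: "i \<noteq> j" using w by (simp add: wall_def)
  have y1: "m \<le> alc y j i" using alc_greater_iff[OF reg(2) ij] sep by simp
  have "y $ i < y $ j + of_int (- m)" using sep by simp
  then have y2: "alc y i j < - m" using alc_less_iff[OF reg(2), of j i "- m"] ij by simp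
  have e: "nat \<bar>alc x a b - alc y a b\<bar> = nat \<bar>alc (reflect i j m x) a b - alc y a b\<bar>
      + ((if a = i then (if b = j then 1 else 0) else 0) + (if a = j then (if b = i then 1 else 0) else 0))" for a b
    using wall_alc[OF w reg(1)] alc_reflect[OF w reg(1), of a b] y1 y2 ij by auto
  show ?thesis
    unfolding alc_dist_def e sum.distrib by (simp add: sum.If_cases)
qed

text \<open>Among the hyperplanes separating x from y choose one with the smallest gap x_i + m -
  x_j: a value inside the gap would give a separating hyperplane with a smaller gap.\<close>

lemma exists_separating_wall:
  assumes reg: "regular x" "regular y" and ne: "alc x \<noteq> alc y"
  obtains i j m where "wall i j m x" "y $ i + of_int m < y $ j"
proof -
  define I where "I = {(i, j, m). i \<noteq> j \<and> x $ j < x $ i + of_int m \<and> y $ i + of_int m < y $ j}"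
  define gap where "gap = (\<lambda>(i, j, m). x $ i + of_int m - x $ j)"
  have "I \<subseteq> (\<Union>i. \<Union>j. (\<lambda>m. (i, j, m)) ` {alc x j i<..alc y j i})"
    unfolding I_def using alc_less_iff[OF reg(1)] alc_greater_iff[OF reg(2)] by fastforce
  then have fin: "finite I" by (rule finite_subset) auto
  obtain a b where ab: "alc x a b \<noteq> alc y a b" using ne by (auto simp: fun_eq_iff)
  then have "a \<noteq> b" by auto
  have "I \<noteq> {}"
  proof (cases "alc x a b < alc y a b")
    case True
    then have "(b, a, alc x a b + 1) \<in> I"
      unfolding I_def using \<open>a \<noteq> b\<close> alc_less_iff[OF reg(1), of b a "alc x a b + 1"]
        alc_greater_iff[OF reg(2), of b a "alc x a b + 1"] by auto
    then show ?thesis by auto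
  next
    case False
    then have "(a, b, - alc x a b) \<in> I"
      unfolding I_def using \<open>a \<noteq> b\<close> ab alc_less_iff[OF reg(2), of b a "alc x a b"]
        alc_greater_iff[OF reg(1), of b a "alc x a b"] by auto
    then show ?thesis by auto
  qed
  with fin obtain t where t: "t \<in> I" and min: "\<And>u. u \<in> I \<Longrightarrow> gap t \<le> gap u"
    using ex_is_arg_min_if_finite[OF fin, of gap] unfolding is_arg_min_linorder by blast
  obtain i j m where ijm: "t = (i, j, m)" by (cases t)
  have ij: "i \<noteq> j" and lt: "x $ j < x $ i + of_int m" and gt: "y $ i + of_int m < y $ j"
    using t ijm by (auto simp: I_def)
  have "v \<notin> vals x" if v: "x $ j < v" "v < x $ i + of_int m" for v
  proof
    assume "v \<in> vals x"
    then obtain k l where kl: "v = x $ k + of_int l" by (auto simp: vals_def)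
    \<comment> \<open>The point y decides: if y_k + l lies below y_j, then (k, j, l) separates,
      otherwise (i, k, m - l) does. For k = i or k = j only the level is shifted.\<close>
    consider "k = j" | "k = i" "k \<noteq> j" | "k \<noteq> i" "k \<noteq> j" "y $ k + of_int l < y $ j"
      | "k \<noteq> i" "k \<noteq> j" "y $ j < y $ k + of_int l"
      using regular_nth[OF reg(2), of j k l] by fastforce
    then show False
    proof cases
      case 1
      then have "(i, j, m - l) \<in> I" using kl v ij gt by (auto simp: I_def)
      from min[OF this] show False using kl v 1 by (auto simp: gap_def ijm)
    next
      case 2
      then have "(i, j, l) \<in> I" using kl v ij gt by (auto simp: I_def)
      from min[OF this] show False using kl v 2 by (auto simp: gap_def ijm)
    next
      case 3
      then have "(k, j, l) \<in> I" using kl v ij gt by (auto simp: I_def)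
      from min[OF this] show False using kl v 3 by (auto simp: gap_def ijm)
    next
      case 4
      then have "(i, k, m - l) \<in> I" using kl v ij gt by (auto simp: I_def)
      from min[OF this] show False using kl v 4 by (auto simp: gap_def ijm)
    qed
  qed
  then have "wall i j m x" using ij lt by (auto simp: wall_def)
  then show thesis using gt that by blast
qed

text \<open>\<open>R i j m\<close> carries data from the side x_j - x_i < m of a hyperplane to the
  other side. \<open>R_inverse\<close> is crossing back. In \<open>R_braid\<close> the hyperplanes
  x_a - x_b = m, x_b - x_d = m' and x_a - x_d = m + m' meet in codimension two, and the two sides of
  the equation are the two ways around. The data are abstract, so that only these relations enter
  path independence.\<close>

locale crossing =
  fixes R :: "'n::finite \<Rightarrow> 'n \<Rightarrow> int \<Rightarrow> 'c \<Rightarrow> 'c" and xb :: "real ^ 'n" and cb :: 'c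
  assumes regular_base: "regular xb"
    and R_inverse: "i \<noteq> j \<Longrightarrow> R j i (- m) (R i j m c) = c"
    and R_commute: "distinct [i, j, i', j'] \<Longrightarrow> R i j m (R i' j' m' c) = R i' j' m' (R i j m c)"
    and R_braid: "distinct [a, b, d] \<Longrightarrow>
      R d b m' (R d a (m + m') (R b a m c)) = R b a m (R d a (m + m') (R d b m' c))"
begin

definition descent :: "'n \<Rightarrow> 'n \<Rightarrow> int \<Rightarrow> real ^ 'n \<Rightarrow> bool" where
  "descent i j m x \<longleftrightarrow> wall i j m x \<and> xb $ i + of_int m < xb $ j"

lemma alc_dist_descent:
  "regular x \<Longrightarrow> descent i j m x \<Longrightarrow> alc_dist (reflect i j m x) xb < alc_dist x xb"
  using alc_dist_reflect[of i j m x xb] regular_base by (auto simp: descent_def)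

text \<open>Walks home through an arbitrarily chosen descent and undoes the step with the inverse
  crossing; independence of the choice is \<open>transport_descent\<close>. The test after
  \<open>SOME\<close> makes the recursion terminate and stops with \<open>cb\<close> in the base
  alcove, where no triple passes it.\<close>

function transport :: "real ^ 'n \<Rightarrow> 'c" where
  "transport x = (case SOME (i, j, m). descent i j m x of (i, j, m) \<Rightarrow>
     if regular x \<and> descent i j m x then R j i (- m) (transport (reflect i j m x)) else cb)"
  by pat_completeness auto
termination
  by (relation "Wellfounded.measure (\<lambda>x. alc_dist x xb)") (auto intro: alc_dist_descent)

declare transport.simps [simp del]

lemma descent_cong:
  assumes "regular x" "regular y" "alc x = alc y"
  shows "descent i j m x \<longleftrightarrow> descent i j m y"
  using wall_cong[OF assms] by (simp add: descent_def)

lemma descent_imp: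
  assumes "descent i j m x"
  shows "i \<noteq> j" "wall i j m x" "x $ j < x $ i + of_int m" "xb $ i + of_int m < xb $ j"
  using assms by (auto simp: descent_def wall_def)

lemma transport_choice:
  assumes "regular x" "descent i j m x"
  obtains i' j' m' where "(SOME (i, j, m). descent i j m x) = (i', j', m')" "descent i' j' m' x"
    "transport x = R j' i' (- m') (transport (reflect i' j' m' x))"
proof -
  obtain i' j' m' where c: "(SOME (i, j, m). descent i j m x) = (i', j', m')"
    by (metis prod_cases3)
  moreover have "case SOME (i, j, m). descent i j m x of (i, j, m) \<Rightarrow> descent i j m x"
    using assms(2) by (intro someI[where P = "\<lambda>(i, j, m). descent i j m x" and x = "(i, j, m)"]) simp
  ultimately have "descent i' j' m' x" by simp
  then show thesis using that c assms(1) by (subst (asm) transport.simps) (auto simp: transport.simps[of x])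
qed

lemma transport_no_descent:
  assumes "\<And>i j m. \<not> descent i j m x"
  shows "transport x = cb"
  using assms by (subst transport.simps) (auto split: prod.split)

lemma transport_cong:
  "regular x \<Longrightarrow> regular y \<Longrightarrow> alc x = alc y \<Longrightarrow> transport x = transport y"
proof (induction "alc_dist x xb" arbitrary: x y rule: less_induct)
  case less
  note d = descent_cong[OF less.prems]
  show ?case
  proof (cases "\<exists>i j m. descent i j m x")
    case False
    then show ?thesis using d by (metis transport_no_descent)
  next
    case True
    then obtain i j m where x: "(SOME (i, j, m). descent i j m x) = (i, j, m)" "descent i j m x"
      "transport x = R j i (- m) (transport (reflect i j m x))"
      using transport_choice less.prems(1) by metis
    \<comment> \<open>The predicates under \<open>SOME\<close> are equal for x and y, hence so are
      the chosen triples.\<close>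
    have y: "(SOME (i, j, m). descent i j m y) = (i, j, m)" "descent i j m y"
      using x d by auto
    then have ty: "transport y = R j i (- m) (transport (reflect i j m y))"
      using less.prems(2) by (subst transport.simps) simp
    have "transport (reflect i j m x) = transport (reflect i j m y)"
      using less.prems descent_imp[OF x(2)] descent_imp[OF y(2)] x(2)
      by (intro less.hyps alc_dist_descent regular_reflect alc_reflect_cong)
    then show ?thesis using x ty by simp
  qed
qed

text \<open>A diamond argument: two distinct descents use disjoint index pairs and commute, or have the form
  \<open>(b, a)\<close>, \<open>(d, b)\<close> and start the two halves of a hexagon closed by the braid relation.\<close>

lemma transport_descent:
  "regular x \<Longrightarrow> descent i j m x \<Longrightarrow> transport x = R j i (- m) (transport (reflect i j m x))"
proof (induction "alc_dist x xb" arbitrary: x i j m rule: less_induct)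
  case less
  note reg = \<open>regular x\<close>
  have IH: "transport y = R q p (- l) (transport (reflect p q l y))"
    if "regular y" "descent p q l y" "alc_dist y xb < alc_dist x xb" for y p q l
    using less.hyps that by blast
  \<comment> \<open>Disjoint index pairs: crossing one of the two walls leaves the other one a
    descent, and both orders of reflecting give the same point.\<close>
  have commuting: "R j i (- m) (transport (reflect i j m x)) = R j' i' (- m') (transport (reflect i' j' m' x))"
    if d: "descent i j m x" "descent i' j' m' x" and dist: "distinct [i, j, i', j']" for i j m i' j' m'
  proof -
    note w = descent_imp[OF d(1)] and w' = descent_imp[OF d(2)]
    have "descent i' j' m' (reflect i j m x)" "descent i j m (reflect i' j' m' x)"
      using d dist by (auto simp: descent_def wall_def vals_reflect reflect_nth)
    then have "transport (reflect i j m x) = R j' i' (- m') (transport (reflect i' j' m' (reflect i j m x)))"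
      "transport (reflect i' j' m' x) = R j i (- m) (transport (reflect i j m (reflect i' j' m' x)))"
      using IH regular_reflect[OF _ reg] alc_dist_descent[OF reg] d w w' by blast+
    moreover have "reflect i' j' m' (reflect i j m x) = reflect i j m (reflect i' j' m' x)"
      using dist by (auto simp: vec_eq_iff reflect_nth)
    ultimately show ?thesis using dist R_commute[of j i j' i'] by auto
  qed
  have braiding: "R a b (- m) (transport (reflect b a m x)) = R b d (- m') (transport (reflect d b m' x))"
    if d: "descent b a m x" "descent d b m' x" and ad: "a \<noteq> d" for a b d m m'
  proof -
    note w = descent_imp[OF d(1)] and w' = descent_imp[OF d(2)]
    have dist: "distinct [a, b, d]" using w(1) w'(1) ad by auto
    \<comment> \<open>The values x_a, x_b + m, x_d + m + m' are consecutive, and at the base point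
      their order is reversed. The hexagon consists of the two ways to reverse three neighbours by
      adjacent exchanges.\<close>
    have e1: "t \<notin> vals x" if "x $ a < t" "t < x $ b + of_int m" for t
      using wall_empty[OF w(2)] that by blast
    have e2: "t \<notin> vals x" if "x $ b + of_int l < t" "t < x $ d + of_int (l + m')" for t l
      using wall_empty[OF w'(2), of "t - of_int l"] vals_shift[of t x "- l"] that by auto
    have e3: "t \<notin> vals x" if "x $ a - of_int m < t" "t < x $ b" for t
      using e1[of "t + of_int m"] vals_shift[of t x m] that by auto
    let ?x1 = "reflect b a m x" and ?y1 = "reflect d b m' x"
    let ?x2 = "reflect d a (m + m') ?x1" and ?y2 = "reflect d a (m + m') ?y1"
    have x1: "regular ?x1" "alc_dist ?x1 xb < alc_dist x xb"
      and y1: "regular ?y1" "alc_dist ?y1 xb < alc_dist x xb"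
      using regular_reflect[OF _ reg] alc_dist_descent[OF reg] d w(1) w'(1) by auto
    have dx1: "descent d a (m + m') ?x1"
      using dist e2[of m] w w' by (auto simp: descent_def wall_def vals_reflect reflect_nth algebra_simps)
    have dy1: "descent d a (m + m') ?y1"
      using dist e1 w w' by (auto simp: descent_def wall_def vals_reflect reflect_nth algebra_simps)
    have x2: "regular ?x2" "alc_dist ?x2 xb < alc_dist x xb"
      and y2: "regular ?y2" "alc_dist ?y2 xb < alc_dist x xb"
      using regular_reflect[OF _ x1(1), of d a] alc_dist_descent[OF x1(1) dx1] x1
        regular_reflect[OF _ y1(1), of d a] alc_dist_descent[OF y1(1) dy1] y1 ad by auto
    have dx2: "descent d b m' ?x2"
      using dist e3 w w' by (auto simp: descent_def wall_def vals_reflect reflect_nth algebra_simps)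
    have dy2: "descent b a m ?y2"
      using dist e2[of m] w w' by (auto simp: descent_def wall_def vals_reflect reflect_nth algebra_simps)
    have "transport ?x1 = R a d (- (m + m')) (R b d (- m') (transport (reflect d b m' ?x2)))"
      using IH[OF x1(1) dx1 x1(2)] IH[OF x2(1) dx2 x2(2)] by simp
    moreover have "transport ?y1 = R a d (- (m + m')) (R a b (- m) (transport (reflect b a m ?y2)))"
      using IH[OF y1(1) dy1 y1(2)] IH[OF y2(1) dy2 y2(2)] by simp
    moreover have "reflect d b m' ?x2 = reflect b a m ?y2"
      using dist by (auto simp: vec_eq_iff reflect_nth)
    ultimately show ?thesis
      using R_braid[of d b a "- m" "- m'"] dist by (auto simp: algebra_simps)
  qed
  obtain i' j' m' where d': "descent i' j' m' x"
    and t: "transport x = R j' i' (- m') (transport (reflect i' j' m' x))"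
    using transport_choice[OF less.prems] by metis
  note d = \<open>descent i j m x\<close>
  note w = descent_imp[OF d] and w' = descent_imp[OF d']
  consider "distinct [i, j, i', j']" | "i = i'" | "j = j'" | "i = j'" "i' \<noteq> j" | "i' = j" "i \<noteq> j'"
    | "i = j'" "i' = j"
    using w(1) w'(1) by auto
  then show ?case
  proof cases
    case 1
    then show ?thesis using commuting[OF d d'] t by simp
  next
    case 2
    \<comment> \<open>Only one number is the lower neighbour of x_i + m.\<close>
    have *: "\<not> x $ q < x $ q' + of_int (l - l')" if "wall p q l x" "wall p q' l' x" for p q q' l l'
      using wall_empty[OF that(1), of "x $ q' + of_int (l - l')"] valsI[of x q' "l - l'"] that
      by (auto simp: wall_def)
    have "x $ j = x $ j' + of_int (m - m')"
      using *[of i j m j' m'] *[of i j' m' j m] w(2) w'(2) 2 by auto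
    moreover from this have "j = j'" using regular_nth[OF reg, of j j' "m - m'"] by blast
    ultimately have "j = j'" "m = m'" by auto
    then show ?thesis using 2 t by simp
  next
    case 3
    \<comment> \<open>Likewise the upper neighbour of x_j is unique.\<close>
    have *: "\<not> x $ p' + of_int l' < x $ p + of_int l" if "wall p q l x" "wall p' q l' x" for p p' q l l'
      using wall_empty[OF that(1), of "x $ p' + of_int l'"] valsI[of x p' l'] that
      by (auto simp: wall_def)
    have "x $ i + of_int m = x $ i' + of_int m'"
      using *[of i j m i' m'] *[of i' j m' i m] w(2) w'(2) 3 by auto
    moreover from this have "i = i'" using regular_nth'[OF reg, of i i' m m'] by blast
    ultimately have "i = i'" "m = m'" by auto
    then show ?thesis using 3 t by simp
  next
    case 4
    then show ?thesis using braiding[of i j m i' m'] d d' t by simp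
  next
    case 5
    then show ?thesis using braiding[of i' j' m' i m] d d' t by auto
  next
    case 6
    \<comment> \<open>The walls give m + m' > 0 at x, while the base point gives m + m' < 0.\<close>
    then show ?thesis using w w' by auto
  qed
qed

text \<open>Depending on the side of the base point, the wall is a descent of x or, seen from
  behind, of the reflected point.\<close>

lemma transport_wall:
  assumes "regular x" "wall i j m x"
  shows "transport (reflect i j m x) = R i j m (transport x)"
proof -
  have ij: "i \<noteq> j" using assms(2) by (simp add: wall_def)
  show ?thesis
  proof (cases "xb $ i + of_int m < xb $ j")
    case True
    then have "transport x = R j i (- m) (transport (reflect i j m x))"
      using assms by (intro transport_descent) (auto simp: descent_def)
    then show ?thesis using R_inverse[of j i "- m"] ij by simp
  next
    case False
    then have "descent j i (- m) (reflect i j m x)"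
      using wall_reflect[OF assms(2)] regular_nth[OF regular_base, of j i m] ij
      by (auto simp: descent_def)
    from transport_descent[OF regular_reflect[OF ij assms(1)] this]
    show ?thesis using ij reflect_swap[OF ij, of m "reflect i j m x"] by simp
  qed
qed

lemma transport_base:
  assumes "regular x" "alc x = alc xb"
  shows "transport x = cb"
proof (rule transport_no_descent)
  fix i j m
  show "\<not> descent i j m x"
    using wall_alc[of i j m x] assms alc_greater_iff[OF regular_base, of i j m]
    by (auto simp: descent_def wall_def)
qed

end

section \<open>Divided differences and the operators of wall crossing\<close>

text \<open>Coordinates with respect to a basis of the whole space are linear functionals. This is
  what reduces identities in \<open>M\<close> to complex ones.\<close>

lemma functional_separates:
  fixes smul :: "complex \<Rightarrow> 'm::ab_group_add \<Rightarrow> 'm"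
  assumes "vector_space smul" and eq: "\<And>\<psi>. Vector_Spaces.linear smul (*) \<psi> \<Longrightarrow> \<psi> a = \<psi> b"
  shows "a = b"
proof -
  interpret V: vector_space smul by fact
  obtain B where B: "V.independent B" "V.span B = UNIV"
    by (metis V.maximal_independent_subset[of UNIV] top.extremum_unique)
  have cv: "vector_space ((*) :: complex \<Rightarrow> complex \<Rightarrow> complex)"
    by unfold_locales (simp_all add: algebra_simps)
  have "Vector_Spaces.linear smul (*) (\<lambda>v. V.representation B v c)" for c
    using B cv assms(1)
    by (intro Vector_Spaces.linear_iff[THEN iffD2]) (auto simp: V.representation_add V.representation_scale)
  then have "V.representation B a = V.representation B b" using eq by blast
  then show ?thesis
    by (metis B UNIV_I V.sum_nonzero_representation_eq)
qed

text \<open>Let \<mu> be w \<open>lam\<close> and s the transposition of i \<noteq> j. After a twist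
  by the sign of w this is the usual divided difference (F(w) - F(s w)) / (\<mu>_i - \<mu>_j) on the
  orbit of \<open>lam\<close>.\<close>

definition ddiff ::
  "(complex \<Rightarrow> 'm \<Rightarrow> 'm::ab_group_add) \<Rightarrow> complex ^ 'n::finite \<Rightarrow> 'n \<Rightarrow> 'n \<Rightarrow> (('n \<Rightarrow> 'n) \<Rightarrow> 'm) \<Rightarrow> ('n \<Rightarrow> 'n) \<Rightarrow> 'm" where
  "ddiff smul lam i j d w =
    smul (1 / (permute_vec w lam $ i - permute_vec w lam $ j)) (d w + d (Transposition.transpose i j \<circ> w))"

lemma permute_vec_transpose:
  assumes "w permutes UNIV"
  shows "permute_vec (Transposition.transpose i j \<circ> w) u $ a = permute_vec w u $ Transposition.transpose i j a"
  using assms by (simp add: permute_vec_def o_inv_distrib permutes_bij)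

lemma permutes_transpose_comp:
  "w permutes UNIV \<Longrightarrow> (Transposition.transpose i j \<circ> w) permutes UNIV"
  by (simp add: permutes_compose permutes_swap_id)

lemma transpose_invol: "Transposition.transpose i j \<circ> (Transposition.transpose i j \<circ> w) = w"
  by (auto simp: fun_eq_iff)

lemma permute_vec_distinct:
  assumes "\<And>i j. i \<noteq> j \<Longrightarrow> lam $ i \<noteq> lam $ j" "w permutes UNIV" "i \<noteq> j"
  shows "permute_vec w lam $ i \<noteq> permute_vec w lam $ j"
  using assms by (simp add: permute_vec_def) (metis permutes_inv_eq)

text \<open>The orbit of w under s1 and s3 has at most six points. With x, y, z and the six values
  of d as free variables the claims are identities of rational functions. The first two are the
  quadratic relations of the Fomin-Kirillov algebra, the third is the braid relation.\<close>

lemma rational_braid: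
  fixes s1 s2 s3 :: "'w \<Rightarrow> 'w" and X Y Z d :: "'w \<Rightarrow> complex"
  assumes S: "\<And>v. v \<in> S \<Longrightarrow> s1 v \<in> S" "\<And>v. v \<in> S \<Longrightarrow> s3 v \<in> S"
    and invol: "\<And>v. s1 (s1 v) = v" "\<And>v. s3 (s3 v) = v"
    and s2: "\<And>v. s2 v = s1 (s3 (s1 v))" and braid: "\<And>v. s3 (s1 (s3 v)) = s1 (s3 (s1 v))"
    and X: "\<And>v. v \<in> S \<Longrightarrow> X (s1 v) = Y v" "\<And>v. v \<in> S \<Longrightarrow> X (s3 v) = X v"
    and Y: "\<And>v. v \<in> S \<Longrightarrow> Y (s1 v) = X v" "\<And>v. v \<in> S \<Longrightarrow> Y (s3 v) = Z v"
    and Z: "\<And>v. v \<in> S \<Longrightarrow> Z (s1 v) = Z v" "\<And>v. v \<in> S \<Longrightarrow> Z (s3 v) = Y v"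
    and w: "w \<in> S" and ne: "X w \<noteq> Y w" "X w \<noteq> Z w" "Y w \<noteq> Z w"
    and D: "D1 = (\<lambda>f v. 1 / (Y v - X v) * (f v + f (s1 v)))"
      "D2 = (\<lambda>f v. 1 / (Z v - X v) * (f v + f (s2 v)))"
      "D3 = (\<lambda>f v. 1 / (Z v - Y v) * (f v + f (s3 v)))"
  shows "D1 (D3 d) w = D3 (D2 d) w + D2 (D1 d) w"
    and "D3 (D1 d) w = D1 (D2 d) w + D2 (D3 d) w"
    and "D1 (D2 (D3 d)) w = D3 (D2 (D1 d)) w"
proof -
  define x y z where "x = X w" "y = Y w" "z = Z w"
  define d0 d1 d2 d3 d4 d5 where "d0 = d w" "d1 = d (s1 w)" "d2 = d (s3 w)" "d3 = d (s1 (s3 w))"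
    "d4 = d (s3 (s1 w))" "d5 = d (s1 (s3 (s1 w)))"
  have ne: "y - x \<noteq> 0" "z - x \<noteq> 0" "z - y \<noteq> 0" "x - y \<noteq> 0" "x - z \<noteq> 0" "y - z \<noteq> 0"
    using ne by (auto simp: x_y_z_def)
  note rules = D invol s2 braid X Y Z S w x_y_z_def[symmetric] d0_d1_d2_d3_d4_d5_def[symmetric]
  show "D1 (D3 d) w = D3 (D2 d) w + D2 (D1 d) w"
    using ne by (simp add: rules) (simp add: divide_simps, simp add: algebra_simps)?
  show "D3 (D1 d) w = D1 (D2 d) w + D2 (D3 d) w"
    using ne by (simp add: rules) (simp add: divide_simps, simp add: algebra_simps)?
  show "D1 (D2 (D3 d)) w = D3 (D2 (D1 d)) w"
    using ne by (simp add: rules) (simp add: divide_simps, simp add: algebra_simps)?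
qed

lemma ddiff_braid_complex:
  assumes d: "\<And>i j. i \<noteq> j \<Longrightarrow> lam $ i \<noteq> lam $ j" and w: "w permutes UNIV" and abc: "distinct [a, b, c]"
  shows "ddiff (*) lam b a (ddiff (*) lam c b d) w =
      ddiff (*) lam c b (ddiff (*) lam c a d) w + ddiff (*) lam c a (ddiff (*) lam b a d) w"
    and "ddiff (*) lam c b (ddiff (*) lam b a d) w =
      ddiff (*) lam b a (ddiff (*) lam c a d) w + ddiff (*) lam c a (ddiff (*) lam c b d) w"
    and "ddiff (*) lam b a (ddiff (*) lam c a (ddiff (*) lam c b d)) w =
      ddiff (*) lam c b (ddiff (*) lam c a (ddiff (*) lam b a d)) w"
proof -
  have *: "ddiff (*) lam i j = (\<lambda>f v. 1 / (permute_vec v lam $ i - permute_vec v lam $ j) *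
      (f v + f (Transposition.transpose i j \<circ> v)))" for i j
    by (intro ext) (simp add: ddiff_def)
  note br = rational_braid[where S = "{w. w permutes UNIV}" and w = w and d = d
    and X = "\<lambda>w. permute_vec w lam $ a" and Y = "\<lambda>w. permute_vec w lam $ b" and Z = "\<lambda>w. permute_vec w lam $ c"
    and ?s1.0 = "\<lambda>w. Transposition.transpose b a \<circ> w" and ?s2.0 = "\<lambda>w. Transposition.transpose c a \<circ> w"
    and ?s3.0 = "\<lambda>w. Transposition.transpose c b \<circ> w", OF _ _ _ _ _ _ _ _ _ _ _ _ _ _ _ _ * * *]
  have ne: "permute_vec w lam $ a \<noteq> permute_vec w lam $ b" "permute_vec w lam $ a \<noteq> permute_vec w lam $ c"
     "permute_vec w lam $ b \<noteq> permute_vec w lam $ c"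
    using permute_vec_distinct[of lam, OF d w] abc by auto
  have t: "Transposition.transpose c a \<circ> v = Transposition.transpose b a \<circ> (Transposition.transpose c b \<circ> (Transposition.transpose b a \<circ> v))"
    "Transposition.transpose c b \<circ> (Transposition.transpose b a \<circ> (Transposition.transpose c b \<circ> v)) = Transposition.transpose b a \<circ> (Transposition.transpose c b \<circ> (Transposition.transpose b a \<circ> v))" for v :: "'a \<Rightarrow> 'a"
    using abc by (auto simp: fun_eq_iff Transposition.transpose_def)
  have v: "Transposition.transpose b a a = b" "Transposition.transpose b a b = a" "Transposition.transpose b a c = c"
    "Transposition.transpose c b a = a" "Transposition.transpose c b b = c" "Transposition.transpose c b c = b"
    using abc by (auto simp: Transposition.transpose_def)
  show "ddiff (*) lam b a (ddiff (*) lam c b d) w =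
      ddiff (*) lam c b (ddiff (*) lam c a d) w + ddiff (*) lam c a (ddiff (*) lam b a d) w"
    by (rule br(1)) (use t(1) t(2) ne w in \<open>simp_all add: permutes_transpose_comp permute_vec_transpose v transpose_invol\<close>)
  show "ddiff (*) lam c b (ddiff (*) lam b a d) w =
      ddiff (*) lam b a (ddiff (*) lam c a d) w + ddiff (*) lam c a (ddiff (*) lam c b d) w"
    by (rule br(2)) (use t(1) t(2) ne w in \<open>simp_all add: permutes_transpose_comp permute_vec_transpose v transpose_invol\<close>)
  show "ddiff (*) lam b a (ddiff (*) lam c a (ddiff (*) lam c b d)) w =
      ddiff (*) lam c b (ddiff (*) lam c a (ddiff (*) lam b a d)) w"
    by (rule br(3)) (use t(1) t(2) ne w in \<open>simp_all add: permutes_transpose_comp permute_vec_transpose v transpose_invol\<close>)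
qed

lemma ddiff_functional:
  assumes "Vector_Spaces.linear smul (*) \<psi>"
  shows "(\<lambda>v. \<psi> (ddiff smul lam i j d v)) = ddiff (*) lam i j (\<lambda>v. \<psi> (d v))"
proof -
  interpret Vector_Spaces.linear smul "(*)" \<psi> by fact
  show ?thesis by (intro ext) (simp add: ddiff_def scale add)
qed

text \<open>On the hyperplane the exponents of w and s w differ by a constant only; it is the origin
  of the exponential factor in \<open>cross\<close>.\<close>

lemma plane_wave_transpose:
  assumes w: "w permutes UNIV" and ij: "i \<noteq> j" and x: "x $ j - x $ i = of_int m"
  shows "plane_wave (permute_vec (Transposition.transpose i j \<circ> w) lam) x =
    plane_wave (permute_vec w lam) x * exp (of_int m * (permute_vec w lam $ i - permute_vec w lam $ j))"
proof -
  let ?\<mu> = "permute_vec w lam" and ?t = "Transposition.transpose i j"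
  have "(\<Sum>a\<in>UNIV. ?\<mu> $ ?t a * of_real (x $ a)) - (\<Sum>a\<in>UNIV. ?\<mu> $ a * of_real (x $ a))
      = (\<Sum>a\<in>UNIV. (?\<mu> $ ?t a - ?\<mu> $ a) * of_real (x $ a))"
    by (simp add: sum_subtractf algebra_simps)
  also have "\<dots> = (\<Sum>a\<in>{i, j}. (?\<mu> $ ?t a - ?\<mu> $ a) * of_real (x $ a))"
    by (rule sum.mono_neutral_right) (auto simp: Transposition.transpose_def)
  also have "\<dots> = of_real (x $ j - x $ i) * (?\<mu> $ i - ?\<mu> $ j)"
    using ij by (simp add: algebra_simps)
  finally have "(\<Sum>a\<in>UNIV. ?\<mu> $ ?t a * of_real (x $ a)) =
      (\<Sum>a\<in>UNIV. ?\<mu> $ a * of_real (x $ a)) + of_int m * (?\<mu> $ i - ?\<mu> $ j)"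
    unfolding x by (simp add: algebra_simps)
  then show ?thesis
    unfolding plane_wave_def using w by (simp add: permute_vec_transpose exp_add)
qed

locale bethe =
  fixes smul :: "complex \<Rightarrow> 'm::ab_group_add \<Rightarrow> 'm"
    and \<rho> :: "('n::{finite,linorder} \<Rightarrow> 'n) \<times> (int ^ 'n::{finite,linorder}) \<Rightarrow> 'm \<Rightarrow> 'm"
    and k :: complex
    and lam :: "complex ^ 'n::{finite,linorder}"
  assumes vector_space_smul: "vector_space smul"
    and hom: "\<rho> \<in> hom affine_sym_group (general_linear_group smul)"
    and lam_distinct: "\<And>i j. i \<noteq> j \<Longrightarrow> lam $ i \<noteq> lam $ j"
begin

sublocale V: vector_space smul by (rule vector_space_smul)

abbreviation wl :: "('n \<Rightarrow> 'n) \<Rightarrow> (complex, 'n) vec" where "wl w \<equiv> permute_vec w lam"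

abbreviation tp :: "'n \<Rightarrow> 'n \<Rightarrow> 'n \<Rightarrow> 'n" where "tp \<equiv> Transposition.transpose"

abbreviation \<rho>s :: "'n \<Rightarrow> 'n \<Rightarrow> int \<Rightarrow> 'm \<Rightarrow> 'm" where "\<rho>s i j m \<equiv> \<rho> (affine_reflection i j m)"

section \<open>The representation on the affine reflections\<close>

lemma \<rho>_linear: "g \<in> carrier affine_sym_group \<Longrightarrow> Vector_Spaces.linear smul smul (\<rho> g)"
  using hom by (auto simp: hom_def general_linear_group_def)

lemma \<rho>_mult: "g \<in> carrier affine_sym_group \<Longrightarrow> h \<in> carrier affine_sym_group \<Longrightarrow>
    \<rho> (g \<otimes>\<^bsub>affine_sym_group\<^esub> h) v = \<rho> g (\<rho> h v)"
  using hom by (auto simp: hom_def general_linear_group_def)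

lemma \<rho>s_linear: "Vector_Spaces.linear smul smul (\<rho>s i j m)"
  by (intro \<rho>_linear affine_reflection_carrier)

lemma \<rho>s_add: "\<rho>s i j m (u + v) = \<rho>s i j m u + \<rho>s i j m v"
  using \<rho>s_linear by (simp add: Vector_Spaces.linear_iff)

lemma \<rho>s_scale: "\<rho>s i j m (smul a v) = smul a (\<rho>s i j m v)"
  using \<rho>s_linear by (simp add: Vector_Spaces.linear_iff)

lemma \<rho>s_zero: "\<rho>s i j m 0 = 0"
  using \<rho>s_scale[of i j m 0 0] by simp

lemma \<rho>s_minus: "\<rho>s i j m (- v) = - \<rho>s i j m v"
  using \<rho>s_scale[of i j m "-1" v] by simp

lemma affine_mult: "(w, v) \<otimes>\<^bsub>affine_sym_group\<^esub> (w', v') = (w \<circ> w', v + permute_vec w v')"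
  by (simp add: affine_sym_group_def)

lemma \<rho>s_eqI:
  assumes "affine_reflection i j m \<otimes>\<^bsub>affine_sym_group\<^esub> affine_reflection i' j' m' =
     affine_reflection a b l \<otimes>\<^bsub>affine_sym_group\<^esub> affine_reflection a' b' l'"
  shows "\<rho>s i j m (\<rho>s i' j' m' v) = \<rho>s a b l (\<rho>s a' b' l' v)"
  using assms \<rho>_mult[OF affine_reflection_carrier affine_reflection_carrier] by metis

lemma affine_reflection_swap: "affine_reflection j i (- m) = (affine_reflection i j m :: ('n \<Rightarrow> 'n) \<times> ((int, 'n) vec))"
  by (auto simp: affine_reflection_def vec_eq_iff axis_def transpose_commute)

lemma \<rho>s_commute:
  assumes "distinct [i, j, i', j']"
  shows "\<rho>s i j m (\<rho>s i' j' m' v) = \<rho>s i' j' m' (\<rho>s i j m v)"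
  using assms unfolding affine_reflection_def
  by (intro \<rho>s_eqI[unfolded affine_reflection_def] )
    (auto simp: affine_mult fun_eq_iff permute_vec_def vec_eq_iff axis_def Transposition.transpose_def)

text \<open>The three reflections lie in a dihedral group of order six, where a product of two
  distinct ones is one of two rotations. The equations bring every such product to one of two normal
  forms.\<close>

lemma \<rho>s_braid:
  assumes "distinct [a, b, c]"
  shows "\<rho>s c b m' (\<rho>s c a (m + m') v) = \<rho>s b a m (\<rho>s c b m' v)"
    and "\<rho>s c a (m + m') (\<rho>s b a m v) = \<rho>s b a m (\<rho>s c b m' v)"
    and "\<rho>s b a m (\<rho>s c a (m + m') v) = \<rho>s c b m' (\<rho>s b a m v)"
    and "\<rho>s c a (m + m') (\<rho>s c b m' v) = \<rho>s c b m' (\<rho>s b a m v)"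
  using assms unfolding affine_reflection_def
  by (intro \<rho>s_eqI[unfolded affine_reflection_def];
      auto simp: affine_mult fun_eq_iff permute_vec_def vec_eq_iff axis_def Transposition.transpose_def)+

lemma \<rho>s_triple:
  assumes "distinct [a, b, c]"
  shows "\<rho>s c b m' (\<rho>s b a m (\<rho>s c b m' v)) = \<rho>s b a m (\<rho>s c b m' (\<rho>s b a m v))"
  using \<rho>s_braid(3,4)[OF assms] by metis

text \<open>Passage from the side \<open>x\<^sub>j - x\<^sub>i < m\<close> of a hyperplane to the side \<open>x\<^sub>j - x\<^sub>i > m\<close>: the added
  term vanishes on the hyperplane, and its \<open>(\<partial>\<^sub>j - \<partial>\<^sub>i)\<close>-derivative there is \<open>-k \<rho>(s) f\<close>.\<close>

definition cross :: "'n \<Rightarrow> 'n \<Rightarrow> int \<Rightarrow> (('n \<Rightarrow> 'n) \<Rightarrow> 'm) \<Rightarrow> ('n \<Rightarrow> 'n) \<Rightarrow> 'm" where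
  "cross i j m c w = (if w permutes UNIV then
     c w + smul (k / (2 * (wl w $ i - wl w $ j)))
       (\<rho>s i j m (c w + smul (exp (of_int m * (wl w $ i - wl w $ j))) (c (tp i j \<circ> w))))
     else c w)"

text \<open>Absorbing the values of the plane waves at a common point \<open>p\<close> of the hyperplanes into the
  coefficients removes the exponential factors from \<open>cross\<close>.\<close>

definition cross0 :: "'n \<Rightarrow> 'n \<Rightarrow> ('m \<Rightarrow> 'm) \<Rightarrow> (('n \<Rightarrow> 'n) \<Rightarrow> 'm) \<Rightarrow> ('n \<Rightarrow> 'n) \<Rightarrow> 'm" where
  "cross0 i j Q d w = (if w permutes UNIV then d w + smul (k / 2) (Q (ddiff smul lam i j d w)) else d w)"

definition gauge :: "(real, 'n) vec \<Rightarrow> (('n \<Rightarrow> 'n) \<Rightarrow> 'm) \<Rightarrow> ('n \<Rightarrow> 'n) \<Rightarrow> 'm" where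
  "gauge p c w = smul (plane_wave (wl w) p) (c w)"

lemma plane_wave_nonzero: "plane_wave \<mu> x \<noteq> 0"
  by (simp add: plane_wave_def)

lemma gauge_inj: "gauge p c = gauge p c' \<longleftrightarrow> c = c'"
proof
  assume "gauge p c = gauge p c'"
  then have "smul (plane_wave (wl w) p) (c w) = smul (plane_wave (wl w) p) (c' w)" for w
    by (metis gauge_def)
  then show "c = c'" using plane_wave_nonzero by (metis V.scale_left_imp_eq V.scale_cancel_left ext)
qed simp

text \<open>By \<open>plane_wave_transpose\<close> at p the exponential times the wave of w is the
  wave of s w, so the bracket in \<open>cross\<close> becomes the numerator of \<open>ddiff\<close>
  for the rescaled coefficients.\<close>

lemma gauge_cross:
  assumes "i \<noteq> j" "p $ j - p $ i = of_int m"
  shows "gauge p (cross i j m c) = cross0 i j (\<rho>s i j m) (gauge p c)"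
proof
  fix w
  show "gauge p (cross i j m c) w = cross0 i j (\<rho>s i j m) (gauge p c) w"
  proof (cases "w permutes UNIV")
    case True
    then show ?thesis
      using plane_wave_transpose[OF True assms, of lam]
      by (simp add: gauge_def cross_def cross0_def ddiff_def V.scale_right_distrib \<rho>s_scale \<rho>s_add mult_ac)
  qed (simp add: gauge_def cross_def cross0_def)
qed

lemma ddiff_ddiff_functional:
  assumes "Vector_Spaces.linear smul (*) \<psi>"
  shows "\<psi> (ddiff smul lam i j d w) = ddiff (*) lam i j (\<lambda>v. \<psi> (d v)) w"
  using ddiff_functional[OF assms] by metis

lemma ddiff_braid:
  assumes w: "w permutes UNIV" and abc: "distinct [a, b, c]"
  shows "ddiff smul lam b a (ddiff smul lam c b d) w =
      ddiff smul lam c b (ddiff smul lam c a d) w + ddiff smul lam c a (ddiff smul lam b a d) w"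
    and "ddiff smul lam c b (ddiff smul lam b a d) w =
      ddiff smul lam b a (ddiff smul lam c a d) w + ddiff smul lam c a (ddiff smul lam c b d) w"
    and "ddiff smul lam b a (ddiff smul lam c a (ddiff smul lam c b d)) w =
      ddiff smul lam c b (ddiff smul lam c a (ddiff smul lam b a d)) w"
  by (rule functional_separates[OF vector_space_smul],
      simp add: ddiff_ddiff_functional ddiff_functional Vector_Spaces.linear_iff[of smul "(*)", THEN iffD1]
        ddiff_braid_complex[OF lam_distinct w abc])+

text \<open>The numerator is symmetric and the denominator antisymmetric under s, so the first
  application gives an antisymmetric function, which the second one kills.\<close>

lemma ddiff_ddiff_same:
  assumes "w permutes UNIV"
  shows "ddiff smul lam i j (ddiff smul lam i j d) w = 0"
proof -
  have "1 / (wl w $ j - wl w $ i) = - (1 / (wl w $ i - wl w $ j))"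
    by (metis minus_diff_eq minus_divide_right)
  then have "ddiff smul lam i j d (tp i j \<circ> w) = - ddiff smul lam i j d w"
    using assms unfolding ddiff_def
    by (simp add: permute_vec_transpose transpose_invol add.commute V.scale_minus_left)
  then show ?thesis unfolding ddiff_def[of smul lam i j "ddiff smul lam i j d"] by simp
qed

lemma ddiff_commute:
  assumes w: "w permutes UNIV" and d: "distinct [i, j, i', j']"
  shows "ddiff smul lam i j (ddiff smul lam i' j' d) w = ddiff smul lam i' j' (ddiff smul lam i j d) w"
proof -
  have "tp i j \<circ> (tp i' j' \<circ> w) = tp i' j' \<circ> (tp i j \<circ> w)"
    using d by (auto simp: fun_eq_iff Transposition.transpose_def)
  moreover have "tp i j i' = i'" "tp i j j' = j'" "tp i' j' i = i" "tp i' j' j = j"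
    using d by (auto simp: Transposition.transpose_def)
  ultimately show ?thesis
    using w unfolding ddiff_def
    by (simp add: permute_vec_transpose V.scale_right_distrib mult_ac add_ac)
qed

text \<open>\<open>Q\<close> acts on \<open>M\<close> and \<open>ddiff\<close> on the index w, so
  they commute.\<close>

lemma ddiff_cross0:
  assumes w: "w permutes UNIV" and Q: "Vector_Spaces.linear smul smul Q"
  shows "ddiff smul lam i j (cross0 i' j' Q d) w =
    ddiff smul lam i j d w + smul (k / 2) (Q (ddiff smul lam i j (ddiff smul lam i' j' d) w))"
  using w permutes_transpose_comp[OF w] Q
  by (simp add: ddiff_def[of smul lam i j] cross0_def Vector_Spaces.linear_iff V.scale_right_distrib mult_ac add_ac)

lemma ddiff_ddiff_cross0:
  assumes w: "w permutes UNIV" and Q: "Vector_Spaces.linear smul smul Q"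
  shows "ddiff smul lam a b (ddiff smul lam i j (cross0 i' j' Q d)) w =
    ddiff smul lam a b (ddiff smul lam i j d) w +
    smul (k / 2) (Q (ddiff smul lam a b (ddiff smul lam i j (ddiff smul lam i' j' d)) w))"
  unfolding ddiff_def[of smul lam a b]
  using Q by (simp add: ddiff_cross0[OF w Q] ddiff_cross0[OF permutes_transpose_comp[OF w] Q]
      Vector_Spaces.linear_iff V.scale_right_distrib mult_ac add_ac)

text \<open>With N = (k / 2) \<rho>(s) \<open>ddiff\<close> the two crossings are 1 - N and 1 + N,
  as \<open>ddiff\<close> is antisymmetric in its two indices, and N N = 0.\<close>

lemma cross_inverse:
  assumes ij: "i \<noteq> j"
  shows "cross j i (- m) (cross i j m c) = c"
proof -
  \<comment> \<open>A point on the hyperplane; passing to \<open>cross0\<close> requires a common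
    point of all hyperplanes involved.\<close>
  let ?p = "axis j (of_int m) :: (real, 'n) vec"
  have p: "?p $ j - ?p $ i = of_int m" "?p $ i - ?p $ j = of_int (- m)" using ij by (auto simp: axis_def)
  have "gauge ?p (cross j i (- m) (cross i j m c)) = gauge ?p c"
  proof
    fix w
    have neg: "ddiff smul lam j i d v = - ddiff smul lam i j d v" for d v
      unfolding ddiff_def transpose_commute[of j i]
      by (metis V.scale_minus_left minus_diff_eq minus_divide_right)
    have "cross0 j i (\<rho>s i j m) (cross0 i j (\<rho>s i j m) d) w = d w" for d
    proof (cases "w permutes UNIV")
      case True
      have "cross0 j i (\<rho>s i j m) (cross0 i j (\<rho>s i j m) d) w =
          cross0 i j (\<rho>s i j m) d w + smul (k / 2) (\<rho>s i j m (ddiff smul lam j i (cross0 i j (\<rho>s i j m) d) w))"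
        using True by (simp add: cross0_def[of j i])
      also have "ddiff smul lam j i (cross0 i j (\<rho>s i j m) d) w = - ddiff smul lam i j d w"
        by (simp add: neg ddiff_cross0[OF True \<rho>s_linear] ddiff_ddiff_same[OF True] \<rho>s_zero)
      also have "cross0 i j (\<rho>s i j m) d w = d w + smul (k / 2) (\<rho>s i j m (ddiff smul lam i j d w))"
        using True by (simp add: cross0_def)
      finally show ?thesis by (simp add: \<rho>s_minus)
    qed (simp add: cross0_def)
    then show "gauge ?p (cross j i (- m) (cross i j m c)) w = gauge ?p c w"
      using gauge_cross[OF ij[symmetric] p(2)] gauge_cross[OF ij p(1)] by (simp add: affine_reflection_swap)
  qed
  then show ?thesis by (simp add: gauge_inj)
qed

text \<open>Both the reflections and the divided differences of disjoint pairs commute.\<close>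

lemma cross_commute:
  assumes d: "distinct [i, j, i', j']"
  shows "cross i j m (cross i' j' m' c) = cross i' j' m' (cross i j m c)"
proof -
  let ?p = "axis j (of_int m) + axis j' (of_int m') :: (real, 'n) vec"
  have p: "?p $ j - ?p $ i = of_int m" "?p $ j' - ?p $ i' = of_int m'" using d by (auto simp: axis_def)
  have ne: "i \<noteq> j" "i' \<noteq> j'" using d by auto
  let ?Q = "\<rho>s i j m" and ?Q' = "\<rho>s i' j' m'"
  have "cross0 i j ?Q (cross0 i' j' ?Q' d) = cross0 i' j' ?Q' (cross0 i j ?Q d)" for d
  proof
    fix w
    show "cross0 i j ?Q (cross0 i' j' ?Q' d) w = cross0 i' j' ?Q' (cross0 i j ?Q d) w"
    proof (cases "w permutes UNIV")
      case True
      then show ?thesis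
        unfolding cross0_def[of i j ?Q "cross0 i' j' ?Q' d"] cross0_def[of i' j' ?Q' "cross0 i j ?Q d"]
        by (simp add: ddiff_cross0[OF True \<rho>s_linear] \<rho>s_add \<rho>s_scale V.scale_right_distrib
            ddiff_commute[OF True assms] \<rho>s_commute[OF assms])
          (simp add: cross0_def add_ac)
    qed (simp add: cross0_def)
  qed
  then have "gauge ?p (cross i j m (cross i' j' m' c)) = gauge ?p (cross i' j' m' (cross i j m c))"
    by (simp add: gauge_cross[OF ne(1) p(1)] gauge_cross[OF ne(2) p(2)])
  then show ?thesis by (simp add: gauge_inj)
qed

text \<open>Expand in powers of k. In degree two the products of two reflections are only two
  rotations, and comparing their coefficients gives exactly the quadratic relations in
  \<open>ddiff_braid\<close>. In degree three the reflections and the divided differences each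
  satisfy the braid relation.\<close>

lemma cross_braid:
  assumes abc: "distinct [a, b, c]"
  shows "cross c b m' (cross c a (m + m') (cross b a m e)) = cross b a m (cross c a (m + m') (cross c b m' e))"
proof -
  \<comment> \<open>The coordinates m + m', m', 0 at a, b, c put p on all three hyperplanes.\<close>
  let ?p = "axis a (of_int (m + m')) + axis b (of_int m') :: (real, 'n) vec"
  have p: "?p $ a - ?p $ b = of_int m" "?p $ a - ?p $ c = of_int (m + m')" "?p $ b - ?p $ c = of_int m'"
    using abc by (auto simp: axis_def)
  have ne: "b \<noteq> a" "c \<noteq> a" "c \<noteq> b" using abc by auto
  let ?Q1 = "\<rho>s b a m" and ?Q2 = "\<rho>s c a (m + m')" and ?Q3 = "\<rho>s c b m'"
  have "cross0 c b ?Q3 (cross0 c a ?Q2 (cross0 b a ?Q1 d)) = cross0 b a ?Q1 (cross0 c a ?Q2 (cross0 c b ?Q3 d))" for d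
  proof
    fix w
    show "cross0 c b ?Q3 (cross0 c a ?Q2 (cross0 b a ?Q1 d)) w = cross0 b a ?Q1 (cross0 c a ?Q2 (cross0 c b ?Q3 d)) w"
    proof (cases "w permutes UNIV")
      case True
      have expand: "cross0 i j (\<rho>s i j n) f w = f w + smul (k / 2) (\<rho>s i j n (ddiff smul lam i j f w))" for i j n f
        using True by (simp add: cross0_def)
      show ?thesis
        unfolding expand ddiff_cross0[OF True \<rho>s_linear] ddiff_ddiff_cross0[OF True \<rho>s_linear]
          ddiff_braid[OF True abc] \<rho>s_add \<rho>s_scale V.scale_right_distrib V.scale_scale \<rho>s_braid[OF abc]
        by (simp only: add_ac \<rho>s_triple[OF abc])
    qed (simp add: cross0_def)
  qed
  then have "gauge ?p (cross c b m' (cross c a (m + m') (cross b a m e))) =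
      gauge ?p (cross b a m (cross c a (m + m') (cross c b m' e)))"
    by (simp only: gauge_cross[OF ne(1) p(1)] gauge_cross[OF ne(2) p(2)] gauge_cross[OF ne(3) p(3)])
  then show ?thesis by (simp add: gauge_inj)
qed

lemma crossing_cross: "regular x0 \<Longrightarrow> crossing cross x0"
  by unfold_locales (simp_all add: cross_inverse cross_braid, rule cross_commute, simp)

end

section \<open>Integration over hyperplanes\<close>

lemma nn_integral_lborel_translate:
  fixes f :: "'a::euclidean_space \<Rightarrow> ennreal"
  assumes [measurable]: "f \<in> borel_measurable borel"
  shows "(\<integral>\<^sup>+x. f (x + a) \<partial>lborel) = (\<integral>\<^sup>+x. f x \<partial>lborel)"
proof -
  have "(\<integral>\<^sup>+x. f x \<partial>lborel) = (\<integral>\<^sup>+x. f x \<partial>(distr lborel borel ((+) a)))"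
    by (simp add: lborel_distr_plus)
  then show ?thesis by (simp add: nn_integral_distr add.commute)
qed

text \<open>The function l runs at unit speed along v, so the slab 0 \<le> l \<le> 1 meets each line
  in direction v in a segment of parameter length one. Fubini and translation invariance then take
  the place of coordinates adapted to v.\<close>

lemma nn_integral_lborel_line:
  fixes v :: "'a::euclidean_space" and G :: "'a \<Rightarrow> ennreal"
  assumes [measurable]: "G \<in> borel_measurable borel" "l \<in> borel_measurable borel"
    and l: "\<And>x t. l (x + t *\<^sub>R v) = l x + t"
  shows "(\<integral>\<^sup>+x. G x \<partial>lborel) =
    (\<integral>\<^sup>+x. indicator {0..1::real} (l x) * (\<integral>\<^sup>+t. G (x + t *\<^sub>R v) \<partial>lborel) \<partial>lborel)"
proof -
  have "(\<integral>\<^sup>+x. indicator {0..1::real} (l x) * (\<integral>\<^sup>+t. G (x + t *\<^sub>R v) \<partial>lborel) \<partial>lborel)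
      = (\<integral>\<^sup>+x. (\<integral>\<^sup>+t. indicator {0..1} (l x) * G (x + t *\<^sub>R v) \<partial>lborel) \<partial>lborel)"
    by (intro nn_integral_cong nn_integral_cmult[symmetric]) measurable
  also have "\<dots> = (\<integral>\<^sup>+t. (\<integral>\<^sup>+x. indicator {0..1} (l x) * G (x + t *\<^sub>R v) \<partial>lborel) \<partial>lborel)"
    by (rule lborel_pair.Fubini'[symmetric]) measurable
  also have "\<dots> = (\<integral>\<^sup>+t. (\<integral>\<^sup>+x. indicator {0..1} (l x - t) * G x \<partial>lborel) \<partial>lborel)"
  proof (rule nn_integral_cong)
    fix t
    have "(\<integral>\<^sup>+x. indicator {0..1} (l x - t) * G x \<partial>lborel)
       = (\<integral>\<^sup>+x. indicator {0..1} (l (x + t *\<^sub>R v) - t) * G (x + t *\<^sub>R v) \<partial>lborel)"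
      by (rule nn_integral_lborel_translate[symmetric]) measurable
    then show "(\<integral>\<^sup>+x. indicator {0..1} (l x) * G (x + t *\<^sub>R v) \<partial>lborel) = (\<integral>\<^sup>+x. indicator {0..1} (l x - t) * G x \<partial>lborel)"
      by (simp add: l)
  qed
  also have "\<dots> = (\<integral>\<^sup>+x. (\<integral>\<^sup>+t. indicator {0..1} (l x - t) * G x \<partial>lborel) \<partial>lborel)"
    by (rule lborel_pair.Fubini') measurable
  also have "\<dots> = (\<integral>\<^sup>+x. G x \<partial>lborel)"
  proof (rule nn_integral_cong)
    fix x
    have "(\<integral>\<^sup>+t. indicator {0..1} (l x - t) * G x \<partial>lborel) = (\<integral>\<^sup>+t. indicator {l x - 1..l x} t \<partial>lborel) * G x"
      by (subst nn_integral_multc[symmetric]) (auto intro!: nn_integral_cong simp: indicator_def)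
    also have "(\<integral>\<^sup>+t. indicator {l x - 1..l x} t \<partial>lborel) = (1::ennreal)" by simp
    finally show "(\<integral>\<^sup>+t. indicator {0..1} (l x - t) * G x \<partial>lborel) = G x" by simp
  qed
  finally show ?thesis by simp
qed

text \<open>On every line in direction v the shear is a translation, because l is constant
  there.\<close>

lemma nn_integral_lborel_shear:
  fixes v :: "'a::euclidean_space" and G :: "'a \<Rightarrow> ennreal"
  assumes [measurable]: "G \<in> borel_measurable borel" "l \<in> borel_measurable borel"
    and l: "\<And>x t. l (x + t *\<^sub>R v) = l x"
  shows "(\<integral>\<^sup>+x. G (x + l x *\<^sub>R v) \<partial>lborel) = (\<integral>\<^sup>+x. G x \<partial>lborel)"
proof (cases "v = 0")
  case False
  define q where "q = (\<lambda>x. x \<bullet> v / (v \<bullet> v))"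
  have q: "q (x + t *\<^sub>R v) = q x + t" for x t
    using False by (simp add: q_def inner_add_left add_divide_distrib)
  have [measurable]: "q \<in> borel_measurable borel" unfolding q_def by measurable
  have "(\<integral>\<^sup>+x. G (x + l x *\<^sub>R v) \<partial>lborel) =
      (\<integral>\<^sup>+x. indicator {0..1::real} (q x) * (\<integral>\<^sup>+t. G (x + t *\<^sub>R v + l (x + t *\<^sub>R v) *\<^sub>R v) \<partial>lborel) \<partial>lborel)"
    by (rule nn_integral_lborel_line) (use q in measurable)
  also have "\<dots> = (\<integral>\<^sup>+x. indicator {0..1::real} (q x) * (\<integral>\<^sup>+t. G (x + t *\<^sub>R v) \<partial>lborel) \<partial>lborel)"
  proof (rule nn_integral_cong)
    fix x
    have "(\<integral>\<^sup>+t. G (x + t *\<^sub>R v + l (x + t *\<^sub>R v) *\<^sub>R v) \<partial>lborel) = (\<integral>\<^sup>+t. G (x + (t + l x) *\<^sub>R v) \<partial>lborel)"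
      by (simp add: l algebra_simps)
    also have "\<dots> = (\<integral>\<^sup>+t. G (x + t *\<^sub>R v) \<partial>lborel)"
      by (rule nn_integral_lborel_translate) measurable
    finally show "indicator {0..1::real} (q x) * (\<integral>\<^sup>+t. G (x + t *\<^sub>R v + l (x + t *\<^sub>R v) *\<^sub>R v) \<partial>lborel) =
        indicator {0..1::real} (q x) * (\<integral>\<^sup>+t. G (x + t *\<^sub>R v) \<partial>lborel)" by simp
  qed
  also have "\<dots> = (\<integral>\<^sup>+x. G x \<partial>lborel)"
    by (rule nn_integral_lborel_line[symmetric]) (use q in measurable)
  finally show ?thesis .
qed simp

text \<open>Uniqueness of Haar measure, with the unit ball as the normalising set.\<close>

lemma nn_integral_lborel_orthogonal:
  fixes T :: "'a::euclidean_space \<Rightarrow> 'a"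
  assumes T: "orthogonal_transformation T" and f[measurable]: "f \<in> borel_measurable borel"
  shows "(\<integral>\<^sup>+x. f (T x) \<partial>lborel) = (\<integral>\<^sup>+x. f x \<partial>lborel)"
proof -
  have lin: "linear T" using T by (rule orthogonal_transformation_linear)
  have "continuous_on UNIV T" using lin by (simp add: linear_continuous_on linear_conv_bounded_linear)
  then have [measurable]: "T \<in> borel_measurable borel" by (rule borel_measurable_continuous_onI)
  have surj: "\<exists>z. T z = y" for y using orthogonal_transformation_surj[OF T] by (metis surjD)
  let ?B = "ball 0 1 :: 'a set"
  have [measurable]: "?B \<in> sets borel" by simp
  have shift: "(\<integral>\<^sup>+x. h (T x + y) \<partial>lborel) = (\<integral>\<^sup>+x. h (T x) \<partial>lborel)"
    if [measurable]: "h \<in> borel_measurable borel" for h :: "'a \<Rightarrow> ennreal" and y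
  proof -
    obtain z where z: "T z = y" using surj by blast
    have "(\<integral>\<^sup>+x. h (T x + y) \<partial>lborel) = (\<integral>\<^sup>+x. h (T (x + z)) \<partial>lborel)"
      using lin z by (simp add: linear_add)
    also have "\<dots> = (\<integral>\<^sup>+x. h (T x) \<partial>lborel)" by (rule nn_integral_lborel_translate) measurable
    finally show ?thesis .
  qed
  have "(\<integral>\<^sup>+x. f (T x) \<partial>lborel) * emeasure lborel ?B =
      (\<integral>\<^sup>+y. (\<integral>\<^sup>+x. f (T x) \<partial>lborel) * indicator ?B y \<partial>lborel)"
    by (subst nn_integral_cmult) (auto intro!: borel_measurable_indicator)
  also have "\<dots> = (\<integral>\<^sup>+y. (\<integral>\<^sup>+x. f (T x + y) * indicator ?B y \<partial>lborel) \<partial>lborel)"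
    by (intro nn_integral_cong) (simp add: nn_integral_multc shift)
  also have "\<dots> = (\<integral>\<^sup>+x. (\<integral>\<^sup>+y. f (T x + y) * indicator ?B y \<partial>lborel) \<partial>lborel)"
    by (rule lborel_pair.Fubini') measurable
  also have "\<dots> = (\<integral>\<^sup>+x. (\<integral>\<^sup>+y. f y * indicator ?B (y - T x) \<partial>lborel) \<partial>lborel)"
  proof (rule nn_integral_cong)
    fix x
    have "(\<integral>\<^sup>+y. f y * indicator ?B (y - T x) \<partial>lborel) = (\<integral>\<^sup>+y. f (y + T x) * indicator ?B (y + T x - T x) \<partial>lborel)"
      by (rule nn_integral_lborel_translate[symmetric]) measurable
    then show "(\<integral>\<^sup>+y. f (T x + y) * indicator ?B y \<partial>lborel) = (\<integral>\<^sup>+y. f y * indicator ?B (y - T x) \<partial>lborel)"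
      by (simp add: add.commute)
  qed
  also have "\<dots> = (\<integral>\<^sup>+y. (\<integral>\<^sup>+x. f y * indicator ?B (y - T x) \<partial>lborel) \<partial>lborel)"
    by (rule lborel_pair.Fubini'[symmetric]) measurable
  also have "\<dots> = (\<integral>\<^sup>+y. f y * emeasure lborel ?B \<partial>lborel)"
  proof (rule nn_integral_cong)
    fix y
    have "(\<integral>\<^sup>+x. f y * indicator ?B (y - T x) \<partial>lborel) = f y * (\<integral>\<^sup>+x. indicator ?B (T x + (- y)) \<partial>lborel)"
      by (subst nn_integral_cmult[symmetric], measurable)
        (intro nn_integral_cong, simp add: indicator_def norm_minus_commute)
    also have "(\<integral>\<^sup>+x. indicator ?B (T x + (- y)) \<partial>lborel) = (\<integral>\<^sup>+x. indicator ?B (T x) \<partial>lborel)"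
      by (rule shift) measurable
    also have "\<dots> = (\<integral>\<^sup>+x. indicator ?B x \<partial>lborel)"
      by (intro nn_integral_cong) (simp add: indicator_def orthogonal_transformation_norm[OF T])
    finally show "(\<integral>\<^sup>+x. f y * indicator ?B (y - T x) \<partial>lborel) = f y * emeasure lborel ?B" by simp
  qed
  also have "\<dots> = (\<integral>\<^sup>+x. f x \<partial>lborel) * emeasure lborel ?B"
    by (rule nn_integral_multc) measurable
  finally have *: "(\<integral>\<^sup>+x. f (T x) \<partial>lborel) * emeasure lborel ?B = (\<integral>\<^sup>+x. f x \<partial>lborel) * emeasure lborel ?B" .
  have "emeasure lborel ?B \<noteq> 0"
    using unit_ball_vol_pos[of "real DIM('a)"] by (auto simp: emeasure_ball simp del: unit_ball_vol_pos)
  moreover have "emeasure lborel ?B \<noteq> \<infinity>"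
    using emeasure_lborel_ball_finite[of "0::'a" 1] by auto
  ultimately show ?thesis using * by (simp add: mult.commute[of _ "emeasure lborel ?B"] ennreal_mult_cancel_left)
qed

text \<open>Lebesgue measure is built from the standard basis. An orthogonal map carries that basis
  to B, and the product measure is merely relabelled along the bijection.\<close>

lemma distr_PiM_orthonormal:
  fixes B :: "'a::euclidean_space set"
  assumes orth: "pairwise orthogonal B" and norm: "\<And>b. b \<in> B \<Longrightarrow> norm b = 1" and span: "span B = UNIV"
  shows "distr (\<Pi>\<^sub>M b\<in>B. lborel) borel (\<lambda>c. \<Sum>b\<in>B. c b *\<^sub>R b) = lborel"
proof -
  have ind: "independent B"
    using orth norm[of 0] by (intro pairwise_orthogonal_independent) auto
  then have fin: "finite B" by (rule independent_imp_finite)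
  have "card B = DIM('a)" using ind span by (metis dim_UNIV dim_eq_card span_UNIV)
  then obtain \<beta> where \<beta>: "bij_betw \<beta> (Basis :: 'a set) B"
    using fin finite_same_card_bij[of Basis B] by auto
  define T where "T x = (\<Sum>b\<in>Basis. (x \<bullet> b) *\<^sub>R \<beta> b)" for x
  have lin: "linear T" unfolding T_def
    by (intro linear_compose_sum ballI linearI) (auto simp: inner_add_left scaleR_left_distrib)
  have inner: "\<beta> b \<bullet> \<beta> b' = (if b = b' then 1 else 0)" if "b \<in> Basis" "b' \<in> Basis" for b b'
  proof (cases "b = b'")
    case True
    then show ?thesis using norm[of "\<beta> b"] \<beta> that by (auto simp: bij_betw_def norm_eq_1)
  next
    case False
    then have "\<beta> b \<noteq> \<beta> b'" using \<beta> that by (auto simp: bij_betw_def inj_on_def)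
    then show ?thesis using orth \<beta> that False by (auto simp: pairwise_def orthogonal_def bij_betw_def)
  qed
  have "T v \<bullet> T w = v \<bullet> w" for v w
    unfolding T_def inner_sum_left inner_sum_right
    by (simp add: inner if_distrib[of "(*) _"] sum.delta euclidean_inner[of v w] mult.commute cong: if_cong)
  then have T: "orthogonal_transformation T" using lin by (simp add: orthogonal_transformation_def)
  have "continuous_on UNIV T" using lin by (simp add: linear_continuous_on linear_conv_bounded_linear)
  then have [measurable]: "T \<in> borel_measurable borel" by (rule borel_measurable_continuous_onI)
  have "distr lborel borel T = lborel"
  proof (rule measure_eqI)
    fix A assume "A \<in> sets (distr lborel borel T)"
    then have [measurable]: "A \<in> sets borel" by simp
    have "emeasure (distr lborel borel T) A = (\<integral>\<^sup>+x. indicator A (T x) \<partial>lborel)"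
      by (subst nn_integral_indicator[symmetric], simp, subst nn_integral_distr) auto
    also have "\<dots> = emeasure lborel A"
      by (subst nn_integral_lborel_orthogonal[OF T]) auto
    finally show "emeasure (distr lborel borel T) A = emeasure lborel A" .
  qed simp
  interpret P: product_sigma_finite "\<lambda>_::'a. lborel :: real measure" ..
  let ?P = "\<lambda>I. PiM I (\<lambda>_. lborel) :: ('a \<Rightarrow> real) measure"
  define \<gamma> where "\<gamma> = inv_into Basis \<beta>"
  have \<gamma>: "\<gamma> b \<in> Basis" "\<beta> (\<gamma> b) = b" if "b \<in> B" for b
    using \<beta> that by (auto simp: \<gamma>_def bij_betw_def intro: inv_into_into f_inv_into_f)
  have \<gamma>\<beta>: "\<gamma> (\<beta> b) = b" "\<beta> b \<in> B" if "b \<in> Basis" for b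
    using \<beta> that by (auto simp: \<gamma>_def bij_betw_def)
  have [measurable]: "(\<lambda>c. \<lambda>b\<in>B. c (\<gamma> b)) \<in> ?P Basis \<rightarrow>\<^sub>M ?P B"
    by (rule measurable_restrict) (use \<gamma> in measurable)
  have re: "distr (?P Basis) (?P B) (\<lambda>c. \<lambda>b\<in>B. c (\<gamma> b)) = ?P B"
  proof (rule P.PiM_eqI)
    fix A assume A: "\<And>b. b \<in> B \<Longrightarrow> A b \<in> sets (lborel :: real measure)"
    have "(\<lambda>c. \<lambda>b\<in>B. c (\<gamma> b)) -` Pi\<^sub>E B A \<inter> space (?P Basis) = (\<Pi>\<^sub>E b\<in>Basis. A (\<beta> b))"
      using \<gamma> \<gamma>\<beta> by (auto simp: space_PiM PiE_iff) (metis \<gamma>\<beta> restrict_apply')+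
    moreover have "Pi\<^sub>E B A \<in> sets (?P B)" using A fin by (intro sets_PiM_I_finite) auto
    ultimately have "emeasure (distr (?P Basis) (?P B) (\<lambda>c. \<lambda>b\<in>B. c (\<gamma> b))) (Pi\<^sub>E B A)
        = emeasure (?P Basis) (\<Pi>\<^sub>E b\<in>Basis. A (\<beta> b))"
      by (simp add: emeasure_distr)
    also have "\<dots> = (\<Prod>b\<in>Basis. emeasure lborel (A (\<beta> b)))"
      using A \<gamma>\<beta> by (intro P.emeasure_PiM) auto
    also have "\<dots> = (\<Prod>b\<in>B. emeasure lborel (A b))"
      using \<beta> by (rule prod.reindex_bij_betw)
    finally show "emeasure (distr (?P Basis) (?P B) (\<lambda>c. \<lambda>b\<in>B. c (\<gamma> b))) (Pi\<^sub>E B A) = (\<Prod>b\<in>B. emeasure lborel (A b))" .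
  qed (use fin in auto)
  have "distr (?P B) borel (\<lambda>c. \<Sum>b\<in>B. c b *\<^sub>R b) =
      distr (?P Basis) borel ((\<lambda>c. \<Sum>b\<in>B. c b *\<^sub>R b) \<circ> (\<lambda>c. \<lambda>b\<in>B. c (\<gamma> b)))"
    by (subst re[symmetric], subst distr_distr) (use fin in auto)
  also have "(\<lambda>c. \<Sum>b\<in>B. c b *\<^sub>R b) \<circ> (\<lambda>c. \<lambda>b\<in>B. c (\<gamma> b)) = T \<circ> (\<lambda>c. \<Sum>b\<in>Basis. c b *\<^sub>R b)"
  proof
    fix c :: "'a \<Rightarrow> real"
    have "((\<lambda>c. \<Sum>b\<in>B. c b *\<^sub>R b) \<circ> (\<lambda>c. \<lambda>b\<in>B. c (\<gamma> b))) c = (\<Sum>b\<in>B. c (\<gamma> b) *\<^sub>R b)" by simp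
    also have "\<dots> = (\<Sum>b\<in>Basis. c (\<gamma> (\<beta> b)) *\<^sub>R \<beta> b)"
      using \<beta> by (rule sum.reindex_bij_betw[symmetric])
    also have "\<dots> = T (\<Sum>b\<in>Basis. c b *\<^sub>R b)"
      by (simp add: T_def \<gamma>\<beta>)
    finally show "((\<lambda>c. \<Sum>b\<in>B. c b *\<^sub>R b) \<circ> (\<lambda>c. \<lambda>b\<in>B. c (\<gamma> b))) c = (T \<circ> (\<lambda>c. \<Sum>b\<in>Basis. c b *\<^sub>R b)) c" by simp
  qed
  also have "distr (?P Basis) borel (T \<circ> (\<lambda>c. \<Sum>b\<in>Basis. c b *\<^sub>R b)) = distr lborel borel T"
    unfolding lborel_eq[where ?'a = 'a] by (rule distr_distr[symmetric]) auto
  finally show ?thesis using \<open>distr lborel borel T = lborel\<close> by simp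
qed

text \<open>The projection along e_i rather than the orthogonal one: it moves only the i-th
  coordinate and so fits integration along coordinate lines.\<close>

definition hyper_proj :: "'n::finite \<Rightarrow> 'n \<Rightarrow> int \<Rightarrow> real ^ 'n \<Rightarrow> real ^ 'n" where
  "hyper_proj i j m x = (\<chi> a. if a = i then x $ j - of_int m else x $ a)"

lemma hyper_proj_eq: "hyper_proj i j m x = x + (x $ j - x $ i - of_int m) *\<^sub>R axis i 1"
  by (auto simp: hyper_proj_def vec_eq_iff axis_def)

lemma continuous_on_vec_nth [continuous_intros]:
  "continuous_on S f \<Longrightarrow> continuous_on S (\<lambda>x. f x $ i :: 'b::topological_space)"
  by (rule continuous_on_component)

lemma measurable_vec_nth [measurable]: "(\<lambda>x :: real ^ 'n::finite. x $ i) \<in> borel_measurable borel"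
  by (intro borel_measurable_continuous_onI continuous_intros)

lemma measurable_hyper_proj [measurable]:
  "(hyper_proj i j m :: real ^ 'n::finite \<Rightarrow> _) \<in> borel \<rightarrow>\<^sub>M borel"
  unfolding hyper_proj_eq[abs_def] by measurable

lemma hyper_proj_in: "i \<noteq> j \<Longrightarrow> hyper_proj i j m x \<in> hyperplane i j m"
  by (simp add: hyper_proj_def hyperplane_def)

text \<open>Thicken H by length one along the unit normal. Adjoining \<nu> to an orthonormal basis
  of the directions of H gives one of the whole space, so the chosen base point and basis disappear
  from the formula.\<close>

lemma nn_integral_affine_volume:
  fixes \<nu> p :: "'a::euclidean_space"
  assumes \<nu>: "norm \<nu> = 1" and p: "p \<in> H" and H: "H = {x. \<nu> \<bullet> x = d}"
    and [measurable]: "h \<in> borel_measurable borel"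
  shows "(\<integral>\<^sup>+x. h x \<partial>affine_volume H) =
    (\<integral>\<^sup>+x. indicator {0..1::real} (\<nu> \<bullet> x - d) * h (x - (\<nu> \<bullet> x - d) *\<^sub>R \<nu>) \<partial>lborel)"
proof -
  have \<nu>\<nu>: "\<nu> \<bullet> \<nu> = 1" using \<nu> by (simp add: norm_eq_1)
  define q where "q = (SOME p. p \<in> H)"
  have q: "\<nu> \<bullet> q = d" using p someI[of "\<lambda>p. p \<in> H"] H by (auto simp: q_def)
  define dir where "dir = {x - y | x y. x \<in> H \<and> y \<in> H}"
  have dir: "dir = {z. \<nu> \<bullet> z = 0}"
  proof (rule equalityI; rule subsetI)
    fix z assume "z \<in> {z. \<nu> \<bullet> z = 0}"
    then have "z = (q + z) - q \<and> q + z \<in> H \<and> q \<in> H" using q H by (simp add: inner_add_right)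
    then show "z \<in> dir" unfolding dir_def by blast
  qed (auto simp: dir_def H inner_diff_right)
  have sub: "subspace dir" unfolding dir by (rule subspace_hyperplane)
  define P where "P B \<longleftrightarrow> pairwise orthogonal B \<and> (\<forall>b\<in>B. norm b = 1) \<and> span B = dir" for B :: "'a set"
  define B where "B = (SOME B. P B)"
  obtain B' where "B' \<subseteq> dir" "pairwise orthogonal B'" "\<And>x. x \<in> B' \<Longrightarrow> norm x = 1" "span B' = dir"
    using orthonormal_basis_subspace[OF sub] by metis
  then have "P B'" by (simp add: P_def)
  then have "P B" unfolding B_def by (rule someI)
  then have orth: "pairwise orthogonal B" and norm: "\<And>b. b \<in> B \<Longrightarrow> norm b = 1" and span: "span B = dir"
    by (auto simp: P_def)
  have \<nu>B: "\<nu> \<bullet> b = 0" if "b \<in> B" for b using span_base[OF that] span dir by auto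
  then have nin: "\<nu> \<notin> B" using \<nu>\<nu> by auto
  have fin: "finite B" using orth norm[of 0]
    by (intro independent_imp_finite pairwise_orthogonal_independent) auto
  have "affine_volume H = distr (\<Pi>\<^sub>M b\<in>B. lborel) borel (\<lambda>c. q + (\<Sum>b\<in>B. c b *\<^sub>R b))"
    unfolding affine_volume_def Let_def q_def[symmetric] dir_def[symmetric] P_def[symmetric] B_def[symmetric] ..
  then have lhs: "(\<integral>\<^sup>+x. h x \<partial>affine_volume H) = (\<integral>\<^sup>+c. h (q + (\<Sum>b\<in>B. c b *\<^sub>R b)) \<partial>(\<Pi>\<^sub>M b\<in>B. lborel))"
    using fin by (simp add: nn_integral_distr)
  have "orthogonal \<nu> b \<and> orthogonal b \<nu>" if "b \<in> B" for b
    using \<nu>B[OF that] by (simp add: orthogonal_def inner_commute)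
  then have orth': "pairwise orthogonal (insert \<nu> B)"
    using orth by (auto simp: pairwise_insert)
  have "x \<in> span (insert \<nu> B)" for x
  proof -
    have "x - (\<nu> \<bullet> x) *\<^sub>R \<nu> \<in> span B"
      using \<nu>\<nu> by (simp add: span dir inner_diff_right)
    then show ?thesis by (auto simp: span_insert)
  qed
  then have span': "span (insert \<nu> B) = UNIV" by auto
  interpret P: product_sigma_finite "\<lambda>_::'a. lborel :: real measure" ..
  define g where "g x = indicator {0..1::real} (\<nu> \<bullet> x - d) * h (x - (\<nu> \<bullet> x - d) *\<^sub>R \<nu>)" for x
  have [measurable]: "g \<in> borel_measurable borel" unfolding g_def by measurable
  have inner: "(\<Sum>b\<in>B. c b * (\<nu> \<bullet> b)) = 0" for c using \<nu>B by (intro sum.neutral) auto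
  have "(\<integral>\<^sup>+x. g x \<partial>lborel) = (\<integral>\<^sup>+x. g (x + q) \<partial>lborel)"
    by (rule nn_integral_lborel_translate[symmetric]) measurable
  also have "\<dots> = (\<integral>\<^sup>+c. g ((\<Sum>b\<in>insert \<nu> B. c b *\<^sub>R b) + q) \<partial>(\<Pi>\<^sub>M b\<in>insert \<nu> B. lborel))"
    by (subst distr_PiM_orthonormal[OF orth' _ span', symmetric]) (use \<nu> norm fin in \<open>auto simp: nn_integral_distr simp del: sum.insert\<close>)
  also have "\<dots> = (\<integral>\<^sup>+c. (\<integral>\<^sup>+t. g ((\<Sum>b\<in>insert \<nu> B. (c(\<nu> := t)) b *\<^sub>R b) + q) \<partial>lborel) \<partial>(\<Pi>\<^sub>M b\<in>B. lborel))"
    using fin nin by (intro P.product_nn_integral_insert) (auto simp del: sum.insert)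
  also have "\<dots> = (\<integral>\<^sup>+c. (\<integral>\<^sup>+t. h (q + (\<Sum>b\<in>B. c b *\<^sub>R b)) * indicator {0..1::real} t \<partial>lborel) \<partial>(\<Pi>\<^sub>M b\<in>B. lborel))"
  proof (intro nn_integral_cong)
    fix c :: "'a \<Rightarrow> real" and t :: real
    have "(\<Sum>b\<in>insert \<nu> B. (c(\<nu> := t)) b *\<^sub>R b) = t *\<^sub>R \<nu> + (\<Sum>b\<in>B. c b *\<^sub>R b)"
      using fin nin by (auto intro!: sum.cong)
    then show "g ((\<Sum>b\<in>insert \<nu> B. (c(\<nu> := t)) b *\<^sub>R b) + q) = h (q + (\<Sum>b\<in>B. c b *\<^sub>R b)) * indicator {0..1} t"
      using q \<nu>\<nu> by (simp add: g_def inner_add_right inner_sum_right inner algebra_simps)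
  qed
  also have "\<dots> = (\<integral>\<^sup>+c. h (q + (\<Sum>b\<in>B. c b *\<^sub>R b)) \<partial>(\<Pi>\<^sub>M b\<in>B. lborel))"
    by (intro nn_integral_cong) (simp add: nn_integral_cmult)
  finally show ?thesis using lhs by (simp add: g_def)
qed

text \<open>A shear along H turns the orthogonal projection into \<open>hyper_proj\<close>, and
  integration along e_i exchanges the slab across H for 0 \<le> x_i \<le> 1. The factor sqrt 2 is
  the ratio of areas between H and its image when the coordinate x_i is forgotten.\<close>

lemma affine_volume_hyperplane:
  fixes i j :: "'n::finite"
  assumes ij: "i \<noteq> j"
  shows "affine_volume (hyperplane i j m) =
    distr (density lborel (\<lambda>x. ennreal (sqrt 2 * indicator {0..1} (x $ i)))) borel (hyper_proj i j m)"
proof (rule measure_eqI)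
  show s: "sets (affine_volume (hyperplane i j m)) =
    sets (distr (density lborel (\<lambda>x. ennreal (sqrt 2 * indicator {0..1} (x $ i)))) borel (hyper_proj i j m))"
    by (simp add: affine_volume_def Let_def)
  fix A assume "A \<in> sets (affine_volume (hyperplane i j m))"
  then have [measurable]: "A \<in> sets borel" by (simp add: affine_volume_def Let_def)
  define \<nu> :: "real ^ 'n" where "\<nu> = (1 / sqrt 2) *\<^sub>R (axis j 1 - axis i 1)"
  define d where "d = of_int m / sqrt 2"
  have in\<nu>: "\<nu> \<bullet> x = (x $ j - x $ i) / sqrt 2" for x
    by (simp add: \<nu>_def inner_diff_left inner_axis' diff_divide_distrib)
  have "\<nu> \<bullet> \<nu> = 1" unfolding in\<nu> using ij by (simp add: \<nu>_def axis_def)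
  then have \<nu>: "norm \<nu> = 1" by (simp add: norm_eq_1)
  have H: "hyperplane i j m = {x. \<nu> \<bullet> x = d}" by (auto simp: hyperplane_def in\<nu> d_def field_simps)
  have p: "hyper_proj i j m 0 \<in> hyperplane i j m" using ij by (rule hyper_proj_in)
  define l where "l x = \<nu> \<bullet> x - d" for x
  have [measurable]: "l \<in> borel_measurable borel" unfolding l_def by measurable
  \<comment> \<open>A tangent vector of H: the normal step \<nu> plus the multiple of e_i that
    returns to the same level.\<close>
  define v :: "real ^ 'n" where "v = \<nu> + sqrt 2 *\<^sub>R axis i 1"
  have "\<nu> \<bullet> v = 0" unfolding in\<nu> using ij by (simp add: v_def \<nu>_def axis_def field_simps)
  then have lv: "l (x + t *\<^sub>R v) = l x" for x t by (simp add: l_def inner_add_right)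
  have "\<nu> \<bullet> axis i 1 = - 1 / sqrt 2" unfolding in\<nu> using ij by (simp add: axis_def)
  then have li: "l (x + t *\<^sub>R axis i 1) = l x - t / sqrt 2" for x t by (simp add: l_def inner_add_right)
  have proj: "x + l x *\<^sub>R v - l (x + l x *\<^sub>R v) *\<^sub>R \<nu> = hyper_proj i j m x" for x
  proof -
    have "l x * sqrt 2 = x $ j - x $ i - of_int m"
      by (simp add: l_def in\<nu> d_def field_simps)
    then show ?thesis unfolding lv by (simp add: v_def hyper_proj_eq scaleR_right_distrib)
  qed
  have proj_i: "hyper_proj i j m (x + t *\<^sub>R axis i 1) = hyper_proj i j m x" for x t
    using ij by (auto simp: hyper_proj_def vec_eq_iff axis_def)
  let ?h = "indicator A :: real ^ 'n \<Rightarrow> ennreal"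
  have "emeasure (affine_volume (hyperplane i j m)) A = (\<integral>\<^sup>+x. ?h x \<partial>affine_volume (hyperplane i j m))"
    by (subst nn_integral_indicator) (auto simp: affine_volume_def Let_def)
  also have "\<dots> = (\<integral>\<^sup>+x. indicator {0..1::real} (l x) * ?h (x - l x *\<^sub>R \<nu>) \<partial>lborel)"
    unfolding l_def by (rule nn_integral_affine_volume[OF \<nu> p H]) measurable
  also have "\<dots> = (\<integral>\<^sup>+x. indicator {0..1::real} (l (x + l x *\<^sub>R v)) * ?h (x + l x *\<^sub>R v - l (x + l x *\<^sub>R v) *\<^sub>R \<nu>) \<partial>lborel)"
    by (rule nn_integral_lborel_shear[symmetric, where G = "\<lambda>x. indicator {0..1::real} (l x) * ?h (x - l x *\<^sub>R \<nu>)"])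
      (use lv in measurable)
  also have "\<dots> = (\<integral>\<^sup>+x. indicator {0..1::real} (l x) * ?h (hyper_proj i j m x) \<partial>lborel)"
    by (simp only: proj) (simp only: lv)
  also have "\<dots> = (\<integral>\<^sup>+x. indicator {0..1::real} (x $ i) *
      (\<integral>\<^sup>+t. indicator {0..1::real} (l (x + t *\<^sub>R axis i 1)) * ?h (hyper_proj i j m (x + t *\<^sub>R axis i 1)) \<partial>lborel) \<partial>lborel)"
    by (rule nn_integral_lborel_line[where l = "\<lambda>x. x $ i"]) (auto simp: axis_def)
  also have "\<dots> = (\<integral>\<^sup>+x. ennreal (sqrt 2 * indicator {0..1} (x $ i)) * ?h (hyper_proj i j m x) \<partial>lborel)"
  proof (rule nn_integral_cong)
    \<comment> \<open>Along e_i the level l falls with slope 1 / sqrt 2, so the slab is crossed in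
      time sqrt 2.\<close>
    fix x :: "real ^ 'n"
    have "(\<integral>\<^sup>+t. indicator {0..1::real} (l (x + t *\<^sub>R axis i 1)) * ?h (hyper_proj i j m (x + t *\<^sub>R axis i 1)) \<partial>lborel)
      = (\<integral>\<^sup>+t. indicator {sqrt 2 * (l x - 1)..sqrt 2 * l x} t * ?h (hyper_proj i j m x) \<partial>lborel)"
      unfolding proj_i li by (intro nn_integral_cong) (auto simp: indicator_def field_simps)
    also have "\<dots> = ennreal (sqrt 2) * ?h (hyper_proj i j m x)"
      by (subst nn_integral_multc) (auto simp: algebra_simps)
    finally show "indicator {0..1::real} (x $ i) *
        (\<integral>\<^sup>+t. indicator {0..1::real} (l (x + t *\<^sub>R axis i 1)) * ?h (hyper_proj i j m (x + t *\<^sub>R axis i 1)) \<partial>lborel) =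
        ennreal (sqrt 2 * indicator {0..1} (x $ i)) * ?h (hyper_proj i j m x)"
      by (simp add: indicator_def)
  qed
  also have "\<dots> = (\<integral>\<^sup>+x. ?h (hyper_proj i j m x) \<partial>density lborel (\<lambda>x. ennreal (sqrt 2 * indicator {0..1} (x $ i))))"
    by (subst nn_integral_density) auto
  also have "\<dots> = emeasure (distr (density lborel (\<lambda>x. ennreal (sqrt 2 * indicator {0..1} (x $ i)))) borel (hyper_proj i j m)) A"
    by (subst nn_integral_indicator[symmetric], simp, subst nn_integral_distr) auto
  finally show "emeasure (affine_volume (hyperplane i j m)) A =
    emeasure (distr (density lborel (\<lambda>x. ennreal (sqrt 2 * indicator {0..1} (x $ i)))) borel (hyper_proj i j m)) A" .
qed

lemma
  fixes h :: "real ^ 'n::finite \<Rightarrow> complex"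
  assumes "i \<noteq> j" and [measurable]: "h \<in> borel_measurable borel"
  shows integral_affine_volume: "integral\<^sup>L (affine_volume (hyperplane i j m)) h =
      sqrt 2 * (\<integral>x. indicator {0..1} (x $ i) *\<^sub>R h (hyper_proj i j m x) \<partial>lborel)"
    and integrable_affine_volume: "integrable (affine_volume (hyperplane i j m)) h \<longleftrightarrow>
      integrable lborel (\<lambda>x. indicator {0..1} (x $ i) *\<^sub>R h (hyper_proj i j m x))"
proof -
  have m: "(\<lambda>x. sqrt 2 * indicator {0..1} (x $ i)) \<in> borel_measurable (lborel :: (real ^ 'n) measure)" by measurable
  have iff: "integrable lborel (\<lambda>x. sqrt 2 *\<^sub>R f x) \<longleftrightarrow> integrable lborel f" for f :: "real ^ 'n \<Rightarrow> complex"
    using integrable_scaleR_right[of "1 / sqrt 2" lborel "\<lambda>x. sqrt 2 *\<^sub>R f x"]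
      integrable_scaleR_right[of "sqrt 2" lborel f] by auto
  show "integral\<^sup>L (affine_volume (hyperplane i j m)) h =
      sqrt 2 * (\<integral>x. indicator {0..1} (x $ i) *\<^sub>R h (hyper_proj i j m x) \<partial>lborel)"
    unfolding affine_volume_hyperplane[OF assms(1)]
    by (simp add: integral_distr integral_density[OF _ m] scaleR_scaleR[symmetric] scaleR_conv_of_real[of "sqrt 2"] mult_scaleR_right[symmetric] del: scaleR_scaleR mult_scaleR_right)
  show "integrable (affine_volume (hyperplane i j m)) h \<longleftrightarrow>
      integrable lborel (\<lambda>x. indicator {0..1} (x $ i) *\<^sub>R h (hyper_proj i j m x))"
    unfolding affine_volume_hyperplane[OF assms(1)]
    by (simp add: integrable_distr_eq integrable_density[OF _ m] iff scaleR_scaleR[symmetric] del: scaleR_scaleR)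
qed

section \<open>Test functions\<close>

lemma partial_eq: "(f has_derivative D) (at x) \<Longrightarrow> partial i f x = D (axis i 1)"
  unfolding partial_def by (metis frechet_derivative_at)

lemma Ck_SucD: "Ck (Suc r) f \<Longrightarrow> Ck r f"
proof (induction r arbitrary: f)
  case 0
  then show ?case
    by (simp add: continuous_at_imp_continuous_on differentiable_imp_continuous_within)
next
  case (Suc r)
  then show ?case by (metis Ck.simps(2))
qed

lemma Ck_SucI:
  assumes "\<And>x. f differentiable at x" "\<And>i x. partial i f x = g i x" "\<And>i. Ck r (g i)"
  shows "Ck (Suc r) f"
proof -
  have "partial i f = g i" for i using assms(2) by auto
  then show ?thesis using assms by simp
qed

lemma frechet_works: "f differentiable at x \<Longrightarrow> (f has_derivative frechet_derivative f (at x)) (at x)"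
  by (simp add: frechet_derivative_works)

lemma Ck_const: "Ck r (\<lambda>_. c)"
proof (induction r arbitrary: c)
  case (Suc r)
  then show ?case by (intro Ck_SucI[where g = "\<lambda>_ _. 0"]) (auto intro!: partial_eq[THEN trans] derivative_eq_intros)
qed simp

lemma Ck_add: "Ck r f \<Longrightarrow> Ck r g \<Longrightarrow> Ck r (\<lambda>x. f x + g x)"
proof (induction r arbitrary: f g)
  case (Suc r)
  have *: "((\<lambda>x. f x + g x) has_derivative (\<lambda>h. frechet_derivative f (at x) h + frechet_derivative g (at x) h)) (at x)" for x
    using Suc.prems by (intro has_derivative_add frechet_works) auto
  show ?case
    using Suc
    by (intro Ck_SucI[where g = "\<lambda>i x. partial i f x + partial i g x"])
      (auto intro: differentiableI[OF *] simp: partial_eq[OF *] simp flip: partial_def)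
qed (simp add: continuous_on_add)

lemma Ck_mult: "Ck r f \<Longrightarrow> Ck r g \<Longrightarrow> Ck r (\<lambda>x. f x * g x)"
proof (induction r arbitrary: f g)
  case (Suc r)
  have *: "((\<lambda>x. f x * g x) has_derivative (\<lambda>h. f x * frechet_derivative g (at x) h + frechet_derivative f (at x) h * g x)) (at x)" for x
    using Suc.prems by (intro has_derivative_mult frechet_works) auto
  have "Ck r f" "Ck r g" using Ck_SucD Suc.prems by blast+
  then show ?case
    using Suc
    by (intro Ck_SucI[where g = "\<lambda>i x. f x * partial i g x + partial i f x * g x"])
      (auto intro: differentiableI[OF *] intro!: Ck_add simp: partial_eq[OF *] simp flip: partial_def)
qed (simp add: continuous_on_mult)

lemma Ck_coordinate: "Ck r (\<lambda>x. of_real (x $ j))"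
proof (induction r)
  case 0
  show ?case by (auto intro!: continuous_intros)
next
  case (Suc r)
  have *: "((\<lambda>x. complex_of_real (x $ j)) has_derivative (\<lambda>h. of_real (h $ j))) (at x)" for x :: "real ^ 'a"
    by (intro has_derivative_of_real bounded_linear_imp_has_derivative bounded_linear_vec_nth)
  show ?case
    by (intro Ck_SucI[where g = "\<lambda>i _. of_real (axis i 1 $ j)"] Ck_const)
      (auto intro: differentiableI[OF *] simp: partial_eq[OF *])
qed

text \<open>Up to linear combinations this family is closed under differentiation, which makes
  smoothness of exp(-1/t), extended by zero, an induction on the order.\<close>

definition flat_exp :: "nat \<Rightarrow> real \<Rightarrow> real" where
  "flat_exp k t = (if t > 0 then exp (- (1 / t)) / t ^ k else 0)"

lemma flat_exp_nonneg: "flat_exp k t \<ge> 0"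
  by (simp add: flat_exp_def)

lemma flat_exp_tendsto_0: "(flat_exp k \<longlongrightarrow> 0) (at 0)"
proof (rule filterlim_split_at)
  show "(flat_exp k \<longlongrightarrow> 0) (at_left 0)"
    by (rule tendsto_eventually) (auto simp: flat_exp_def eventually_at_filter)
  have "((\<lambda>t::real. inverse t ^ k / exp (inverse t)) \<longlongrightarrow> 0) (at_right 0)"
    using tendsto_power_div_exp_0 filterlim_inverse_at_top_right by (rule filterlim_compose)
  moreover have "\<forall>\<^sub>F t in at_right 0. inverse t ^ k / exp (inverse t) = flat_exp k t"
    unfolding eventually_at_filter
    by (auto simp: flat_exp_def exp_minus divide_simps)
  ultimately show "(flat_exp k \<longlongrightarrow> 0) (at_right 0)" by (rule Lim_transform_eventually)
qed

lemma flat_exp_deriv: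
  "(flat_exp k has_real_derivative flat_exp (k + 2) t - real k * flat_exp (k + 1) t) (at t)"
proof -
  consider "t > 0" | "t < 0" | "t = 0" by linarith
  then show ?thesis
  proof cases
    case 1
    have "((\<lambda>t. exp (- (1 / t)) / t ^ k) has_real_derivative flat_exp (k + 2) t - real k * flat_exp (k + 1) t) (at t)"
    proof -
      have P: "l = 0 \<or> t * t ^ (l - Suc 0) = t ^ l" for l by (cases l) auto
      have "k = 0 \<or> k = 1 \<or> (\<exists>l. k = Suc (Suc l))" by presburger
      then show ?thesis
        using 1 P by (elim disjE exE;
          auto intro!: derivative_eq_intros simp: flat_exp_def field_simps power2_eq_square; metis)
    qed
    then show ?thesis
      by (rule has_field_derivative_transform_within_open[where S = "{0<..}"]) (use 1 in \<open>auto simp: flat_exp_def\<close>)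
  next
    case 2
    have "((\<lambda>_. 0) has_real_derivative flat_exp (k + 2) t - real k * flat_exp (k + 1) t) (at t)"
      using 2 by (auto simp: flat_exp_def)
    then show ?thesis
      by (rule has_field_derivative_transform_within_open[where S = "{..<0}"]) (use 2 in \<open>auto simp: flat_exp_def\<close>)
  next
    case 3
    \<comment> \<open>The difference quotient of \<open>flat_exp k\<close> at 0 is
      \<open>flat_exp (Suc k)\<close>, which tends to 0.\<close>
    have "((\<lambda>h. (flat_exp k (0 + h) - flat_exp k 0) / h) \<longlongrightarrow> 0) (at 0)"
      by (rule Lim_transform_eventually[OF flat_exp_tendsto_0[of "Suc k"]])
        (auto simp: flat_exp_def eventually_at_filter)
    then show ?thesis using 3 by (simp add: DERIV_def flat_exp_def)
  qed
qed

text \<open>Both the factor p and the exponent k are general, because a partial derivative is a sum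
  of terms of the same form with new factors and exponents k, k + 1, k + 2.\<close>

lemma Ck_flat_exp:
  fixes y :: "real ^ 'n::finite"
  assumes "Ck r p"
  shows "Ck r (\<lambda>x. p x * of_real (flat_exp k (e - (\<Sum>a\<in>UNIV. (x $ a - y $ a)\<^sup>2))))"
  using assms
proof (induction r arbitrary: p k)
  case 0
  have "isCont (flat_exp k) t" for t by (rule DERIV_isCont[OF flat_exp_deriv])
  then have "continuous_on UNIV (flat_exp k)" by (simp add: continuous_at_imp_continuous_on)
  then have "continuous_on UNIV (\<lambda>x. flat_exp k (e - (\<Sum>a\<in>UNIV. (x $ a - y $ a)\<^sup>2)))"
    by (rule continuous_on_compose2) (auto intro!: continuous_intros)
  then show ?case using 0 by (auto intro!: continuous_intros)
next
  case (Suc r)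
  define q where "q x = e - (\<Sum>a\<in>UNIV. (x $ a - y $ a)\<^sup>2)" for x
  define q' where "q' x h = - (\<Sum>a\<in>UNIV. 2 * (x $ a - y $ a) * h $ a)" for x h :: "real ^ 'n"
  have q: "(q has_derivative q' x) (at x)" for x
    unfolding q_def[abs_def] q'_def[abs_def]
    by (auto intro!: derivative_eq_intros has_derivative_sum simp: sum_negf[symmetric] algebra_simps
        intro: bounded_linear_imp_has_derivative bounded_linear_vec_nth)
  let ?g = "\<lambda>k x. complex_of_real (flat_exp k (q x))"
  let ?d = "\<lambda>x. flat_exp (k + 2) (q x) - real k * flat_exp (k + 1) (q x)"
  have g: "(?g k has_derivative (\<lambda>h. of_real (?d x * q' x h))) (at x)" for x
    using has_derivative_of_real[OF has_derivative_compose[OF q flat_exp_deriv[unfolded has_field_derivative_def]]] by simp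
  have *: "((\<lambda>x. p x * ?g k x) has_derivative
      (\<lambda>h. p x * of_real (?d x * q' x h) + frechet_derivative p (at x) h * ?g k x)) (at x)" for x
    using Suc.prems by (intro has_derivative_mult frechet_works g) auto
  have q'_axis: "q' x (axis i 1) = - 2 * (x $ i - y $ i)" for x i
    unfolding q'_def by (simp add: axis_def if_distrib cong: if_cong)
  let ?l = "\<lambda>i x. (- 2 :: complex) * (of_real (x $ i) + of_real (- y $ i))"
  have smooth: "Ck r (\<lambda>x. p x * ?l i x)" for i
    using Ck_SucD[OF Suc.prems] by (intro Ck_mult Ck_const Ck_add Ck_coordinate)
  have "Ck (Suc r) (\<lambda>x. p x * ?g k x)"
  proof (rule Ck_SucI)
    show "(\<lambda>x. p x * ?g k x) differentiable at x" for x using * by (rule differentiableI)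
    show "partial i (\<lambda>x. p x * ?g k x) x = (p x * ?l i x) * ?g (k + 2) x +
        ((- of_nat k) * (p x * ?l i x) * ?g (k + 1) x + partial i p x * ?g k x)" for i x
      by (subst partial_eq[OF *]) (simp add: q'_axis partial_def algebra_simps)
    show "Ck r (\<lambda>x. (p x * ?l i x) * ?g (k + 2) x +
        ((- of_nat k) * (p x * ?l i x) * ?g (k + 1) x + partial i p x * ?g k x))" for i
      unfolding q_def using Suc.prems by (intro Ck_add Suc.IH Ck_mult[OF Ck_const] smooth) auto
  qed
  then show ?case unfolding q_def .
qed

definition bump :: "real ^ 'n::finite \<Rightarrow> real \<Rightarrow> real ^ 'n \<Rightarrow> real" where
  "bump y e x = flat_exp 0 (e\<^sup>2 - (\<Sum>a\<in>UNIV. (x $ a - y $ a)\<^sup>2))"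

lemma bump_nonneg: "bump y e x \<ge> 0"
  by (simp add: bump_def flat_exp_nonneg)

lemma bump_pos_iff:
  assumes "e > 0"
  shows "bump y e x > 0 \<longleftrightarrow> dist x y < e"
proof -
  have "(\<Sum>a\<in>UNIV. (x $ a - y $ a)\<^sup>2) = (dist x y)\<^sup>2"
    by (simp add: dist_vec_def L2_set_def dist_real_def sum_nonneg)
  then have "bump y e x > 0 \<longleftrightarrow> (dist x y)\<^sup>2 < e\<^sup>2" by (auto simp: bump_def flat_exp_def)
  also have "\<dots> \<longleftrightarrow> dist x y < e" using assms
    by (metis less_eq_real_def power2_less_imp_less power_strict_mono zero_le_dist zero_less_numeral)
  finally show ?thesis .
qed

lemma test_function_bump:
  assumes "e > 0"
  shows "test_function (\<lambda>x. complex_of_real (bump y e x))"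
proof -
  have "Ck r (\<lambda>x. complex_of_real (bump y e x))" for r
    using Ck_flat_exp[OF Ck_const[of r 1], of 0 "e\<^sup>2" y] by (simp add: bump_def)
  moreover have "{x. complex_of_real (bump y e x) \<noteq> 0} \<subseteq> cball y e"
    using bump_pos_iff[OF assms, of y] bump_nonneg[of y e]
    by (auto simp: dist_commute) (metis less_eq_real_def)
  then have "compact (closure {x. complex_of_real (bump y e x) \<noteq> 0})"
    using bounded_subset[OF bounded_cball] by (simp add: compact_closure)
  ultimately show ?thesis by (simp add: test_function_def)
qed

lemma partial_has_vector_derivative:
  assumes "f differentiable at (x + t *\<^sub>R axis i 1)"
  shows "((\<lambda>t. f (x + t *\<^sub>R axis i 1)) has_vector_derivative partial i f (x + t *\<^sub>R axis i 1)) (at t)"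
proof -
  let ?D = "frechet_derivative f (at (x + t *\<^sub>R axis i 1))"
  have D: "(f has_derivative ?D) (at (x + t *\<^sub>R axis i 1))" using assms by (rule frechet_works)
  have l: "((\<lambda>t. x + t *\<^sub>R axis i 1) has_derivative (\<lambda>h. h *\<^sub>R axis i 1)) (at t)"
    by (auto intro!: derivative_eq_intros)
  have "((\<lambda>t. f (x + t *\<^sub>R axis i 1)) has_derivative (\<lambda>h. ?D (h *\<^sub>R axis i 1))) (at t)"
    using has_derivative_compose[OF l D] .
  moreover have "?D (h *\<^sub>R axis i 1) = h *\<^sub>R partial i f (x + t *\<^sub>R axis i 1)" for h
    using has_derivative_linear[OF D] by (simp add: linear_scale partial_def)
  ultimately show ?thesis by (simp add: has_vector_derivative_def)
qed

lemma partial_zero_outside: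
  assumes "x \<notin> closure {x. f x \<noteq> 0}"
  shows "partial i f x = 0"
proof -
  have "(f has_derivative (\<lambda>_. 0)) (at x)"
    by (rule has_derivative_transform_within_open[of "\<lambda>_. 0" _ _ _ "- closure {x. f x \<noteq> 0}"])
      (use assms closure_subset[of "{x. f x \<noteq> 0}"] in \<open>auto simp: open_Compl\<close>)
  then show ?thesis by (simp add: partial_eq)
qed

lemma test_functionD:
  assumes "test_function \<phi>"
  shows "\<phi> differentiable at x" "partial i \<phi> differentiable at x"
    "continuous_on UNIV \<phi>" "continuous_on UNIV (partial i \<phi>)" "continuous_on UNIV (partial i (partial i \<phi>))"
    "continuous_on UNIV (laplacian \<phi>)"
proof -
  have C: "Ck r \<phi>" for r using assms by (simp add: test_function_def)
  show "\<phi> differentiable at x" "partial i \<phi> differentiable at x" using C[of 2] by (auto simp: numeral_2_eq_2)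
  show "continuous_on UNIV \<phi>" "continuous_on UNIV (partial i \<phi>)" "continuous_on UNIV (partial i (partial i \<phi>))"
    using C[of 0] C[of 1] C[of 2] by (auto simp: numeral_2_eq_2)
  have "continuous_on UNIV (partial i (partial i \<phi>))" for i using C[of 2] by (auto simp: numeral_2_eq_2)
  then show "continuous_on UNIV (laplacian \<phi>)"
    unfolding laplacian_def[abs_def] by (intro continuous_on_sum)
qed

text \<open>Integration by parts twice. The primitive v \<phi>' - v' \<phi> jumps by - J \<phi> at a
  kink; adding step functions of height J \<phi> makes it continuous, so the fundamental theorem
  applies with finitely many exceptional points.\<close>

lemma kink_integral:
  fixes v v1 v2 \<phi> \<phi>1 \<phi>2 :: "real \<Rightarrow> complex" and L J :: "real \<Rightarrow> complex"
  assumes S: "finite S" and ab: "a \<le> b" "S \<subseteq> {a<..<b}"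
    and v: "\<And>t. isCont v t"
    and v1: "\<And>t. t \<in> {a..b} - S \<Longrightarrow> (v has_vector_derivative v1 t) (at t)"
    and v2: "\<And>t. t \<in> {a..b} - S \<Longrightarrow> (v1 has_vector_derivative v2 t) (at t)"
    and L: "\<And>s. s \<in> S \<Longrightarrow> (v1 \<longlongrightarrow> L s) (at_left s)"
    and J: "\<And>s. s \<in> S \<Longrightarrow> (v1 \<longlongrightarrow> L s + J s) (at_right s)"
    and \<phi>1: "\<And>t. (\<phi> has_vector_derivative \<phi>1 t) (at t)"
    and \<phi>2: "\<And>t. (\<phi>1 has_vector_derivative \<phi>2 t) (at t)"
    and z: "\<phi> a = 0" "\<phi> b = 0" "\<phi>1 a = 0" "\<phi>1 b = 0"
  shows "((\<lambda>t. v t * \<phi>2 t - v2 t * \<phi> t) has_integral (\<Sum>s\<in>S. J s * \<phi> s)) {a..b}"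
proof -
  \<comment> \<open>At a kink V takes the left limit of the derivative, in accordance with
    \<open>step\<close>, which sets in strictly after s.\<close>
  define V where "V t = (if t \<in> S then L t else v1 t)" for t
  define step where "step s t = (if s < t then J s * \<phi> s else 0)" for s t
  define W where "W t = v t * \<phi>1 t - V t * \<phi> t + (\<Sum>s\<in>S. step s t)" for t
  have \<phi>_cont: "isCont \<phi> t" "isCont \<phi>1 t" for t
    using \<phi>1 \<phi>2 has_vector_derivative_continuous by blast+
  have notin: "\<forall>\<^sub>F u in at t. u \<notin> S" for t
    using islimpt_finite[OF S, of t] by (simp add: islimpt_iff_eventually)
  have W': "(W has_vector_derivative v t * \<phi>2 t - v2 t * \<phi> t) (at t)" if t: "t \<in> {a..b} - S" for t
  proof -
    have "(V has_vector_derivative v2 t) (at t)"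
      by (rule has_vector_derivative_transform_within_open[OF v2[OF t], of "- S"])
        (use t finite_imp_closed[OF S] in \<open>auto simp: V_def\<close>)
    moreover have "(step s has_vector_derivative 0) (at t)" if "s \<in> S" for s
    proof (cases "t < s")
      case True
      show ?thesis
        by (rule has_vector_derivative_transform_within_open[OF has_vector_derivative_const, of "{..<s}"])
          (use True in \<open>auto simp: step_def\<close>)
    next
      case False
      with t that have "s < t" by (metis DiffD2 linorder_neqE)
      show ?thesis
        by (rule has_vector_derivative_transform_within_open[OF has_vector_derivative_const, of "{s<..}"])
          (use \<open>s < t\<close> in \<open>auto simp: step_def\<close>)
    qed
    ultimately have "(W has_vector_derivative
        ((v t * \<phi>2 t + v1 t * \<phi>1 t) - (V t * \<phi>1 t + v2 t * \<phi> t) + (\<Sum>s\<in>S. 0))) (at t)"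
      unfolding W_def using v1[OF t] \<phi>1 \<phi>2
      by (intro has_vector_derivative_add has_vector_derivative_diff has_vector_derivative_mult has_vector_derivative_sum) auto
    then show ?thesis using t by (simp add: V_def)
  qed
  have "isCont W s" if s: "s \<in> S" for s
  proof -
    have left: "(step s' \<longlongrightarrow> step s' s) (at_left s)" for s'
    proof (rule tendsto_eventually)
      show "\<forall>\<^sub>F u in at_left s. step s' u = step s' s"
      proof (cases "s' < s")
        case True
        show ?thesis using eventually_at_left_real[OF True] by eventually_elim (use True in \<open>simp add: step_def\<close>)
      qed (auto simp: step_def eventually_at_filter)
    qed
    have right: "(step s' \<longlongrightarrow> step s' s + (if s' = s then J s * \<phi> s else 0)) (at_right s)" for s'
    proof (rule tendsto_eventually)
      show "\<forall>\<^sub>F u in at_right s. step s' u = step s' s + (if s' = s then J s * \<phi> s else 0)"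
      proof (cases "s < s'")
        case True
        show ?thesis using eventually_at_right_real[OF True] by eventually_elim (use True in \<open>simp add: step_def\<close>)
      qed (auto simp: step_def eventually_at_filter)
    qed
    have ev: "\<forall>\<^sub>F u in at_left s. v1 u = V u" "\<forall>\<^sub>F u in at_right s. v1 u = V u"
      using notin[of s] by (auto simp: V_def eventually_at_filter elim!: eventually_mono)
    have lim: "(v \<longlongrightarrow> v s) (at s within A)" "(\<phi> \<longlongrightarrow> \<phi> s) (at s within A)" "(\<phi>1 \<longlongrightarrow> \<phi>1 s) (at s within A)" for A
      using v[of s] \<phi>_cont[of s] unfolding isCont_def by (auto intro: tendsto_within_subset)
    have "(W \<longlongrightarrow> v s * \<phi>1 s - L s * \<phi> s + (\<Sum>s'\<in>S. step s' s)) (at_left s)"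
      unfolding W_def using Lim_transform_eventually[OF L[OF s] ev(1)]
      by (intro tendsto_intros lim left)
    moreover have "(W \<longlongrightarrow> v s * \<phi>1 s - (L s + J s) * \<phi> s + (\<Sum>s'\<in>S. step s' s + (if s' = s then J s * \<phi> s else 0))) (at_right s)"
      unfolding W_def using Lim_transform_eventually[OF J[OF s] ev(2)]
      by (intro tendsto_intros lim right)
    moreover have "W s = v s * \<phi>1 s - L s * \<phi> s + (\<Sum>s'\<in>S. step s' s)"
      "W s = v s * \<phi>1 s - (L s + J s) * \<phi> s + (\<Sum>s'\<in>S. step s' s + (if s' = s then J s * \<phi> s else 0))"
      using s S by (simp_all add: W_def V_def sum.distrib algebra_simps)
    ultimately show ?thesis unfolding isCont_def by (metis filterlim_split_at)
  qed
  then have cont: "continuous_on {a..b} W"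
    using W' has_vector_derivative_continuous
    by (metis DiffI continuous_at_imp_continuous_on)
  have "((\<lambda>t. v t * \<phi>2 t - v2 t * \<phi> t) has_integral (W b - W a)) {a..b}"
    by (rule fundamental_theorem_of_calculus_strong[OF S ab(1) _ cont]) (use W' in auto)
  moreover have "(\<Sum>s\<in>S. step s b) = (\<Sum>s\<in>S. J s * \<phi> s)" "(\<Sum>s\<in>S. step s a) = 0"
    using ab by (auto simp: step_def intro!: sum.cong sum.neutral)
  ultimately show ?thesis by (simp add: W_def z)
qed

section \<open>Green's formula for piecewise plane waves\<close>

text \<open>If \<open>y\<^sub>j - y\<^sub>i = m\<close>, then \<open>alc y j i = m\<close> and \<open>side_of i j (alc y)\<close> is the alcove next to \<open>y\<close> on the
  side \<open>x\<^sub>j - x\<^sub>i < m\<close>.\<close>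

definition side_of :: "'n \<Rightarrow> 'n \<Rightarrow> ('n \<Rightarrow> 'n \<Rightarrow> int) \<Rightarrow> 'n \<Rightarrow> 'n \<Rightarrow> int" where
  "side_of i j q = (\<lambda>a b. if a = j \<and> b = i then q j i - 1 else q a b)"

text \<open>Points lying on exactly one hyperplane, and that one belongs to the pair i, j.\<close>

definition semiregular :: "'n::finite \<Rightarrow> 'n \<Rightarrow> real ^ 'n \<Rightarrow> bool" where
  "semiregular i j y \<longleftrightarrow> i \<noteq> j \<and> y $ i - y $ j \<in> \<int> \<and>
    (\<forall>a b. a \<noteq> b \<longrightarrow> {a, b} \<noteq> {i, j} \<longrightarrow> y $ a - y $ b \<notin> \<int>)"

section \<open>Alcoves near a point on at most one hyperplane\<close>

lemma eventually_floor_nonint: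
  fixes t :: real
  assumes "t \<notin> \<int>"
  shows "\<forall>\<^sub>F s in nhds t. s \<notin> \<int> \<and> \<lfloor>s\<rfloor> = \<lfloor>t\<rfloor>"
proof -
  have "t \<noteq> of_int \<lfloor>t\<rfloor>" using assms by (metis Ints_of_int)
  then have "t \<in> {of_int \<lfloor>t\<rfloor><..<of_int \<lfloor>t\<rfloor> + 1}"
    using of_int_floor_le[of t] floor_correct[of t] by (simp only: greaterThanLessThan_iff) linarith
  then have "\<forall>\<^sub>F s in nhds t. s \<in> {of_int \<lfloor>t\<rfloor><..<of_int \<lfloor>t\<rfloor> + 1}"
    by (intro eventually_nhds_in_open) auto
  then show ?thesis
  proof eventually_elim
    case (elim s)
    then have "\<lfloor>s\<rfloor> = \<lfloor>t\<rfloor>" by (simp add: floor_eq_iff)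
    moreover have "s \<notin> \<int>" using elim calculation by (metis Ints_cases floor_of_int greaterThanLessThan_iff less_irrefl)
    ultimately show ?case by simp
  qed
qed

lemma eventually_coordinate:
  fixes y :: "real ^ 'n::finite"
  assumes "\<forall>\<^sub>F s in nhds (y $ a - y $ b). P s"
  shows "\<forall>\<^sub>F x in nhds y. P (x $ a - x $ b)"
proof -
  have "isCont (\<lambda>x::real ^ 'n. x $ a - x $ b) y" by (intro continuous_intros)
  then have "filterlim (\<lambda>x::real ^ 'n. x $ a - x $ b) (nhds (y $ a - y $ b)) (nhds y)"
    unfolding isCont_def by (rule tendsto_at_iff_tendsto_nhds[of "\<lambda>x::real ^ 'n. x $ a - x $ b" y, THEN iffD1])
  then show ?thesis using assms by (simp add: filterlim_iff)
qed

lemma eventually_regular: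
  fixes x :: "real ^ 'n::finite"
  assumes "regular x"
  shows "\<forall>\<^sub>F z in nhds x. regular z \<and> alc z = alc x"
proof -
  have "\<forall>\<^sub>F z in nhds x. \<forall>a b. a \<noteq> b \<longrightarrow> z $ a - z $ b \<notin> \<int> \<and> \<lfloor>z $ a - z $ b\<rfloor> = \<lfloor>x $ a - x $ b\<rfloor>"
  proof (intro eventually_all_finite)
    fix a b
    show "\<forall>\<^sub>F z in nhds x. a \<noteq> b \<longrightarrow> z $ a - z $ b \<notin> \<int> \<and> \<lfloor>z $ a - z $ b\<rfloor> = \<lfloor>x $ a - x $ b\<rfloor>"
      using eventually_coordinate[OF eventually_floor_nonint, of x a b] assms
      by (cases "a = b") (auto simp: regular_def elim: eventually_mono)
  qed
  then show ?thesis
  proof eventually_elim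
    case (elim z)
    then have "alc z a b = alc x a b" for a b by (cases "a = b") (auto simp: alc_def)
    then show ?case using elim by (auto simp: regular_def)
  qed
qed

text \<open>Floors of non-integers are locally constant, so near y only the entries of the pair i, j
  can change; a larger x_i - x_j lowers the entry (j, i), a smaller one the entry (i, j).\<close>

lemma eventually_side:
  fixes y :: "real ^ 'n::finite"
  assumes y: "semiregular i j y"
  shows "\<forall>\<^sub>F x in nhds y. (x $ i - x $ j > y $ i - y $ j \<longrightarrow> regular x \<and> alc x = side_of i j (alc y)) \<and>
      (x $ i - x $ j < y $ i - y $ j \<longrightarrow> regular x \<and> alc x = side_of j i (alc y)) \<and>
      (x $ i - x $ j = y $ i - y $ j \<longrightarrow> semiregular i j x \<and> alc x = alc y)"
proof -
  have ij: "i \<noteq> j" and int: "y $ i - y $ j \<in> \<int>" using y by (auto simp: semiregular_def)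
  then obtain m where m: "y $ i - y $ j = of_int m" by (metis Ints_cases)
  have alcy: "alc y i j = m" "alc y j i = - m"
    using m unfolding alc_def by (simp_all add: floor_eq_iff)
  have "\<forall>\<^sub>F z in nhds y. \<forall>a b. a \<noteq> b \<and> {a, b} \<noteq> {i, j} \<longrightarrow> z $ a - z $ b \<notin> \<int> \<and> \<lfloor>z $ a - z $ b\<rfloor> = \<lfloor>y $ a - y $ b\<rfloor>"
  proof (intro eventually_all_finite)
    fix a b
    show "\<forall>\<^sub>F z in nhds y. a \<noteq> b \<and> {a, b} \<noteq> {i, j} \<longrightarrow> z $ a - z $ b \<notin> \<int> \<and> \<lfloor>z $ a - z $ b\<rfloor> = \<lfloor>y $ a - y $ b\<rfloor>"
      using eventually_coordinate[OF eventually_floor_nonint, of y a b] y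
      by (cases "a \<noteq> b \<and> {a, b} \<noteq> {i, j}") (auto simp: semiregular_def elim: eventually_mono)
  qed
  moreover have "\<forall>\<^sub>F s in nhds (y $ i - y $ j). s \<in> {of_int m - 1<..<of_int m + 1}"
    using m by (intro eventually_nhds_in_open) auto
  then have "\<forall>\<^sub>F z in nhds y. z $ i - z $ j \<in> {of_int m - 1<..<of_int m + 1}"
    by (rule eventually_coordinate)
  ultimately show ?thesis
  proof eventually_elim
    case (elim x)
    note e = elim(1)[rule_format, unfolded alc_def[symmetric]]
    have same: "alc x a b = alc y a b" if "{a, b} \<noteq> {i, j}" for a b
      using e[of a b] that by (cases "a = b") auto
    have reg: "regular x" if "x $ i - x $ j \<notin> \<int>"
      unfolding regular_def
    proof (intro allI impI)
      fix a b :: 'n assume ab: "a \<noteq> b"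
      have "x $ j - x $ i \<notin> \<int>" using that by (metis Ints_minus minus_diff_eq)
      then show "x $ a - x $ b \<notin> \<int>" using e[of a b] ab that by (auto simp: doubleton_eq_iff)
    qed
    have notint: "s \<notin> \<int>" if "of_int l < s" "s < of_int l + 1" for s :: real and l
    proof
      assume "s \<in> \<int>"
      then obtain l' where "s = of_int l'" by (metis Ints_cases)
      then show False using that by simp
    qed
    have 1: "regular x \<and> alc x = side_of i j (alc y)" if gt: "x $ i - x $ j > y $ i - y $ j"
    proof -
      have nint: "x $ i - x $ j \<notin> \<int>" using notint[of m] gt m elim(2) by auto
      have "alc x i j = m" "alc x j i = - m - 1"
        using gt m elim(2) unfolding alc_def by (auto simp: floor_eq_iff)
      then have "alc x a b = side_of i j (alc y) a b" for a b
        using same[of a b] alcy ij by (cases "{a, b} = {i, j}") (auto simp: side_of_def doubleton_eq_iff)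
      then show ?thesis using reg nint by (simp add: fun_eq_iff)
    qed
    have 2: "regular x \<and> alc x = side_of j i (alc y)" if gt: "x $ i - x $ j < y $ i - y $ j"
    proof -
      have nint: "x $ i - x $ j \<notin> \<int>" using notint[of "m - 1"] gt m elim(2) by auto
      have "alc x i j = m - 1" "alc x j i = - m"
        using gt m elim(2) unfolding alc_def by (auto simp: floor_eq_iff)
      then have "alc x a b = side_of j i (alc y) a b" for a b
        using same[of a b] alcy ij by (cases "{a, b} = {i, j}") (auto simp: side_of_def doubleton_eq_iff)
      then show ?thesis using reg nint by (simp add: fun_eq_iff)
    qed
    have 3: "semiregular i j x \<and> alc x = alc y" if eq: "x $ i - x $ j = y $ i - y $ j"
    proof -
      have "alc x i j = m" "alc x j i = - m"
        using eq m unfolding alc_def by (simp_all add: floor_eq_iff)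
      then have "alc x a b = alc y a b" for a b
        using same[of a b] alcy by (cases "{a, b} = {i, j}") (auto simp: doubleton_eq_iff)
      then show ?thesis using eq m e ij by (auto simp: semiregular_def)
    qed
    show ?case using 1 2 3 by blast
  qed
qed

lemma measurable_alc [measurable]: "alc \<in> borel \<rightarrow>\<^sub>M count_space (UNIV :: ('n::finite \<Rightarrow> 'n \<Rightarrow> int) set)"
proof (subst measurable_count_space_eq_countable)
  show "countable (UNIV :: ('n \<Rightarrow> 'n \<Rightarrow> int) set)" by simp
  have "alc -` {q} \<inter> space borel = {x \<in> space (borel :: (real ^ 'n) measure). \<forall>a b. \<lfloor>x $ a - x $ b\<rfloor> = q a b}" for q :: "'n \<Rightarrow> 'n \<Rightarrow> int"
    by (auto simp: alc_def fun_eq_iff)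
  moreover have "{x \<in> space (borel :: (real ^ 'n) measure). \<forall>a b. \<lfloor>x $ a - x $ b\<rfloor> = q a b} \<in> sets borel" for q :: "'n \<Rightarrow> 'n \<Rightarrow> int"
    unfolding floor_eq_iff by measurable
  ultimately have "alc -` {q} \<inter> space borel \<in> sets borel" for q :: "'n \<Rightarrow> 'n \<Rightarrow> int"
    by (simp only:)
  then have "\<forall>q\<in>UNIV. alc -` {q} \<inter> space (borel :: (real ^ 'n) measure) \<in> sets borel" by blast
  then show "alc \<in> space (borel :: (real ^ 'n) measure) \<rightarrow> UNIV \<and> (\<forall>q\<in>UNIV. alc -` {q} \<inter> space (borel :: (real ^ 'n) measure) \<in> sets borel)"
    by (intro conjI) simp_all
qed

lemma finite_functions_into: "finite B \<Longrightarrow> finite {f :: 'a::finite \<Rightarrow> 'b. \<forall>x. f x \<in> B}"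
  using finite_set_of_finite_funs[OF finite_class.finite_UNIV, of B undefined] by simp

lemma finite_alc_cball: "finite (alc ` cball (0 :: real ^ 'n::finite) r)"
proof -
  have *: "alc x a b \<in> {\<lfloor>- 2 * r\<rfloor>..\<lfloor>2 * r\<rfloor>}" if "x \<in> cball 0 r" for x :: "real ^ 'n" and a b
  proof -
    have "- 2 * r \<le> x $ a - x $ b" "x $ a - x $ b \<le> 2 * r"
      using that component_le_norm_cart[of x a] component_le_norm_cart[of x b] by auto
    then show ?thesis unfolding alc_def by (simp only: atLeastAtMost_iff floor_mono simp_thms)
  qed
  have "finite {q :: 'n \<Rightarrow> 'n \<Rightarrow> int. \<forall>a. q a \<in> {f. \<forall>b. f b \<in> {\<lfloor>- 2 * r\<rfloor>..\<lfloor>2 * r\<rfloor>}}}"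
    by (intro finite_functions_into finite_atLeastAtMost_int)
  then show ?thesis by (rule finite_subset[rotated]) (use * in auto)
qed

text \<open>There are infinitely many pieces, but only finitely many floor tables occur in a
  ball.\<close>

lemma piecewise_bounded_measurable:
  fixes Q :: "('n::finite \<Rightarrow> 'n \<Rightarrow> int) \<Rightarrow> real ^ 'n \<Rightarrow> complex"
  assumes Q: "\<And>q. continuous_on UNIV (Q q)" and \<phi>: "continuous_on UNIV \<phi>" "\<And>x. norm x \<ge> r \<Longrightarrow> \<phi> x = 0"
  shows "(\<lambda>x. Q (alc x) x * \<phi> x) \<in> borel_measurable borel"
    and "\<exists>B. \<forall>x. norm (Q (alc x) x * \<phi> x) \<le> B"
proof -
  have [measurable]: "Q q \<in> borel_measurable borel" for q by (intro borel_measurable_continuous_onI Q)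
  have [measurable]: "\<phi> \<in> borel_measurable borel" by (intro borel_measurable_continuous_onI \<phi>)
  have "(\<lambda>x. Q (alc x) x) \<in> borel_measurable borel"
    by (rule measurable_compose_countable[of _ borel borel "\<lambda>x. alc x"]) measurable
  then show "(\<lambda>x. Q (alc x) x * \<phi> x) \<in> borel_measurable borel" by measurable
  have "bounded ((\<lambda>x. Q q x * \<phi> x) ` cball 0 r)" for q
    by (intro compact_imp_bounded compact_continuous_image compact_cball)
      (use Q \<phi> continuous_on_subset in \<open>blast intro: continuous_on_mult\<close>)
  then have "bounded (\<Union>q\<in>alc ` cball 0 r. (\<lambda>x. Q q x * \<phi> x) ` cball 0 r)"
    by (intro bounded_UN finite_alc_cball) auto
  then obtain B where "\<And>z. z \<in> (\<Union>q\<in>alc ` cball 0 r. (\<lambda>x. Q q x * \<phi> x) ` cball 0 r) \<Longrightarrow> norm z \<le> B"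
    by (auto simp only: bounded_iff)
  then have B: "norm (Q (alc x) x * \<phi> x) \<le> B" if "x \<in> cball 0 r" for x using that by blast
  have "norm (Q (alc x) x * \<phi> x) \<le> max B 0" for x
    using B[of x] \<phi>(2)[of x] by (cases "norm x \<le> r") auto
  then show "\<exists>B. \<forall>x. norm (Q (alc x) x * \<phi> x) \<le> B" by blast
qed

lemma integrable_bounded_support:
  fixes G :: "'a::euclidean_space \<Rightarrow> complex"
  assumes "G \<in> borel_measurable borel" "\<And>x. norm (G x) \<le> B" "\<And>x. norm x > r \<Longrightarrow> G x = 0"
  shows "integrable lborel G"
  by (rule integrableI_bounded_set[where A = "cball 0 r" and B = B])
    (use assms emeasure_lborel_cball_finite[of 0 r] in auto)

text \<open>The counterpart of \<open>nn_integral_lborel_line\<close> for complex functions and l =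
  x_i; boundedness and bounded support supply the integrability that Fubini asks for.\<close>

lemma integral_lborel_line:
  fixes G :: "real ^ 'n::finite \<Rightarrow> complex"
  assumes G[measurable]: "G \<in> borel_measurable borel" and B: "\<And>x. norm (G x) \<le> B" and z: "\<And>x. norm x > r \<Longrightarrow> G x = 0"
  shows "(\<integral>x. G x \<partial>lborel) = (\<integral>x. indicator {0..1::real} (x $ i) *\<^sub>R (\<integral>t. G (x + t *\<^sub>R axis i 1) \<partial>lborel) \<partial>lborel)"
proof -
  have nr: "\<bar>x $ i\<bar> \<le> norm x" for x :: "real ^ 'n" by (rule component_le_norm_cart)
  have trans: "(\<integral>x. h (x + a) \<partial>lborel) = (\<integral>x. h x \<partial>lborel)" if [measurable]: "h \<in> borel_measurable borel" for h :: "real ^ 'n \<Rightarrow> complex" and a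
  proof -
    have "(\<integral>x. h x \<partial>lborel) = (\<integral>x. h x \<partial>(distr lborel borel ((+) a)))" by (simp add: lborel_distr_plus)
    then show ?thesis by (simp add: integral_distr add.commute)
  qed
  have B0: "0 \<le> B" using B[of 0] norm_ge_zero order_trans by blast
  have npair: "norm (x, t) \<le> norm x + \<bar>t\<bar>" for x :: "real ^ 'n" and t :: real
    by (metis norm_Pair_le real_norm_def)
  have m1: "(\<lambda>(x, t). indicator {0..1::real} (x $ i) *\<^sub>R G (x + t *\<^sub>R axis i 1)) \<in> borel_measurable (borel \<Otimes>\<^sub>M borel)"
    by measurable
  have i1: "integrable (lborel \<Otimes>\<^sub>M lborel) (\<lambda>(x, t). indicator {0..1::real} (x $ i) *\<^sub>R G (x + t *\<^sub>R axis i 1))"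
    unfolding lborel_prod
  \<comment> \<open>If x_i lies in [0, 1] and x + t e_i in the ball, then \<bar>t\<bar> \<le>
    \<bar>r\<bar> + 1, and the norm of x is at most \<bar>r\<bar> + \<bar>t\<bar>.\<close>
  proof (rule integrable_bounded_support[where B = B and r = "\<bar>r\<bar> + 2 * (\<bar>r\<bar> + 1)"])
    fix p :: "(real ^ 'n) \<times> real"
    obtain x t where p: "p = (x, t)" by (cases p)
    show "norm (case p of (x, t) \<Rightarrow> indicator {0..1::real} (x $ i) *\<^sub>R G (x + t *\<^sub>R axis i 1)) \<le> B"
      using B B0 p by (auto simp: indicator_def)
    assume n: "norm p > \<bar>r\<bar> + 2 * (\<bar>r\<bar> + 1)"
    have "G (x + t *\<^sub>R axis i 1) = 0" if "x $ i \<in> {0..1}"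
    proof (rule ccontr)
      assume "G (x + t *\<^sub>R axis i 1) \<noteq> 0"
      then have le: "norm (x + t *\<^sub>R axis i 1) \<le> r" using z not_le by blast
      then have "\<bar>x $ i + t\<bar> \<le> r" using nr[of "x + t *\<^sub>R axis i 1"] by (simp add: axis_def)
      then have t: "\<bar>t\<bar> \<le> \<bar>r\<bar> + 1" using that by auto
      have "norm x \<le> norm (x + t *\<^sub>R axis i 1) + norm (t *\<^sub>R axis i 1 :: real ^ 'n)"
        by (metis add_diff_cancel_right' norm_triangle_ineq4)
      also have "\<dots> \<le> \<bar>r\<bar> + \<bar>t\<bar>" using le by simp
      finally show False using npair[of x t] n p t by simp
    qed
    then show "(case p of (x, t) \<Rightarrow> indicator {0..1::real} (x $ i) *\<^sub>R G (x + t *\<^sub>R axis i 1)) = 0"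
      using p by (auto simp: indicator_def)
  qed (use m1 in \<open>simp add: borel_prod\<close>)
  have m2: "(\<lambda>(x, t). indicator {0..1::real} (x $ i - t) *\<^sub>R G x) \<in> borel_measurable (borel \<Otimes>\<^sub>M borel)"
    by measurable
  have i2: "integrable (lborel \<Otimes>\<^sub>M lborel) (\<lambda>(x, t). indicator {0..1::real} (x $ i - t) *\<^sub>R G x)"
    unfolding lborel_prod
  proof (rule integrable_bounded_support[where B = B and r = "\<bar>r\<bar> + (\<bar>r\<bar> + 1)"])
    fix p :: "(real ^ 'n) \<times> real"
    obtain x t where p: "p = (x, t)" by (cases p)
    show "norm (case p of (x, t) \<Rightarrow> indicator {0..1::real} (x $ i - t) *\<^sub>R G x) \<le> B"
      using B B0 p by (auto simp: indicator_def)
    assume n: "norm p > \<bar>r\<bar> + (\<bar>r\<bar> + 1)"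
    have "G x = 0" if "x $ i - t \<in> {0..1}"
    proof (rule ccontr)
      assume "G x \<noteq> 0"
      then have le: "norm x \<le> r" using z not_le by blast
      then have "\<bar>t\<bar> \<le> \<bar>r\<bar> + 1" using that nr[of x] by auto
      then show False using npair[of x t] n p le by simp
    qed
    then show "(case p of (x, t) \<Rightarrow> indicator {0..1::real} (x $ i - t) *\<^sub>R G x) = 0"
      using p by (auto simp: indicator_def)
  qed (use m2 in \<open>simp add: borel_prod\<close>)
  have "(\<integral>x. indicator {0..1::real} (x $ i) *\<^sub>R (\<integral>t. G (x + t *\<^sub>R axis i 1) \<partial>lborel) \<partial>lborel)
      = (\<integral>x. (\<integral>t. indicator {0..1::real} (x $ i) *\<^sub>R G (x + t *\<^sub>R axis i 1) \<partial>lborel) \<partial>lborel)"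
    by simp
  also have "\<dots> = (\<integral>t. (\<integral>x. indicator {0..1::real} (x $ i) *\<^sub>R G (x + t *\<^sub>R axis i 1) \<partial>lborel) \<partial>lborel)"
    by (rule lborel_pair.Fubini_integral[OF i1, symmetric])
  also have "\<dots> = (\<integral>t. (\<integral>x. indicator {0..1::real} (x $ i - t) *\<^sub>R G x \<partial>lborel) \<partial>lborel)"
  proof (rule Bochner_Integration.integral_cong[OF refl])
    fix t :: real
    have "(\<integral>x. indicator {0..1::real} (x $ i - t) *\<^sub>R G x \<partial>lborel) =
       (\<integral>x. indicator {0..1::real} ((x + t *\<^sub>R axis i 1) $ i - t) *\<^sub>R G (x + t *\<^sub>R axis i 1) \<partial>lborel)"
      by (rule trans[symmetric]) measurable
    then show "(\<integral>x. indicator {0..1::real} (x $ i) *\<^sub>R G (x + t *\<^sub>R axis i 1) \<partial>lborel) =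
       (\<integral>x. indicator {0..1::real} (x $ i - t) *\<^sub>R G x \<partial>lborel)"
      by (simp add: axis_def)
  qed
  also have "\<dots> = (\<integral>x. (\<integral>t. indicator {0..1::real} (x $ i - t) *\<^sub>R G x \<partial>lborel) \<partial>lborel)"
    by (rule lborel_pair.Fubini_integral[OF i2])
  also have "\<dots> = (\<integral>x. G x \<partial>lborel)"
  proof (rule Bochner_Integration.integral_cong[OF refl])
    fix x :: "real ^ 'n"
    have "(\<integral>t. indicator {0..1::real} (x $ i - t) *\<^sub>R G x \<partial>lborel) = (\<integral>t. indicator {x $ i - 1..x $ i} t *\<^sub>R G x \<partial>lborel)"
      by (intro Bochner_Integration.integral_cong) (auto simp: indicator_def)
    then show "(\<integral>t. indicator {0..1::real} (x $ i - t) *\<^sub>R G x \<partial>lborel) = G x"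
      by simp
  qed
  finally show ?thesis by simp
qed

text \<open>There are countably many hyperplanes, each of measure zero.\<close>

lemma AE_regular: "AE x in lborel. regular (x :: real ^ 'n::finite)"
proof -
  have "AE x in lborel. (x :: real ^ 'n) $ a - x $ b \<noteq> of_int l" if "a \<noteq> b" for a b :: 'n and l :: int
  proof -
    have "(axis a 1 - axis b 1 :: real ^ 'n) \<noteq> 0"
      using that by (auto simp: vec_eq_iff axis_def intro!: exI[of _ a])
    then have "negligible {x :: real ^ 'n. (axis a 1 - axis b 1) \<bullet> x = of_int l}"
      by (intro negligible_hyperplane) auto
    then have "{x :: real ^ 'n. x $ a - x $ b = of_int l} \<in> null_sets lebesgue"
      by (simp add: negligible_iff_null_sets inner_diff_left inner_axis')
    moreover have "{x :: real ^ 'n. x $ a - x $ b = of_int l} \<in> sets borel" by measurable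
    ultimately have "{x :: real ^ 'n. x $ a - x $ b = of_int l} \<in> null_sets lborel"
      by (simp add: null_sets_completion_iff)
    from AE_not_in[OF this] show ?thesis by auto
  qed
  then have "AE x in lborel. \<forall>l. (x :: real ^ 'n) $ a - x $ b \<noteq> of_int l" if "a \<noteq> b" for a b
    using that by (subst AE_all_countable) auto
  then have "AE x in lborel. a \<noteq> b \<longrightarrow> (\<forall>l. (x :: real ^ 'n) $ a - x $ b \<noteq> of_int l)" for a b
    by (cases "a = b") auto
  then have "AE x in lborel. \<forall>a b. a \<noteq> b \<longrightarrow> (\<forall>l. (x :: real ^ 'n) $ a - x $ b \<noteq> of_int l)"
    by (intro eventually_all_finite)
  then show ?thesis
    by (rule eventually_mono) (auto simp: regular_def Ints_def)
qed

definition pwsum :: "'w set \<Rightarrow> ('w \<Rightarrow> complex ^ 'n::finite) \<Rightarrow> ('w \<Rightarrow> complex) \<Rightarrow> real ^ 'n \<Rightarrow> complex" where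
  "pwsum W \<mu> b x = (\<Sum>w\<in>W. b w * plane_wave (\<mu> w) x)"

lemma continuous_plane_wave [continuous_intros]: "continuous_on S (plane_wave \<mu>)"
  unfolding plane_wave_def[abs_def] by (intro continuous_intros)

lemma continuous_pwsum [continuous_intros]: "continuous_on S (pwsum W \<mu> b)"
  unfolding pwsum_def[abs_def] by (intro continuous_intros)

lemma plane_wave_line: "plane_wave \<mu> (x + t *\<^sub>R axis i 1) = plane_wave \<mu> x * exp (\<mu> $ i * of_real t)"
proof -
  have "(\<Sum>j\<in>UNIV. \<mu> $ j * of_real ((x + t *\<^sub>R axis i 1) $ j)) =
      (\<Sum>j\<in>UNIV. \<mu> $ j * of_real (x $ j) + (if j = i then \<mu> $ i * of_real t else 0))"
    by (intro sum.cong) (auto simp: axis_def algebra_simps)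
  then show ?thesis by (simp add: plane_wave_def sum.distrib exp_add)
qed

lemma pwsum_line_deriv:
  "((\<lambda>t. pwsum W \<mu> b (x + t *\<^sub>R axis i 1)) has_vector_derivative
    pwsum W \<mu> (\<lambda>w. b w * \<mu> w $ i) (x + t *\<^sub>R axis i 1)) (at t)"
proof -
  have "((\<lambda>t. exp (\<mu> w $ i * of_real t)) has_vector_derivative \<mu> w $ i * exp (\<mu> w $ i * of_real t)) (at t)" for w
  proof -
    have "((\<lambda>z. exp (\<mu> w $ i * z)) has_field_derivative \<mu> w $ i * exp (\<mu> w $ i * of_real t)) (at (of_real t))"
      by (auto intro!: derivative_eq_intros)
    then show ?thesis by (rule has_vector_derivative_real_field)
  qed
  then have "((\<lambda>t. \<Sum>w\<in>W. (b w * plane_wave (\<mu> w) x) * exp (\<mu> w $ i * of_real t)) has_vector_derivative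
     (\<Sum>w\<in>W. (b w * plane_wave (\<mu> w) x) * (\<mu> w $ i * exp (\<mu> w $ i * of_real t)))) (at t)"
    by (intro has_vector_derivative_sum has_vector_derivative_mult_right)
  then show ?thesis unfolding pwsum_def plane_wave_line by (simp add: mult_ac)
qed

lemma eventually_line:
  fixes x :: "real ^ 'n::finite"
  assumes "\<forall>\<^sub>F z in nhds (x + s *\<^sub>R axis i 1). P z"
  shows "\<forall>\<^sub>F t in nhds s. P (x + t *\<^sub>R axis i 1)"
proof -
  have "isCont (\<lambda>t. x + t *\<^sub>R axis i 1) s" by (intro continuous_intros)
  then have "filterlim (\<lambda>t. x + t *\<^sub>R axis i 1) (nhds (x + s *\<^sub>R axis i 1)) (nhds s)"
    unfolding isCont_def by (rule tendsto_at_iff_tendsto_nhds[of "\<lambda>t. x + t *\<^sub>R axis i 1" s, THEN iffD1])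
  then show ?thesis using assms by (simp add: filterlim_iff)
qed

lemma has_vector_derivative_eventually:
  assumes "(f has_vector_derivative f') (at t)" "\<forall>\<^sub>F s in nhds t. f s = g s"
  shows "(g has_vector_derivative f') (at t)"
proof -
  obtain S where "open S" "t \<in> S" "\<And>s. s \<in> S \<Longrightarrow> f s = g s"
    using assms(2) by (auto simp: eventually_nhds)
  then show ?thesis using has_vector_derivative_transform_within_open[OF assms(1)] by blast
qed

text \<open>The new i-th coordinate is congruent to x_j modulo 1, and the other coordinates are
  pairwise incongruent. Consequently almost every line in direction e_i meets the hyperplanes
  transversal to it one at a time.\<close>

lemma semiregular_hyper_proj:
  assumes "regular x" "i \<noteq> j"
  shows "semiregular i j (hyper_proj i j m x)"
  unfolding semiregular_def
proof (intro conjI allI impI)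
  show "hyper_proj i j m x $ i - hyper_proj i j m x $ j \<in> \<int>"
    using assms(2) by (simp add: hyper_proj_def)
  fix a b assume ab: "a \<noteq> b" "{a, b} \<noteq> {i, j}"
  have nint: "t - s \<notin> \<int>" if "x $ p - x $ q \<notin> \<int>" "t = x $ p + of_int l" "s = x $ q + of_int l'" for p q l l' t s
  proof
    assume "t - s \<in> \<int>"
    then have "(t - s) - (of_int l - of_int l') \<in> \<int>" by simp
    then show False using that by (simp add: algebra_simps)
  qed
  have r: "p \<noteq> q \<Longrightarrow> x $ p - x $ q \<notin> \<int>" for p q using assms(1) by (simp add: regular_def)
  consider "a = i" "b \<noteq> i" "b \<noteq> j" | "b = i" "a \<noteq> i" "a \<noteq> j" | "a \<noteq> i" "b \<noteq> i"
    using ab by auto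
  then show "hyper_proj i j m x $ a - hyper_proj i j m x $ b \<notin> \<int>"
  proof cases
    case 1
    then show ?thesis
      using nint[OF r[of j b], of _ "- m" _ 0] by (simp add: hyper_proj_def)
  next
    case 2
    then show ?thesis
      using nint[OF r[of a j], of _ 0 _ "- m"] by (simp add: hyper_proj_def)
  next
    case 3
    then show ?thesis using r[OF ab(1)] by (simp add: hyper_proj_def)
  qed
qed (use assms in auto)

text \<open>The scalar situation, applied to \<psi> o f for one solution and for the difference of
  two. Indexing the coefficients by floor tables makes them constant on alcoves.\<close>

locale piecewise =
  fixes W :: "'w set" and \<mu> :: "'w \<Rightarrow> complex ^ 'n::finite"
    and a :: "('n \<Rightarrow> 'n \<Rightarrow> int) \<Rightarrow> 'w \<Rightarrow> complex" and u :: "real ^ 'n \<Rightarrow> complex"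
  assumes u_cont: "continuous_on UNIV u"
    and u_eq: "\<And>x. regular x \<Longrightarrow> u x = pwsum W \<mu> (a (alc x)) x"
begin

text \<open>At a point on a single hyperplane of the pair i, j: the jump of the i-th partial
  derivative of u in the direction of increasing x_i.\<close>

definition jump :: "'n \<Rightarrow> 'n \<Rightarrow> real ^ 'n \<Rightarrow> complex" where
  "jump i j y = pwsum W \<mu> (\<lambda>w. (a (side_of i j (alc y)) w - a (side_of j i (alc y)) w) * \<mu> w $ i) y"

text \<open>\<open>kink_integral\<close> on the line x + t e_i. As x is regular, the meeting points
  with the hyperplanes are distinct and lie on one hyperplane each; hyperplanes with \<bar>m\<bar> >
  2 r miss the support.\<close>

lemma line_integral:
  assumes \<phi>: "test_function \<phi>"
    and supp: "\<And>z. norm z \<ge> r \<Longrightarrow> \<phi> z = 0 \<and> partial i \<phi> z = 0 \<and> partial i (partial i \<phi>) z = 0"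
    and x: "regular x" and Ms: "finite Ms" "\<And>m. of_int \<bar>m\<bar> \<le> 2 * r \<Longrightarrow> m \<in> Ms"
  shows "((\<lambda>t. u (x + t *\<^sub>R axis i 1) * partial i (partial i \<phi>) (x + t *\<^sub>R axis i 1)
        - pwsum W \<mu> (\<lambda>w. a (alc (x + t *\<^sub>R axis i 1)) w * \<mu> w $ i * \<mu> w $ i) (x + t *\<^sub>R axis i 1) * \<phi> (x + t *\<^sub>R axis i 1))
      has_integral (\<Sum>j\<in>UNIV - {i}. \<Sum>m\<in>Ms. jump i j (hyper_proj i j m x) * \<phi> (hyper_proj i j m x))) UNIV"
proof -
  let ?l = "\<lambda>t. x + t *\<^sub>R axis i 1 :: real ^ 'n"
  have l_nth: "?l t $ b = (if b = i then x $ i + t else x $ b)" for t b by (simp add: axis_def)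
  \<comment> \<open>The time at which the line meets the hyperplane x_j - x_i = m.\<close>
  define \<kappa> where "\<kappa> = (\<lambda>(j, m). x $ j - of_int m - x $ i)"
  have l\<kappa>: "?l (\<kappa> (j, m)) = hyper_proj i j m x" if "j \<noteq> i" for j m
    using that by (auto simp: vec_eq_iff \<kappa>_def hyper_proj_def axis_def)
  define K where "K = \<kappa> ` ((UNIV - {i}) \<times> UNIV)"
  have inj: "inj_on \<kappa> ((UNIV - {i}) \<times> UNIV)"
  proof (rule inj_onI)
    fix p p' assume "p \<in> (UNIV - {i}) \<times> UNIV" "p' \<in> (UNIV - {i}) \<times> UNIV" and e: "\<kappa> p = \<kappa> p'"
    obtain j m j' m' where p: "p = (j, m)" "p' = (j', m')" by (metis surj_pair)
    have e: "x $ j - x $ j' = of_int (m - m')" using e p by (simp add: \<kappa>_def)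
    then have "x $ j - x $ j' \<in> \<int>" by (metis Ints_of_int)
    then have "j = j'" using x by (auto simp: regular_def)
    then show "p = p'" using e p by simp
  qed
  have finK: "finite {p \<in> (UNIV - {i}) \<times> UNIV. \<kappa> p \<in> {c<..<d}}" for c d
  proof (rule finite_subset)
    show "{p \<in> (UNIV - {i}) \<times> UNIV. \<kappa> p \<in> {c<..<d}} \<subseteq>
      (\<Union>j. (\<lambda>m. (j, m)) ` {\<lfloor>x $ j - x $ i - d\<rfloor>..\<lceil>x $ j - x $ i - c\<rceil>})"
    proof
      fix p assume p: "p \<in> {p \<in> (UNIV - {i}) \<times> UNIV. \<kappa> p \<in> {c<..<d}}"
      obtain j m where jm: "p = (j, m)" by (cases p)
      then have "x $ j - x $ i - d < of_int m" "of_int m < x $ j - x $ i - c" using p by (auto simp: \<kappa>_def)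
      then have "\<lfloor>x $ j - x $ i - d\<rfloor> \<le> m \<and> m \<le> \<lceil>x $ j - x $ i - c\<rceil>" by linarith
      then show "p \<in> (\<Union>j. (\<lambda>m. (j, m)) ` {\<lfloor>x $ j - x $ i - d\<rfloor>..\<lceil>x $ j - x $ i - c\<rceil>})" using jm by (intro UN_I[of j]) auto
    qed
  qed auto
  have reg: "regular (?l t)" if "t \<notin> K" for t
    unfolding regular_def
  proof (intro allI impI notI)
    have no: "x $ i + t - x $ j \<notin> \<int>" if "j \<noteq> i" for j
    proof
      assume "x $ i + t - x $ j \<in> \<int>"
      then obtain m where "x $ i + t - x $ j = of_int m" by (metis Ints_cases)
      then have "t = \<kappa> (j, - m)" by (simp add: \<kappa>_def)
      then show False using \<open>t \<notin> K\<close> that by (auto simp: K_def)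
    qed
    fix b c assume bc: "b \<noteq> c" "?l t $ b - ?l t $ c \<in> \<int>"
    have "x $ b - x $ c \<notin> \<int>" using x bc by (simp add: regular_def)
    moreover have "x $ j - (x $ i + t) \<notin> \<int>" if "j \<noteq> i" for j
      using no[OF that] by (metis Ints_minus minus_diff_eq)
    ultimately show False using bc no[of b] no[of c] unfolding l_nth by (auto split: if_splits)
  qed
  \<comment> \<open>The meeting times are discrete, so the end points of the interval can be chosen
    off them.\<close>
  have nonK: "\<exists>t. c < t \<and> t < d \<and> t \<notin> K" if "c < d" for c d
  proof -
    have "finite (\<kappa> ` {p \<in> (UNIV - {i}) \<times> UNIV. \<kappa> p \<in> {c<..<d}})" using finK by simp
    moreover have "infinite {c<..<d}" using that by (simp add: infinite_Ioo)
    ultimately have "\<not> {c<..<d} \<subseteq> \<kappa> ` {p \<in> (UNIV - {i}) \<times> UNIV. \<kappa> p \<in> {c<..<d}}"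
      using finite_subset by blast
    then obtain t where t: "t \<in> {c<..<d}" "t \<notin> \<kappa> ` {p \<in> (UNIV - {i}) \<times> UNIV. \<kappa> p \<in> {c<..<d}}" by blast
    then have "t \<notin> K" unfolding K_def by auto
    with t show ?thesis by auto
  qed
  define T where "T = \<bar>r\<bar> + \<bar>x $ i\<bar>"
  obtain c where c: "- T - 1 < c" "c < - T" "c \<notin> K" using nonK[of "- T - 1" "- T"] by auto
  obtain d where d: "T < d" "d < T + 1" "d \<notin> K" using nonK[of "T" "T + 1"] by auto
  have far: "norm (?l t) \<ge> r" if "\<bar>t\<bar> \<ge> T" for t
    using component_le_norm_cart[of "?l t" i] that unfolding l_nth T_def by auto
  have T0: "T \<ge> 0" by (simp add: T_def)
  define S where "S = K \<inter> {c<..<d}"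
  define P where "P = {p \<in> (UNIV - {i}) \<times> UNIV. \<kappa> p \<in> {c<..<d}}"
  have P: "finite P" "S = \<kappa> ` P" "inj_on \<kappa> P"
    using finK inj unfolding P_def S_def K_def by (auto intro: inj_on_subset)
  \<comment> \<open>Recovers from a kink the second index of the hyperplane met there.\<close>
  define jj where "jj s = fst (inv_into P \<kappa> s)" for s
  have jj: "jj (\<kappa> (j, m)) = j" if "(j, m) \<in> P" for j m
    using inv_into_f_f[OF P(3) that] by (simp add: jj_def)
  define v where "v t = u (?l t)" for t
  define v1 where "v1 t = pwsum W \<mu> (\<lambda>w. a (alc (?l t)) w * \<mu> w $ i) (?l t)" for t
  define v2 where "v2 t = pwsum W \<mu> (\<lambda>w. a (alc (?l t)) w * \<mu> w $ i * \<mu> w $ i) (?l t)" for t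
  define L where "L s = pwsum W \<mu> (\<lambda>w. a (side_of (jj s) i (alc (?l s))) w * \<mu> w $ i) (?l s)" for s
  define J where "J s = jump i (jj s) (?l s)" for s
  have "((\<lambda>t. v t * partial i (partial i \<phi>) (?l t) - v2 t * \<phi> (?l t)) has_integral
      (\<Sum>s\<in>S. J s * \<phi> (?l s))) {c..d}"
  proof (rule kink_integral[where L = L and ?v1.0 = v1 and ?\<phi>1.0 = "\<lambda>t. partial i \<phi> (?l t)"])
    show "finite S" "c \<le> d" "S \<subseteq> {c<..<d}" using P c d T0 by (auto simp: S_def)
    show "isCont v t" for t
    proof -
      have "continuous_on UNIV v" unfolding v_def
        by (rule continuous_on_compose2[OF u_cont]) (auto intro!: continuous_intros)
      then show ?thesis by (simp add: continuous_on_eq_continuous_at)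
    qed
    show "((\<lambda>t. \<phi> (?l t)) has_vector_derivative partial i \<phi> (?l t)) (at t)"
      "((\<lambda>t. partial i \<phi> (?l t)) has_vector_derivative partial i (partial i \<phi>) (?l t)) (at t)" for t
      using test_functionD(1,2)[OF \<phi>] by (auto intro: partial_has_vector_derivative)
    show "\<phi> (?l c) = 0" "\<phi> (?l d) = 0" "partial i \<phi> (?l c) = 0" "partial i \<phi> (?l d) = 0"
      using supp far[of c] far[of d] c d T0 by auto
    fix t
    {
      assume "t \<in> {c..d} - S"
      then have "t \<notin> K" using c d by (auto simp: S_def less_le)
      then have ev: "\<forall>\<^sub>F s in nhds t. regular (?l s) \<and> alc (?l s) = alc (?l t)"
        using eventually_line[OF eventually_regular[OF reg]] by blast
      show "(v has_vector_derivative v1 t) (at t)"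
        unfolding v1_def by (rule has_vector_derivative_eventually[OF pwsum_line_deriv])
          (use ev in \<open>auto simp: v_def u_eq elim!: eventually_mono\<close>)
      show "(v1 has_vector_derivative v2 t) (at t)"
        unfolding v2_def by (rule has_vector_derivative_eventually[OF pwsum_line_deriv])
          (use ev in \<open>auto simp: v1_def elim!: eventually_mono\<close>)
    }
    assume "t \<in> S"
    then obtain j m where jm: "(j, m) \<in> P" "t = \<kappa> (j, m)" using P by auto
    then have ji: "j \<noteq> i" and jjt: "jj t = j" using jj by (auto simp: P_def)
    have lt: "?l t = hyper_proj i j m x" using l\<kappa>[OF ji] jm by simp
    have semi: "semiregular i j (?l t)" unfolding lt using semiregular_hyper_proj[OF x] ji by metis
    have aj: "axis i (1::real) $ j = 0" "axis i (1::real) $ i = 1" using ji by (simp_all add: axis_def)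
    have ev: "\<forall>\<^sub>F s in nhds t. (s > t \<longrightarrow> alc (?l s) = side_of i j (alc (?l t))) \<and>
        (s < t \<longrightarrow> alc (?l s) = side_of j i (alc (?l t)))"
      using eventually_line[OF eventually_side[OF semi]] by eventually_elim (auto simp: aj)
    have lim: "((\<lambda>s. pwsum W \<mu> b (?l s)) \<longlongrightarrow> pwsum W \<mu> b (?l t)) (at t within A)" for b A
    proof -
      have "isCont (\<lambda>s. pwsum W \<mu> b (?l s)) t"
        using pwsum_line_deriv has_vector_derivative_continuous by blast
      then show ?thesis unfolding isCont_def by (rule tendsto_within_subset) simp
    qed
    show "(v1 \<longlongrightarrow> L t) (at_left t)"
      unfolding L_def jjt
      by (rule Lim_transform_eventually[OF lim])
        (use ev in \<open>auto simp: v1_def eventually_at_filter elim!: eventually_mono\<close>)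
    have "L t + J t = pwsum W \<mu> (\<lambda>w. a (side_of i j (alc (?l t))) w * \<mu> w $ i) (?l t)"
      unfolding L_def J_def jump_def jjt pwsum_def by (simp add: sum.distrib[symmetric] algebra_simps)
    then show "(v1 \<longlongrightarrow> L t + J t) (at_right t)"
      by (simp only:) (rule Lim_transform_eventually[OF lim],
        use ev in \<open>auto simp: v1_def eventually_at_filter elim!: eventually_mono\<close>)
  qed
  moreover have "(\<Sum>s\<in>S. J s * \<phi> (?l s)) =
      (\<Sum>(j, m)\<in>P. jump i j (hyper_proj i j m x) * \<phi> (hyper_proj i j m x))"
    unfolding P(2)
  proof (subst sum.reindex[OF P(3)], rule sum.cong[OF refl])
    fix p assume p: "p \<in> P"
    obtain j m where jm: "p = (j, m)" by (cases p)
    then have "j \<noteq> i" using p by (auto simp: P_def)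
    then show "((\<lambda>s. J s * \<phi> (?l s)) \<circ> \<kappa>) p =
        (case p of (j, m) \<Rightarrow> jump i j (hyper_proj i j m x) * \<phi> (hyper_proj i j m x))"
      using jj[of j m] p jm l\<kappa>[of j m] by (simp add: J_def)
  qed
  \<comment> \<open>The hyperplanes met inside the interval are exchanged for an index set that does
    not depend on x; the terms in the difference vanish with \<phi>.\<close>
  moreover have "\<dots> = (\<Sum>(j, m)\<in>(UNIV - {i}) \<times> Ms. jump i j (hyper_proj i j m x) * \<phi> (hyper_proj i j m x))"
  proof (rule sum.mono_neutral_cong)
    fix p assume p: "p \<in> (UNIV - {i}) \<times> Ms - P"
    obtain j m where jm: "p = (j, m)" by (cases p)
    then have ji: "j \<noteq> i" using p by auto
    then have "\<not> (c < \<kappa> (j, m) \<and> \<kappa> (j, m) < d)" using p jm by (auto simp: P_def)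
    then have "\<bar>\<kappa> (j, m)\<bar> \<ge> T" using c d by auto
    then have "\<phi> (hyper_proj i j m x) = 0" using supp far l\<kappa>[OF ji] by metis
    then show "(case p of (j, m) \<Rightarrow> jump i j (hyper_proj i j m x) * \<phi> (hyper_proj i j m x)) = 0" using jm by simp
  next
    fix p assume p: "p \<in> P - (UNIV - {i}) \<times> Ms"
    obtain j m where jm: "p = (j, m)" by (cases p)
    let ?y = "hyper_proj i j m x"
    have ji: "j \<noteq> i" and "m \<notin> Ms" using p jm by (auto simp: P_def)
    then have "of_int \<bar>m\<bar> > 2 * r" using Ms(2) not_le by blast
    moreover have "?y $ j - ?y $ i = of_int m" using ji by (simp add: hyper_proj_def)
    ultimately have "norm ?y \<ge> r"
      using component_le_norm_cart[of ?y i] component_le_norm_cart[of ?y j] by auto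
    then show "(case p of (j, m) \<Rightarrow> jump i j (hyper_proj i j m x) * \<phi> (hyper_proj i j m x)) = 0" using jm supp by simp
  qed (use P Ms in auto)
  moreover have "\<dots> = (\<Sum>j\<in>UNIV - {i}. \<Sum>m\<in>Ms. jump i j (hyper_proj i j m x) * \<phi> (hyper_proj i j m x))"
    by (simp add: sum.cartesian_product)
  ultimately have "((\<lambda>t. v t * partial i (partial i \<phi>) (?l t) - v2 t * \<phi> (?l t)) has_integral
      (\<Sum>j\<in>UNIV - {i}. \<Sum>m\<in>Ms. jump i j (hyper_proj i j m x) * \<phi> (hyper_proj i j m x))) {c..d}" by simp
  then have "((\<lambda>t. v t * partial i (partial i \<phi>) (?l t) - v2 t * \<phi> (?l t)) has_integral
      (\<Sum>j\<in>UNIV - {i}. \<Sum>m\<in>Ms. jump i j (hyper_proj i j m x) * \<phi> (hyper_proj i j m x))) UNIV"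
  proof (rule has_integral_on_superset)
    fix t assume "t \<notin> {c..d}"
    then have "\<bar>t\<bar> \<ge> T" using c d by auto
    then show "v t * partial i (partial i \<phi>) (?l t) - v2 t * \<phi> (?l t) = 0" using supp far by auto
  qed auto
  then show ?thesis by (simp add: v_def v2_def)
qed

lemma jump_bounded_measurable:
  assumes \<phi>: "continuous_on UNIV \<phi>" "\<And>x. norm x \<ge> r \<Longrightarrow> \<phi> x = 0"
  shows "(\<lambda>y. jump i j y * \<phi> y) \<in> borel_measurable borel"
    and "\<exists>B. \<forall>y. norm (jump i j y * \<phi> y) \<le> B"
proof -
  let ?Q = "\<lambda>q. pwsum W \<mu> (\<lambda>w. (a (side_of i j q) w - a (side_of j i q) w) * \<mu> w $ i)"
  have c: "continuous_on UNIV (?Q q)" for q by (intro continuous_intros)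
  show "(\<lambda>y. jump i j y * \<phi> y) \<in> borel_measurable borel" "\<exists>B. \<forall>y. norm (jump i j y * \<phi> y) \<le> B"
    using piecewise_bounded_measurable[of ?Q, OF c \<phi>] by (simp_all add: jump_def)
qed

end

lemma integrable_hyper_proj:
  fixes h :: "real ^ 'n::finite \<Rightarrow> complex"
  assumes ij: "i \<noteq> j" and h[measurable]: "h \<in> borel_measurable borel"
    and B: "\<And>x. norm (h x) \<le> B" and z: "\<And>x. norm x \<ge> r \<Longrightarrow> h x = 0"
  shows "integrable lborel (\<lambda>x. indicator {0..1::real} (x $ i) *\<^sub>R h (hyper_proj i j m x))"
    and "integrable (affine_volume (hyperplane i j m)) h"
proof -
  have B0: "0 \<le> B" using B[of 0] norm_ge_zero order_trans by blast
  show "integrable lborel (\<lambda>x. indicator {0..1::real} (x $ i) *\<^sub>R h (hyper_proj i j m x))"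
  \<comment> \<open>With x_i in [0, 1] and the image in the ball of radius r, the projection moves x
    by at most 1 + r.\<close>
  proof (rule integrable_bounded_support[where B = B and r = "2 * \<bar>r\<bar> + 1"])
    fix x :: "real ^ 'n"
    show "norm (indicator {0..1::real} (x $ i) *\<^sub>R h (hyper_proj i j m x)) \<le> B"
      using B B0 by (auto simp: indicator_def)
    let ?y = "hyper_proj i j m x"
    assume n: "norm x > 2 * \<bar>r\<bar> + 1"
    have "h ?y = 0" if "x $ i \<in> {0..1}"
    proof (rule z, rule ccontr)
      assume "\<not> r \<le> norm ?y"
      then have y: "norm ?y < r" by simp
      have "x - ?y = (x $ i - ?y $ i) *\<^sub>R axis i 1"
        by (auto simp: vec_eq_iff hyper_proj_def axis_def)
      then have "norm (x - ?y) = \<bar>x $ i - ?y $ i\<bar>" by simp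
      also have "\<dots> \<le> 1 + r" using that component_le_norm_cart[of ?y i] y by auto
      finally have "norm x \<le> norm ?y + (1 + r)" using norm_triangle_sub[of x ?y] by simp
      then show False using n y by auto
    qed
    then show "indicator {0..1::real} (x $ i) *\<^sub>R h (hyper_proj i j m x) = 0"
      by (auto simp: indicator_def)
  qed measurable
  then show "integrable (affine_volume (hyperplane i j m)) h"
    by (simp add: integrable_affine_volume[OF ij h])
qed

context piecewise
begin

text \<open>Integrates \<open>line_integral\<close> over the slab 0 \<le> x_i \<le> 1. Each jump
  term becomes a hyperplane integral, whose area factor sqrt 2 is cancelled by 1 / sqrt 2.\<close>

lemma green_direction:
  assumes \<phi>: "test_function \<phi>"
    and supp: "\<And>z. norm z \<ge> r \<Longrightarrow> \<phi> z = 0 \<and> partial i \<phi> z = 0 \<and> partial i (partial i \<phi>) z = 0"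
    and Ms: "finite Ms" "\<And>m. of_int \<bar>m\<bar> \<le> 2 * r \<Longrightarrow> m \<in> Ms"
  defines "G \<equiv> \<lambda>x. u x * partial i (partial i \<phi>) x - pwsum W \<mu> (\<lambda>w. a (alc x) w * \<mu> w $ i * \<mu> w $ i) x * \<phi> x"
  shows "integrable lborel G"
    and "(\<integral>x. G x \<partial>lborel) = (\<Sum>j\<in>UNIV - {i}. \<Sum>m\<in>Ms. complex_of_real (1 / sqrt 2) *
      (\<integral>y. jump i j y * \<phi> y \<partial>affine_volume (hyperplane i j m)))"
proof -
  note c = test_functionD[OF \<phi>]
  have cz: "\<And>x. norm x \<ge> r \<Longrightarrow> partial i (partial i \<phi>) x = 0" "\<And>x. norm x \<ge> r \<Longrightarrow> \<phi> x = 0"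
    using supp by auto
  note b1 = piecewise_bounded_measurable[of "\<lambda>_. u", OF u_cont c(5) cz(1)]
    and b2 = piecewise_bounded_measurable[of "\<lambda>q. pwsum W \<mu> (\<lambda>w. a q w * \<mu> w $ i * \<mu> w $ i)", OF continuous_pwsum c(3) cz(2)]
  have [measurable]: "G \<in> borel_measurable borel" unfolding G_def by (rule borel_measurable_diff[OF b1(1) b2(1)])
  obtain B1 B2 where "\<And>x. norm (u x * partial i (partial i \<phi>) x) \<le> B1"
      "\<And>x. norm (pwsum W \<mu> (\<lambda>w. a (alc x) w * \<mu> w $ i * \<mu> w $ i) x * \<phi> x) \<le> B2"
    using b1(2) b2(2) by blast
  then have B: "norm (G x) \<le> B1 + B2" for x unfolding G_def by (meson add_mono norm_triangle_ineq4 order_trans)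
  have G0: "G x = 0" if "norm x \<ge> r" for x using supp[OF that] by (simp add: G_def)
  show "integrable lborel G"
    using G0 B by (intro integrable_bounded_support[where B = "B1 + B2" and r = r]) auto
  let ?h = "\<lambda>j y. jump i j y * \<phi> y"
  have hm[measurable]: "?h j \<in> borel_measurable borel" for j
    using jump_bounded_measurable(1)[OF c(3)] supp by blast
  have hB: "\<exists>B. \<forall>y. norm (?h j y) \<le> B" for j
    using jump_bounded_measurable(2)[OF c(3)] supp by blast
  have hi: "integrable lborel (\<lambda>x. indicator {0..1::real} (x $ i) *\<^sub>R ?h j (hyper_proj i j m x))" if "j \<noteq> i" for j m
  proof -
    obtain B where "\<And>y. norm (?h j y) \<le> B" using hB by blast
    then show ?thesis using that supp by (intro integrable_hyper_proj(1)[OF _ hm, where r = r]) auto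
  qed
  have "(\<integral>x. G x \<partial>lborel) = (\<integral>x. indicator {0..1::real} (x $ i) *\<^sub>R (\<integral>t. G (x + t *\<^sub>R axis i 1) \<partial>lborel) \<partial>lborel)"
    by (rule integral_lborel_line[where B = "B1 + B2" and r = r]) (use B G0 in auto)
  also have "\<dots> = (\<integral>x. (\<Sum>j\<in>UNIV - {i}. \<Sum>m\<in>Ms. indicator {0..1::real} (x $ i) *\<^sub>R ?h j (hyper_proj i j m x)) \<partial>lborel)"
  proof (rule integral_cong_AE)
    show "AE x in lborel. indicator {0..1::real} (x $ i) *\<^sub>R (\<integral>t. G (x + t *\<^sub>R axis i 1) \<partial>lborel) =
      (\<Sum>j\<in>UNIV - {i}. \<Sum>m\<in>Ms. indicator {0..1::real} (x $ i) *\<^sub>R ?h j (hyper_proj i j m x))"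
    proof (rule eventually_mono[OF AE_regular])
      fix x :: "real ^ 'n" assume x: "regular x"
      have far: "norm (x + t *\<^sub>R axis i 1) \<ge> r" if "\<bar>t\<bar> > \<bar>r\<bar> + \<bar>x $ i\<bar>" for t
        using component_le_norm_cart[of "x + t *\<^sub>R axis i 1" i] that by (auto simp: axis_def)
      have "integrable lborel (\<lambda>t. G (x + t *\<^sub>R axis i 1))"
        by (rule integrable_bounded_support[where B = "B1 + B2" and r = "\<bar>r\<bar> + \<bar>x $ i\<bar>"])
          (use B G0 far in auto)
      then have "((\<lambda>t. G (x + t *\<^sub>R axis i 1)) has_integral (\<integral>t. G (x + t *\<^sub>R axis i 1) \<partial>lborel)) UNIV"
        by (rule has_integral_integral_lborel)
      then have "(\<integral>t. G (x + t *\<^sub>R axis i 1) \<partial>lborel) = (\<Sum>j\<in>UNIV - {i}. \<Sum>m\<in>Ms. ?h j (hyper_proj i j m x))"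
        using line_integral[OF \<phi> supp x Ms] unfolding G_def by (rule has_integral_unique)
      then show "indicator {0..1::real} (x $ i) *\<^sub>R (\<integral>t. G (x + t *\<^sub>R axis i 1) \<partial>lborel) =
          (\<Sum>j\<in>UNIV - {i}. \<Sum>m\<in>Ms. indicator {0..1::real} (x $ i) *\<^sub>R ?h j (hyper_proj i j m x))"
        by (simp add: scaleR_sum_right)
    qed
  qed measurable
  also have "\<dots> = (\<Sum>j\<in>UNIV - {i}. \<integral>x. (\<Sum>m\<in>Ms. indicator {0..1::real} (x $ i) *\<^sub>R ?h j (hyper_proj i j m x)) \<partial>lborel)"
    by (rule Bochner_Integration.integral_sum) (use hi in \<open>auto intro!: Bochner_Integration.integrable_sum\<close>)
  also have "\<dots> = (\<Sum>j\<in>UNIV - {i}. \<Sum>m\<in>Ms. (\<integral>x. indicator {0..1::real} (x $ i) *\<^sub>R ?h j (hyper_proj i j m x) \<partial>lborel))"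
    by (intro sum.cong refl Bochner_Integration.integral_sum) (use hi in auto)
  also have "\<dots> = (\<Sum>j\<in>UNIV - {i}. \<Sum>m\<in>Ms. complex_of_real (1 / sqrt 2) *
      (\<integral>y. ?h j y \<partial>affine_volume (hyperplane i j m)))"
    by (intro sum.cong refl) (simp add: integral_affine_volume[OF _ hm])
  finally show "(\<integral>x. G x \<partial>lborel) = (\<Sum>j\<in>UNIV - {i}. \<Sum>m\<in>Ms. complex_of_real (1 / sqrt 2) *
      (\<integral>y. jump i j y * \<phi> y \<partial>affine_volume (hyperplane i j m)))" .
qed

end

lemma hyperplane_swap: "hyperplane j i m = hyperplane i j (- m)"
  by (auto simp: hyperplane_def)

lemma sum_off_diagonal:
  fixes X :: "'n::{finite,linorder} \<Rightarrow> 'n \<Rightarrow> 'b::comm_monoid_add"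
  shows "(\<Sum>i\<in>UNIV. \<Sum>j\<in>UNIV - {i}. X i j) = (\<Sum>(i, j)\<in>{(i, j). i < j}. X i j + X j i)"
proof -
  have "(\<Sum>i\<in>UNIV. \<Sum>j\<in>UNIV - {i}. X i j) = (\<Sum>(i, j)\<in>Sigma UNIV (\<lambda>i. UNIV - {i}). X i j)"
    by (rule sum.Sigma) auto
  also have "Sigma UNIV (\<lambda>i::'n. UNIV - {i}) = {(i, j). i < j} \<union> {(i, j). j < i}" by auto
  also have "(\<Sum>(i, j)\<in>{(i, j). i < j} \<union> {(i, j). j < i}. X i j) =
      (\<Sum>(i, j)\<in>{(i, j). i < j}. X i j) + (\<Sum>(i, j)\<in>{(i, j). j < i}. X i j)"
    by (rule sum.union_disjoint) auto
  also have "(\<Sum>(i, j)\<in>{(i, j). j < i}. X i j) = (\<Sum>(i, j)\<in>{(i, j). i < j}. X j i)"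
    by (rule sum.reindex_bij_witness[of _ prod.swap prod.swap]) auto
  finally show ?thesis by (simp add: sum.distrib case_prod_unfold)
qed

text \<open>Sum over the coordinate directions: on each alcove the second derivatives of the plane
  waves add up to E u.\<close>

lemma (in piecewise) green:
  assumes \<phi>: "test_function \<phi>" and ev: "\<And>w. w \<in> W \<Longrightarrow> (\<Sum>i\<in>UNIV. (\<mu> w $ i)\<^sup>2) = E"
    and supp: "\<And>i z. norm z \<ge> r \<Longrightarrow> \<phi> z = 0 \<and> partial i \<phi> z = 0 \<and> partial i (partial i \<phi>) z = 0"
    and R: "2 * r \<le> of_int R"
  shows "(\<integral>x. laplacian \<phi> x * u x \<partial>lborel) = E * (\<integral>x. \<phi> x * u x \<partial>lborel) +
    (\<Sum>i\<in>UNIV. \<Sum>j\<in>UNIV - {i}. \<Sum>m\<in>{-R..R}. complex_of_real (1 / sqrt 2) *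
      (\<integral>y. jump i j y * \<phi> y \<partial>affine_volume (hyperplane i j m)))"
proof -
  let ?D = "\<lambda>i x. u x * partial i (partial i \<phi>) x - pwsum W \<mu> (\<lambda>w. a (alc x) w * \<mu> w $ i * \<mu> w $ i) x * \<phi> x"
  note c = test_functionD[OF \<phi>]
  have Ms: "finite {-R..R}" "\<And>m. of_int \<bar>m\<bar> \<le> 2 * r \<Longrightarrow> m \<in> {-R..R}"
    using R by (auto simp: abs_le_iff)
  have m1[measurable]: "(\<lambda>x. u x * \<phi> x) \<in> borel_measurable borel"
    by (intro borel_measurable_continuous_onI continuous_intros u_cont c)
  obtain B where B: "\<And>x. norm (u x * \<phi> x) \<le> B"
    using piecewise_bounded_measurable(2)[of "\<lambda>_. u", OF u_cont c(3)] supp by blast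
  have i1: "integrable lborel (\<lambda>x. u x * \<phi> x)"
    using B supp by (intro integrable_bounded_support[where B = B and r = r]) auto
  have sum: "(\<Sum>i\<in>UNIV. ?D i x) = laplacian \<phi> x * u x - E * (u x * \<phi> x)" if x: "regular x" for x
  proof -
    have "(\<Sum>i\<in>UNIV. pwsum W \<mu> (\<lambda>w. a (alc x) w * \<mu> w $ i * \<mu> w $ i) x) =
      (\<Sum>w\<in>W. a (alc x) w * plane_wave (\<mu> w) x * (\<Sum>i\<in>UNIV. (\<mu> w $ i)\<^sup>2))"
      unfolding pwsum_def sum_distrib_left by (subst sum.swap) (simp add: power2_eq_square mult_ac)
    also have "\<dots> = E * u x" using ev by (simp add: u_eq[OF x] pwsum_def sum_distrib_left mult_ac)
    finally have "(\<Sum>i\<in>UNIV. pwsum W \<mu> (\<lambda>w. a (alc x) w * \<mu> w $ i * \<mu> w $ i) x * \<phi> x) = E * (u x * \<phi> x)"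
      by (simp add: sum_distrib_right[symmetric])
    moreover have "(\<Sum>i\<in>UNIV. u x * partial i (partial i \<phi>) x) = laplacian \<phi> x * u x"
      by (simp add: laplacian_def sum_distrib_left mult.commute)
    ultimately show ?thesis by (simp add: sum_subtractf)
  qed
  have "(\<integral>x. (\<Sum>i\<in>UNIV. ?D i x) \<partial>lborel) = (\<Sum>i\<in>UNIV. \<integral>x. ?D i x \<partial>lborel)"
    by (rule Bochner_Integration.integral_sum) (use green_direction(1)[where r = r, OF \<phi> supp Ms] in auto)
  also have "\<dots> = (\<Sum>i\<in>UNIV. \<Sum>j\<in>UNIV - {i}. \<Sum>m\<in>{-R..R}. complex_of_real (1 / sqrt 2) *
      (\<integral>y. jump i j y * \<phi> y \<partial>affine_volume (hyperplane i j m)))"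
    by (intro sum.cong refl green_direction(2)[OF \<phi> supp Ms])
  finally have 1: "(\<integral>x. (\<Sum>i\<in>UNIV. ?D i x) \<partial>lborel) = \<dots>" .
  have intS: "integrable lborel (\<lambda>x. \<Sum>i\<in>UNIV. ?D i x)"
    by (rule Bochner_Integration.integrable_sum) (use green_direction(1)[where r = r, OF \<phi> supp Ms] in auto)
  have [measurable]: "(\<lambda>x. laplacian \<phi> x * u x) \<in> borel_measurable borel"
    by (intro borel_measurable_continuous_onI continuous_intros u_cont c)
  have "(\<integral>x. laplacian \<phi> x * u x \<partial>lborel) = (\<integral>x. (\<Sum>i\<in>UNIV. ?D i x) + E * (u x * \<phi> x) \<partial>lborel)"
  proof (rule integral_cong_AE)
    show "AE x in lborel. laplacian \<phi> x * u x = (\<Sum>i\<in>UNIV. ?D i x) + E * (u x * \<phi> x)"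
      by (rule eventually_mono[OF AE_regular]) (simp only: sum, simp)
    show "(\<lambda>x. (\<Sum>i\<in>UNIV. ?D i x) + E * (u x * \<phi> x)) \<in> borel_measurable lborel"
      using borel_measurable_add[OF borel_measurable_integrable[OF intS]
          borel_measurable_times[OF borel_measurable_const borel_measurable_integrable[OF i1]]] .
  qed measurable
  also have "\<dots> = (\<integral>x. (\<Sum>i\<in>UNIV. ?D i x) \<partial>lborel) + E * (\<integral>x. u x * \<phi> x \<partial>lborel)"
    using intS i1 by (subst Bochner_Integration.integral_add) auto
  finally show ?thesis unfolding 1 by (simp add: mult.commute[of _ "\<phi> _"] add.commute)
qed

section \<open>Independence of plane waves on a wall\<close>

text \<open>For small t > 0 the number t (\<alpha> - \<beta>) has modulus at most 1 < 2 \<pi>, so it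
  is no nonzero period of exp.\<close>

lemma exp_eq_exp_all_small:
  fixes \<alpha> \<beta> :: complex
  assumes "e > 0" and eq: "\<And>t::real. 0 < t \<Longrightarrow> t < e \<Longrightarrow> exp (of_real t * \<alpha>) = exp (of_real t * \<beta>)"
  shows "\<alpha> = \<beta>"
proof (rule ccontr)
  assume ne: "\<alpha> \<noteq> \<beta>"
  define t where "t = min (e / 2) (1 / norm (\<alpha> - \<beta>))"
  have t: "0 < t" "t < e" "t * norm (\<alpha> - \<beta>) \<le> 1"
    using ne assms(1) by (auto simp: t_def min_def field_simps)
  define z where "z = of_real t * (\<alpha> - \<beta>)"
  have "exp z = 1" using eq[OF t(1,2)] by (simp add: z_def right_diff_distrib exp_diff)
  then obtain n :: int where n: "Re z = 0" "Im z = of_int (2 * n) * pi" by (auto simp: exp_eq_1)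
  have "norm z \<le> 1" using t by (simp add: z_def norm_mult)
  then have "\<bar>Im z\<bar> \<le> 1" using abs_Im_le_cmod order_trans by blast
  moreover have "\<bar>Im z\<bar> \<ge> 2 * pi" if "n \<noteq> 0"
  proof -
    have "(1::real) \<le> \<bar>of_int n\<bar>" using that by linarith
    then have "1 * (2 * pi) \<le> \<bar>of_int n\<bar> * (2 * pi)" by (intro mult_right_mono) auto
    then show ?thesis using n by (simp add: abs_mult)
  qed
  ultimately have "n = 0" using pi_gt3 by linarith
  then have "z = 0" using n by (simp add: complex_eq_iff)
  then show False using t ne by (simp add: z_def)
qed

text \<open>Passing from f(z) to f(z + t z0) - exp(t L w0 z0) f(z) removes the exponent w0. By
  induction the new coefficients vanish, and if d w \<noteq> 0, \<open>exp_eq_exp_all_small\<close>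
  contradicts the separation of w from w0 by z0.\<close>

lemma exp_independent:
  fixes L :: "'w \<Rightarrow> 'a::real_normed_vector \<Rightarrow> complex"
  assumes "finite W" and E: "subspace E"
    and lin: "\<And>w. w \<in> W \<Longrightarrow> linear (L w)"
    and sep: "\<And>w w'. w \<in> W \<Longrightarrow> w' \<in> W \<Longrightarrow> w \<noteq> w' \<Longrightarrow> \<exists>z\<in>E. L w z \<noteq> L w' z"
    and "e > 0" and "\<And>z. z \<in> E \<Longrightarrow> norm z < e \<Longrightarrow> (\<Sum>w\<in>W. d w * exp (L w z)) = 0"
  shows "\<forall>w\<in>W. d w = 0"
  using assms(1,3-)
proof (induction W arbitrary: d e rule: finite_induct)
  case (insert w0 W)
  have W: "d w = 0" if w: "w \<in> W" for w
  proof (rule ccontr)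
    assume dw: "d w \<noteq> 0"
    obtain z0 where z0: "z0 \<in> E" "L w z0 \<noteq> L w0 z0"
      using insert.prems(2)[of w w0] w insert.hyps(2) by auto
    \<comment> \<open>Keeps t z0 shorter than e / 2, so that z + t z0 stays in the ball of radius e
      for z in the half ball.\<close>
    define e' where "e' = e / 2 / (norm z0 + 1)"
    have n0: "norm z0 + 1 > 0" by (simp add: add_nonneg_pos)
    have e': "e' > 0" unfolding e'_def using insert.prems(3) n0 by simp
    have "exp (of_real t * L w z0) = exp (of_real t * L w0 z0)" if t: "0 < t" "t < e'" for t
    proof -
      have "norm (t *\<^sub>R z0) < e / 2"
      proof -
        have "norm (t *\<^sub>R z0) \<le> t * (norm z0 + 1)" using t by (simp add: mult_left_mono)
        also have "\<dots> < e' * (norm z0 + 1)" using t n0 by (intro mult_strict_right_mono) auto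
        also have "\<dots> = e / 2" unfolding e'_def using n0 by (simp add: field_simps)
        finally show ?thesis .
      qed
      note small = this
      have Lt: "L v (z + t *\<^sub>R z0) = L v z + of_real t * L v z0" if "v \<in> insert w0 W" for v z
        using insert.prems(1)[OF that] by (simp add: linear_add linear_scale scaleR_conv_of_real)
      have "\<forall>v\<in>W. d v * (exp (of_real t * L v z0) - exp (of_real t * L w0 z0)) = 0"
      proof (rule insert.IH)
        show "e / 2 > 0" using insert.prems(3) by simp
        fix z assume z: "z \<in> E" "norm z < e / 2"
        have "norm (z + t *\<^sub>R z0) < e" using norm_triangle_ineq[of z "t *\<^sub>R z0"] z small by linarith
        moreover have "z + t *\<^sub>R z0 \<in> E" using E z z0 by (simp add: subspace_add subspace_scale)
        ultimately have "(\<Sum>v\<in>insert w0 W. d v * exp (L v (z + t *\<^sub>R z0))) = 0" using insert.prems(4) by blast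
        also have "(\<Sum>v\<in>insert w0 W. d v * exp (L v (z + t *\<^sub>R z0)))
          = (\<Sum>v\<in>insert w0 W. d v * exp (of_real t * L v z0) * exp (L v z))"
          by (intro sum.cong refl) (simp only: Lt exp_add mult_ac)
        finally have 1: "(\<Sum>v\<in>insert w0 W. d v * exp (of_real t * L v z0) * exp (L v z)) = 0" .
        have "(\<Sum>v\<in>insert w0 W. d v * exp (L v z)) = 0" using insert.prems(3,4) z by simp
        then have "exp (of_real t * L w0 z0) * (\<Sum>v\<in>insert w0 W. d v * exp (L v z)) = 0" by simp
        then have 2: "(\<Sum>v\<in>insert w0 W. d v * exp (of_real t * L w0 z0) * exp (L v z)) = 0"
          by (simp only: sum_distrib_left mult_ac)
        have "(\<Sum>v\<in>insert w0 W. d v * (exp (of_real t * L v z0) - exp (of_real t * L w0 z0)) * exp (L v z)) = 0"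
          using 1 2 by (simp only: right_diff_distrib left_diff_distrib sum_subtractf) simp
        then show "(\<Sum>v\<in>W. d v * (exp (of_real t * L v z0) - exp (of_real t * L w0 z0)) * exp (L v z)) = 0"
          using insert.hyps by simp
      qed (use insert.prems in auto)
      then show ?thesis using w dw by auto
    qed
    then have "L w z0 = L w0 z0" by (rule exp_eq_exp_all_small[OF e'])
    then show False using z0 by simp
  qed
  have "(\<Sum>w\<in>insert w0 W. d w * exp (L w 0)) = 0"
    using insert.prems(3) insert.prems(4)[of 0] E by (simp add: subspace_0)
  then have "d w0 = 0" using W insert.hyps by simp
  then show ?case using W by auto
qed simp

text \<open>Exponents that coincide on E are merged into one, represented by \<open>rep\<close>; the
  merged coefficients are the class sums.\<close>

lemma exp_independent_classes:
  fixes L :: "'w \<Rightarrow> 'a::real_normed_vector \<Rightarrow> complex"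
  assumes W: "finite W" and E: "subspace E" and lin: "\<And>w. w \<in> W \<Longrightarrow> linear (L w)"
    and e: "e > 0" and z: "\<And>z. z \<in> E \<Longrightarrow> norm z < e \<Longrightarrow> (\<Sum>w\<in>W. d w * exp (L w z)) = 0" and w: "w \<in> W"
  shows "(\<Sum>w' | w' \<in> W \<and> (\<forall>z\<in>E. L w' z = L w z). d w') = 0"
proof -
  define rep where "rep w = (SOME w'. w' \<in> W \<and> (\<forall>z\<in>E. L w' z = L w z))" for w
  have rep: "rep w \<in> W" "\<And>z. z \<in> E \<Longrightarrow> L (rep w) z = L w z" if "w \<in> W" for w
    using that someI[of "\<lambda>w'. w' \<in> W \<and> (\<forall>z\<in>E. L w' z = L w z)" w] unfolding rep_def by auto
  have rep_eq: "rep w = rep w' \<longleftrightarrow> (\<forall>z\<in>E. L w z = L w' z)" if "w \<in> W" "w' \<in> W" for w w'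
  proof
    assume "rep w = rep w'"
    then show "\<forall>z\<in>E. L w z = L w' z" using rep(2)[OF that(1)] rep(2)[OF that(2)] by metis
  next
    assume "\<forall>z\<in>E. L w z = L w' z"
    then have "(\<lambda>v. v \<in> W \<and> (\<forall>z\<in>E. L v z = L w z)) = (\<lambda>v. v \<in> W \<and> (\<forall>z\<in>E. L v z = L w' z))"
      by (intro ext) auto
    then show "rep w = rep w'" unfolding rep_def by simp
  qed
  have "\<forall>v\<in>rep ` W. (\<Sum>w' | w' \<in> W \<and> rep w' = v. d w') = 0"
  proof (rule exp_independent[where L = L and E = E and e = e])
    fix z assume zE: "z \<in> E" "norm z < e"
    have "(\<Sum>v\<in>rep ` W. (\<Sum>w' | w' \<in> W \<and> rep w' = v. d w') * exp (L v z)) =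
        (\<Sum>v\<in>rep ` W. \<Sum>w' | w' \<in> W \<and> rep w' = v. d w' * exp (L w' z))"
      unfolding sum_distrib_right by (intro sum.cong refl) (use rep(2) zE in auto)
    also have "\<dots> = (\<Sum>w\<in>W. d w * exp (L w z))"
      using W by (rule sum.image_gen[symmetric])
    finally show "(\<Sum>v\<in>rep ` W. (\<Sum>w' | w' \<in> W \<and> rep w' = v. d w') * exp (L v z)) = 0"
      using z zE by simp
  next
    fix v v' assume v: "v \<in> rep ` W" "v' \<in> rep ` W" "v \<noteq> v'"
    obtain p p' where p: "v = rep p" "v' = rep p'" "p \<in> W" "p' \<in> W" using v by auto
    then obtain z where "z \<in> E" "L p z \<noteq> L p' z" using rep_eq v(3) by blast
    then show "\<exists>z\<in>E. L v z \<noteq> L v' z" using rep(2) p by auto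
  qed (use W E e lin rep(1) in auto)
  then have "(\<Sum>w' | w' \<in> W \<and> rep w' = rep w. d w') = 0" using w by auto
  moreover have "{w' \<in> W. rep w' = rep w} = {w' \<in> W. \<forall>z\<in>E. L w' z = L w z}" using rep_eq w by blast
  ultimately show ?thesis by simp
qed

context bethe
begin

abbreviation Perms :: "('n \<Rightarrow> 'n) set" where "Perms \<equiv> {w. w permutes UNIV}"

lemma finite_Perms: "finite Perms"
  by (simp add: finite_permutations)

text \<open>As the entries of \<open>lam\<close> are distinct, the entries of w \<open>lam\<close>
  off i and j leave only two candidates for w. They are the waves that merge on a
  hyperplane.\<close>

lemma wl_agree:
  assumes w: "w permutes UNIV" "w' permutes UNIV" and ij: "i \<noteq> j"
    and agree: "\<And>a. a \<noteq> i \<Longrightarrow> a \<noteq> j \<Longrightarrow> wl w' $ a = wl w $ a"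
  shows "w' = w \<or> w' = tp i j \<circ> w"
proof -
  let ?v = "inv_into UNIV w" and ?v' = "inv_into UNIV w'"
  have eq: "?v' a = ?v a" if "a \<noteq> i" "a \<noteq> j" for a
    using agree[OF that] lam_distinct[of "?v' a" "?v a"] by (auto simp: permute_vec_def)
  have wv: "w (?v a) = a" "w' (?v' a) = a" for a using w by (simp_all add: permutes_inverses)
  have vw: "?v (w a) = a" "?v' (w' a) = a" for a using w by (simp_all add: permutes_inverses)
  have fw: "w' b = w b" if "w b \<noteq> i" "w b \<noteq> j" for b
    using eq[OF that] vw(1)[of b] wv(2)[of "w b"] by metis
  have inj: "inj w'" "inj w" using w by (simp_all add: permutes_inj)
  let ?p = "?v i" and ?q = "?v j"
  have pq: "w ?p = i" "w ?q = j" using wv by auto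
  have img: "w' b \<in> {i, j}" if "w b \<in> {i, j}" for b
  proof (rule ccontr)
    assume n: "w' b \<notin> {i, j}"
    have "w (?v (w' b)) = w' b" by (rule wv)
    then have "w' (?v (w' b)) = w' b" using fw[of "?v (w' b)"] n by auto
    then have "?v (w' b) = b" using inj(1) by (simp add: inj_eq)
    then have "w b = w' b" using wv(1)[of "w' b"] by simp
    then show False using that n by simp
  qed
  have ne: "?p \<noteq> ?q" using pq ij by auto
  have "w' ?p \<noteq> w' ?q" using ne inj(1) by (simp add: inj_eq)
  then consider "w' ?p = i" "w' ?q = j" | "w' ?p = j" "w' ?q = i"
    using img[of ?p] img[of ?q] pq by auto
  then show ?thesis
  proof cases
    case 1
    have "w' b = w b" for b
      using fw[of b] 1 vw(1)[of b] by (cases "w b = i \<or> w b = j") auto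
    then show ?thesis by auto
  next
    case 2
    have "w' b = tp i j (w b)" for b
      using fw[of b] 2 vw(1)[of b] by (cases "w b = i \<or> w b = j") (auto simp: Transposition.transpose_def)
    then show ?thesis by (auto simp: fun_eq_iff)
  qed
qed

text \<open>On the hyperplane the waves of w and s w merge, and waves from different pairs stay
  independent. The value says that the two coefficients, rescaled by the waves at y, add up to zero;
  the normal derivative says that they are equal, because \<mu>_i \<noteq> \<mu>_j for \<mu> = w
  \<open>lam\<close>.\<close>

lemma coefficients_zero:
  fixes b :: "('n \<Rightarrow> 'n) \<Rightarrow> complex"
  assumes ij: "i \<noteq> j" and y: "y $ j - y $ i = of_int m" and e: "e > 0"
    and val: "\<And>x. x $ j - x $ i = of_int m \<Longrightarrow> dist x y < e \<Longrightarrow> (\<Sum>w\<in>Perms. b w * plane_wave (wl w) x) = 0"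
    and der: "\<And>x. x $ j - x $ i = of_int m \<Longrightarrow> dist x y < e \<Longrightarrow>
      (\<Sum>w\<in>Perms. b w * (wl w $ i - wl w $ j) * plane_wave (wl w) x) = 0"
    and w: "w permutes UNIV"
  shows "b w = 0"
proof -
  define E :: "(real, 'n) vec set" where "E = {z. z $ i = z $ j}"
  define L where "L w z = (\<Sum>a\<in>UNIV. wl w $ a * of_real (z $ a))" for w and z :: "(real, 'n) vec"
  have E: "subspace E" by (auto simp: subspace_def E_def)
  have lin: "linear (L w)" for w
    unfolding L_def by (rule linearI) (simp_all add: sum.distrib algebra_simps sum_distrib_left scaleR_conv_of_real[where 'a = complex])
  have pw: "plane_wave (wl w) (y + z) = plane_wave (wl w) y * exp (L w z)" for w z
    by (simp add: plane_wave_def L_def exp_add[symmetric] sum.distrib[symmetric] algebra_simps)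
  have sw: "(tp i j \<circ> w) permutes UNIV" using w by (rule permutes_transpose_comp)
  have Ls: "L (tp i j \<circ> w) z = L w z" if "z \<in> E" for z
  proof -
    have "L (tp i j \<circ> w) z = (\<Sum>a\<in>UNIV. wl w $ tp i j a * of_real (z $ tp i j a))"
      using that unfolding L_def by (intro sum.cong) (auto simp: permute_vec_transpose[OF w] E_def Transposition.transpose_def)
    also have "\<dots> = L w z" unfolding L_def
      by (rule sum.reindex_bij_betw[of "tp i j"]) simp
    finally show ?thesis .
  qed
  have ne: "tp i j \<circ> w \<noteq> w"
  proof
    assume "tp i j \<circ> w = w"
    then have "tp i j (w (inv_into UNIV w i)) = w (inv_into UNIV w i)" by (metis comp_apply)
    then show False using ij w by (simp add: permutes_inverses)
  qed
  have cls: "{w' \<in> Perms. \<forall>z\<in>E. L w' z = L w z} = {w, tp i j \<circ> w}"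
  proof (intro equalityI subsetI)
    fix w' assume "w' \<in> {w' \<in> Perms. \<forall>z\<in>E. L w' z = L w z}"
    then have w': "w' permutes UNIV" and eq: "\<And>z. z \<in> E \<Longrightarrow> L w' z = L w z" by auto
    have "wl w' $ a = wl w $ a" if "a \<noteq> i" "a \<noteq> j" for a
    proof -
      have "axis a 1 \<in> E" using that by (auto simp: E_def axis_def)
      from eq[OF this] show ?thesis by (simp add: L_def axis_def if_distrib cong: if_cong)
    qed
    from wl_agree[OF w w' ij this] show "w' \<in> {w, tp i j \<circ> w}" by auto
  qed (use w sw Ls in auto)
  have zero: "d w + d (tp i j \<circ> w) = 0"
    if "\<And>z. z \<in> E \<Longrightarrow> norm z < e \<Longrightarrow> (\<Sum>w\<in>Perms. d w * exp (L w z)) = 0" for d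
  proof -
    have "(\<Sum>w' | w' \<in> Perms \<and> (\<forall>z\<in>E. L w' z = L w z). d w') = 0"
      by (rule exp_independent_classes[OF finite_Perms E lin e that]) (use w in auto)
    then show ?thesis using ne unfolding cls[simplified] by (simp add: cls[simplified])
  qed
  \<comment> \<open>Absorbing the value at y leaves exponents that are linear on the direction space
    E.\<close>
  define d1 where "d1 w = b w * plane_wave (wl w) y" for w
  have H: "(y + z) $ j - (y + z) $ i = of_int m \<and> dist (y + z) y < e" if "z \<in> E" "norm z < e" for z
    using that y by (auto simp: E_def dist_norm)
  have "d1 w + d1 (tp i j \<circ> w) = 0"
  proof (rule zero)
    fix z assume "z \<in> E" "norm z < e"
    then have "(\<Sum>w\<in>Perms. b w * plane_wave (wl w) (y + z)) = 0" using val H by blast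
    then show "(\<Sum>w\<in>Perms. d1 w * exp (L w z)) = 0" by (simp only: d1_def pw mult_ac)
  qed
  moreover have "d1 w * (wl w $ i - wl w $ j) + d1 (tp i j \<circ> w) * (wl (tp i j \<circ> w) $ i - wl (tp i j \<circ> w) $ j) = 0"
  proof (rule zero[where d = "\<lambda>w. d1 w * (wl w $ i - wl w $ j)"])
    fix z assume "z \<in> E" "norm z < e"
    then have "(\<Sum>w\<in>Perms. b w * (wl w $ i - wl w $ j) * plane_wave (wl w) (y + z)) = 0" using der H by blast
    then show "(\<Sum>w\<in>Perms. d1 w * (wl w $ i - wl w $ j) * exp (L w z)) = 0" by (simp only: d1_def pw mult_ac)
  qed
  then have "(d1 w - d1 (tp i j \<circ> w)) * (wl w $ i - wl w $ j) = 0"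
    by (simp add: permute_vec_transpose[OF w] algebra_simps)
  then have "d1 w = d1 (tp i j \<circ> w)"
    using permute_vec_distinct[OF lam_distinct w ij] by simp
  ultimately have "d1 w = 0" by simp
  then show ?thesis by (simp add: d1_def plane_wave_nonzero)
qed

end

section \<open>The weak eigenvalue equation\<close>

lemma test_function_support:
  fixes \<phi> :: "real ^ 'a::finite \<Rightarrow> complex"
  assumes "test_function \<phi>"
  obtains r where "r > 0"
    "\<And>x i. norm x \<ge> r \<Longrightarrow> \<phi> x = 0 \<and> partial i \<phi> x = 0 \<and> partial i (partial i \<phi>) x = 0"
proof -
  let ?K = "closure {x. \<phi> x \<noteq> 0}"
  have "bounded ?K" using assms by (simp add: test_function_def compact_imp_bounded)
  then obtain r where r: "r > 0" "?K \<subseteq> ball 0 r"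
    using bounded_subset_ballD[of ?K 0] by auto
  have z: "x \<notin> ?K \<Longrightarrow> \<phi> x = 0" for x :: "real ^ 'a" using closure_subset[of "{x. \<phi> x \<noteq> 0}"] by blast
  have z1: "x \<notin> ?K \<Longrightarrow> partial i \<phi> x = 0" for i and x :: "real ^ 'a" by (rule partial_zero_outside)
  have "{x. partial i \<phi> x \<noteq> 0} \<subseteq> ?K" for i using z1 by blast
  then have "closure {x. partial i \<phi> x \<noteq> 0} \<subseteq> ?K" for i by (simp add: closure_minimal)
  then have z2: "x \<notin> ?K \<Longrightarrow> partial i (partial i \<phi>) x = 0" for i and x :: "real ^ 'a" by (intro partial_zero_outside) blast
  show thesis
  proof (rule that[OF r(1)])
    fix x :: "real ^ 'a" and i assume "norm x \<ge> r"
    then have "x \<notin> ?K" using r(2) by auto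
    then show "\<phi> x = 0 \<and> partial i \<phi> x = 0 \<and> partial i (partial i \<phi>) x = 0" using z z1 z2 by blast
  qed
qed

lemma continuous_compact_support:
  fixes h :: "real ^ 'n::finite \<Rightarrow> complex"
  assumes "continuous_on UNIV h" "\<And>x. norm x \<ge> r \<Longrightarrow> h x = 0"
  shows "h \<in> borel_measurable borel" "\<exists>B. \<forall>x. norm (h x) \<le> B" "integrable lborel h"
    and "i \<noteq> j \<Longrightarrow> integrable (affine_volume (hyperplane i j m)) h"
proof -
  show m: "h \<in> borel_measurable borel" by (intro borel_measurable_continuous_onI assms)
  show "\<exists>B. \<forall>x. norm (h x) \<le> B"
    using piecewise_bounded_measurable(2)[of "\<lambda>_ _. 1", OF continuous_on_const assms] by simp
  then obtain B where B: "\<And>x. norm (h x) \<le> B" by blast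
  show "integrable lborel h"
    using m B assms(2) by (intro integrable_bounded_support[where B = B and r = r]) auto
  show "i \<noteq> j \<Longrightarrow> integrable (affine_volume (hyperplane i j m)) h"
    using m B assms(2) by (intro integrable_hyper_proj(2)[where B = B and r = r]) auto
qed

context bethe
begin

abbreviation functional :: "('m \<Rightarrow> complex) \<Rightarrow> bool" where
  "functional \<psi> \<equiv> Vector_Spaces.linear smul (*) \<psi>"

section \<open>Linear functionals, plane waves and integrals with values in \<open>M\<close>\<close>

lemma functional_simps:
  assumes "functional \<psi>"
  shows "\<psi> (u + v) = \<psi> u + \<psi> v" "\<psi> (smul a v) = a * \<psi> v" "\<psi> 0 = 0" "\<psi> (- v) = - \<psi> v"
    "\<psi> (u - v) = \<psi> u - \<psi> v" "\<psi> (\<Sum>x\<in>A. g x) = (\<Sum>x\<in>A. \<psi> (g x))"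
proof -
  interpret \<psi>: Vector_Spaces.linear smul "(*)" \<psi> by fact
  show "\<psi> (u + v) = \<psi> u + \<psi> v" "\<psi> (smul a v) = a * \<psi> v" "\<psi> 0 = 0" "\<psi> (- v) = - \<psi> v"
    "\<psi> (u - v) = \<psi> u - \<psi> v" "\<psi> (\<Sum>x\<in>A. g x) = (\<Sum>x\<in>A. \<psi> (g x))"
    by (rule \<psi>.add \<psi>.scale \<psi>.zero \<psi>.neg \<psi>.diff \<psi>.sum)+
qed

lemma functional_\<rho>s: "functional \<psi> \<Longrightarrow> functional (\<lambda>v. \<psi> (\<rho>s i j m v))"
  by (simp add: Vector_Spaces.linear_iff \<rho>s_add \<rho>s_scale)

lemma functional_eqI: "(\<And>\<psi>. functional \<psi> \<Longrightarrow> \<psi> a = \<psi> b) \<Longrightarrow> a = b"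
  using functional_separates[OF vector_space_smul] by blast

definition pw :: "(('n \<Rightarrow> 'n) \<Rightarrow> 'm) \<Rightarrow> (real, 'n) vec \<Rightarrow> 'm" where
  "pw c x = (\<Sum>w | w permutes UNIV. smul (plane_wave (wl w) x) (c w))"

lemma functional_pw: "functional \<psi> \<Longrightarrow> \<psi> (pw c x) = pwsum Perms wl (\<lambda>w. \<psi> (c w)) x"
  by (simp add: pw_def pwsum_def functional_simps mult.commute)

lemma sum_Perms_tp: "(\<Sum>w\<in>Perms. X (tp i j \<circ> w)) = (\<Sum>w\<in>Perms. X w)"
  by (rule sum.reindex_bij_witness[of _ "\<lambda>w. tp i j \<circ> w" "\<lambda>w. tp i j \<circ> w"])
    (auto simp: transpose_invol permutes_transpose_comp)

text \<open>Exchanging w with s w leaves \<open>X\<close> unchanged and reverses the sign of its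
  prefactor. Hence the correction sums to zero, and after multiplication by \<mu>_i - \<mu>_j the
  two halves k / 2 add up to k.\<close>

lemma
  assumes ij: "i \<noteq> j" and y: "y $ j - y $ i = of_int m"
  shows pw_cross: "pw (cross i j m c) y = pw c y"
    and jump_cross: "(\<Sum>w\<in>Perms. smul ((wl w $ i - wl w $ j) * plane_wave (wl w) y) (cross i j m c w - c w)) =
      smul k (\<rho>s i j m (pw c y))"
proof -
  let ?e = "\<lambda>w. plane_wave (wl w) y"
  define X where "X w = \<rho>s i j m (smul (?e w) (c w) + smul (?e (tp i j \<circ> w)) (c (tp i j \<circ> w)))" for w
  have diff: "smul (?e w) (cross i j m c w - c w) = smul (k / (2 * (wl w $ i - wl w $ j))) (X w)" if w: "w permutes UNIV" for w
    using w plane_wave_transpose[OF w ij y, of lam]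
    by (simp add: cross_def X_def \<rho>s_add \<rho>s_scale V.scale_right_distrib mult_ac)
  define Y where "Y w = smul (k / (2 * (wl w $ i - wl w $ j))) (X w)" for w
  have Xs: "X (tp i j \<circ> w) = X w" for w
    by (simp add: X_def transpose_invol add.commute)
  have Ys: "Y (tp i j \<circ> w) = - Y w" if w: "w permutes UNIV" for w
  proof -
    have "k / (2 * (wl w $ j - wl w $ i)) = - (k / (2 * (wl w $ i - wl w $ j)))"
      by (simp add: minus_divide_right)
    then show ?thesis using w by (simp add: Y_def Xs permute_vec_transpose)
  qed
  have "(\<Sum>w\<in>Perms. Y w) = (\<Sum>w\<in>Perms. Y (tp i j \<circ> w))" by (rule sum_Perms_tp[symmetric])
  also have "\<dots> = - (\<Sum>w\<in>Perms. Y w)" using Ys by (simp add: sum_negf)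
  finally have "(\<Sum>w\<in>Perms. Y w) + (\<Sum>w\<in>Perms. Y w) = 0" by (rule eq_neg_iff_add_eq_0[THEN iffD1])
  then have "smul 2 (\<Sum>w\<in>Perms. Y w) = 0" using V.scale_left_distrib[of 1 1 "\<Sum>w\<in>Perms. Y w"] by simp
  then have "(\<Sum>w\<in>Perms. Y w) = 0" by (simp add: V.scale_eq_0_iff)
  moreover have "pw (cross i j m c) y - pw c y = (\<Sum>w\<in>Perms. Y w)"
    unfolding pw_def sum_subtractf[symmetric] V.scale_right_diff_distrib[symmetric] Y_def
    by (intro sum.cong refl diff) simp
  ultimately show "pw (cross i j m c) y = pw c y" by simp
  have "smul ((wl w $ i - wl w $ j) * ?e w) (cross i j m c w - c w) = smul (k / 2) (X w)" if w: "w permutes UNIV" for w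
  proof -
    have "wl w $ i - wl w $ j \<noteq> 0" using permute_vec_distinct[OF lam_distinct w ij] by simp
    then show ?thesis
      unfolding V.scale_scale[symmetric] diff[OF w] by (simp add: field_simps)
  qed
  then have "(\<Sum>w\<in>Perms. smul ((wl w $ i - wl w $ j) * ?e w) (cross i j m c w - c w)) = (\<Sum>w\<in>Perms. smul (k / 2) (X w))"
    by (intro sum.cong) auto
  also have "\<dots> = smul (k / 2) (\<Sum>w\<in>Perms. X w)" by (rule V.scale_sum_right[symmetric])
  also have "(\<Sum>w\<in>Perms. X w) = \<rho>s i j m ((\<Sum>w\<in>Perms. smul (?e w) (c w)) + (\<Sum>w\<in>Perms. smul (?e (tp i j \<circ> w)) (c (tp i j \<circ> w))))"
  proof -
    interpret r: Vector_Spaces.linear smul smul "\<rho>s i j m" by (rule \<rho>s_linear)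
    show ?thesis unfolding X_def r.sum[symmetric] sum.distrib ..
  qed
  also have "(\<Sum>w\<in>Perms. smul (?e (tp i j \<circ> w)) (c (tp i j \<circ> w))) = (\<Sum>w\<in>Perms. smul (?e w) (c w))"
    by (rule sum_Perms_tp)
  also have "\<rho>s i j m ((\<Sum>w\<in>Perms. smul (?e w) (c w)) + (\<Sum>w\<in>Perms. smul (?e w) (c w))) = smul 2 (\<rho>s i j m (pw c y))"
    using V.scale_left_distrib[of 1 1 "\<rho>s i j m (pw c y)"] by (simp add: \<rho>s_add pw_def)
  finally show "(\<Sum>w\<in>Perms. smul ((wl w $ i - wl w $ j) * plane_wave (wl w) y) (cross i j m c w - c w)) =
      smul k (\<rho>s i j m (pw c y))" by simp
qed

text \<open>A basis of the finite-dimensional span is extended to a basis of \<open>M\<close>, so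
  its coordinates become functionals on all of \<open>M\<close>.\<close>

lemma finite_representation:
  assumes "finite S" "\<And>x. x \<in> K \<Longrightarrow> f x \<in> V.span S"
  obtains N :: nat and \<psi> v where "\<And>l. l < N \<Longrightarrow> functional (\<psi> l)"
    "\<And>x. x \<in> K \<Longrightarrow> f x = (\<Sum>l<N. smul (\<psi> l (f x)) (v l))"
proof -
  obtain T where T: "T \<subseteq> S" "V.independent T" "S \<subseteq> V.span T"
    using V.maximal_independent_subset[of S] by blast
  obtain B where "T \<subseteq> B" "V.independent B" "UNIV \<subseteq> V.span B"
    by (rule V.maximal_independent_subset_extend[OF subset_UNIV T(2)])
  then have B: "T \<subseteq> B" "V.independent B" "V.span B = UNIV" by (simp_all add: top.extremum_unique)
  have fin: "finite T" using T(1) assms(1) by (rule finite_subset)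
  have cv: "vector_space ((*) :: complex \<Rightarrow> complex \<Rightarrow> complex)"
    by unfold_locales (simp_all add: algebra_simps)
  have func: "functional (\<lambda>u. V.representation B u b)" for b
    using B cv vector_space_smul
    by (intro Vector_Spaces.linear_iff[THEN iffD2]) (auto simp: V.representation_add V.representation_scale)
  have rep: "f x = (\<Sum>b\<in>T. smul (V.representation B (f x) b) b)" if "x \<in> K" for x
  proof -
    have "V.span S \<subseteq> V.span T" using T(3) by (simp add: V.span_minimal V.subspace_span)
    then have fx: "f x \<in> V.span T" using assms(2)[OF that] by blast
    then have "V.representation B (f x) = V.representation T (f x)"
      using B by (intro V.representation_extend) auto
    then show ?thesis using V.sum_representation_eq[OF T(2) fx fin] by simp
  qed
  obtain h where h: "bij_betw h {..<card T} T"
    using ex_bij_betw_nat_finite[OF fin] by (auto simp: atLeast0LessThan)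
  show thesis
  proof (rule that[of "card T" "\<lambda>l u. V.representation B u (h l)" h])
    fix x assume "x \<in> K"
    show "f x = (\<Sum>l<card T. smul (V.representation B (f x) (h l)) (h l))"
      using rep[OF \<open>x \<in> K\<close>] sum.reindex_bij_betw[OF h, of "\<lambda>b. smul (V.representation B (f x) b) b"] by simp
  qed (rule func)
qed

lemma vec_continuous_functional:
  fixes f :: "(real, 'n) vec \<Rightarrow> 'm"
  assumes "vec_continuous smul f" "functional \<psi>"
  shows "continuous_on UNIV (\<lambda>x. \<psi> (f x))"
proof -
  have "isCont (\<lambda>x. \<psi> (f x)) x" for x
  proof -
    obtain U and N :: nat and g v where U: "open U" "x \<in> U"
      and g: "\<And>l. l < N \<Longrightarrow> continuous_on U (g l)" and f: "\<And>y. y \<in> U \<Longrightarrow> f y = (\<Sum>l<N. smul (g l y) (v l))"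
      using assms(1) unfolding vec_continuous_def by metis
    have "continuous_on U (\<lambda>y. \<Sum>l<N. g l y * \<psi> (v l))"
      by (intro continuous_intros) (use g in auto)
    then have "continuous_on U (\<lambda>y. \<psi> (f y))"
      by (rule continuous_on_cong[THEN iffD1, rotated 2]) (simp_all add: f functional_simps[OF assms(2)])
    then show ?thesis using U by (simp add: continuous_on_eq_continuous_at)
  qed
  then show ?thesis by (simp add: continuous_at_imp_continuous_on)
qed

text \<open>Locally the values lie in the span of finitely many vectors; a finite subcover collects
  them.\<close>

lemma vec_continuous_span:
  fixes f :: "(real, 'n) vec \<Rightarrow> 'm"
  assumes "vec_continuous smul f" "compact K"
  obtains S where "finite S" "\<And>x. x \<in> K \<Longrightarrow> f x \<in> V.span S"
proof -
  have "\<exists>U S. open U \<and> x \<in> U \<and> finite S \<and> (\<forall>y\<in>U. f y \<in> V.span S)" for x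
  proof -
    obtain U and N :: nat and g v where U: "open U" "x \<in> U" and f: "\<And>y. y \<in> U \<Longrightarrow> f y = (\<Sum>l<N. smul (g l y) (v l))"
      using assms(1) unfolding vec_continuous_def by metis
    have "f y \<in> V.span (v ` {..<N})" if "y \<in> U" for y
      unfolding f[OF that] by (intro V.span_sum V.span_scale V.span_base) auto
    then show ?thesis using U by blast
  qed
  then obtain U S where US: "\<And>x. open (U x) \<and> x \<in> U x \<and> finite (S x) \<and> (\<forall>y\<in>U x. f y \<in> V.span (S x))" by metis
  have "K \<subseteq> (\<Union>x\<in>K. U x)" using US by fast
  with US obtain C where C: "finite C" "K \<subseteq> (\<Union>x\<in>C. U x)"
    by (rule_tac compactE_image[OF assms(2), of K U]) simp_all
  show thesis
  proof (rule that[of "\<Union>x\<in>C. S x"])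
    show "finite (\<Union>x\<in>C. S x)" using C US by blast
    fix y assume "y \<in> K"
    then obtain x where "x \<in> C" "y \<in> U x" using C by blast
    then have "f y \<in> V.span (S x)" using US by blast
    then show "f y \<in> V.span (\<Union>x\<in>C. S x)" using V.span_mono[of "S x" "\<Union>x\<in>C. S x"] \<open>x \<in> C\<close> by blast
  qed
qed

text \<open>The coordinate functionals of the local finite-dimensional span furnish the local tensor
  expression.\<close>

lemma vec_continuousI:
  fixes f :: "(real, 'n) vec \<Rightarrow> 'm"
  assumes "\<And>x. \<exists>U S. open U \<and> x \<in> U \<and> finite S \<and> (\<forall>y\<in>U. f y \<in> V.span S)"
    and "\<And>\<psi>. functional \<psi> \<Longrightarrow> continuous_on UNIV (\<lambda>x. \<psi> (f x))"
  shows "vec_continuous smul f"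
  unfolding vec_continuous_def
proof
  fix x
  obtain U S where U: "open U" "x \<in> U" and S: "finite S" "\<And>y. y \<in> U \<Longrightarrow> f y \<in> V.span S" using assms(1) by metis
  obtain N :: nat and \<psi> v where \<psi>: "\<And>l. l < N \<Longrightarrow> functional (\<psi> l)"
    and f: "\<And>x. x \<in> U \<Longrightarrow> f x = (\<Sum>l<N. smul (\<psi> l (f x)) (v l))"
    using finite_representation[where K = U and f = f, OF S] by blast
  have "\<forall>l<N. continuous_on U (\<lambda>y. \<psi> l (f y))"
    using assms(2) \<psi> continuous_on_subset by blast
  then show "\<exists>U. open U \<and> x \<in> U \<and> (\<exists>(N::nat) g v. (\<forall>l<N. continuous_on U (g l)) \<and>
      (\<forall>y\<in>U. f y = (\<Sum>l<N. smul (g l y) (v l))))"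
    using U f by (intro exI[of _ U] conjI exI[of _ N] exI[of _ "\<lambda>l y. \<psi> l (f y)"] exI[of _ v]) auto
qed

text \<open>On the support f takes values in a finite-dimensional subspace, so the integrand is a
  single finite sum of scalar functions times vectors. This gives both the existence of the integral
  and its value under \<psi>.\<close>

lemma functional_vec_integral:
  fixes f :: "(real, 'n) vec \<Rightarrow> 'm"
  assumes f: "vec_continuous smul f" and \<phi>: "continuous_on UNIV \<phi>" "\<And>x. norm x \<ge> r \<Longrightarrow> \<phi> x = 0"
    and \<mu>: "\<And>h :: (real, 'n) vec \<Rightarrow> complex. continuous_on UNIV h \<Longrightarrow> (\<And>x. norm x \<ge> r \<Longrightarrow> h x = 0) \<Longrightarrow> integrable \<mu> h"
    and \<psi>: "functional \<psi>"
  shows "\<psi> (vec_integral smul \<mu> (\<lambda>x. smul (\<phi> x) (f x))) = (\<integral>x. \<phi> x * \<psi> (f x) \<partial>\<mu>)"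
proof -
  obtain S where S: "finite S" "\<And>x. x \<in> cball 0 r \<Longrightarrow> f x \<in> V.span S"
    using vec_continuous_span[OF f compact_cball] by blast
  obtain N :: nat and \<xi> v where \<xi>: "\<And>l. l < N \<Longrightarrow> functional (\<xi> l)"
    and rep: "\<And>x. x \<in> cball 0 r \<Longrightarrow> f x = (\<Sum>l<N. smul (\<xi> l (f x)) (v l))"
    using finite_representation[where K = "cball 0 r" and f = f, OF S] by blast
  define g where "g l x = \<phi> x * \<xi> l (f x)" for l x
  have g: "integrable \<mu> (g l)" if "l < N" for l
    unfolding g_def using \<phi> vec_continuous_functional[OF f \<xi>[OF that]] by (intro \<mu> continuous_intros) auto
  have F: "smul (\<phi> x) (f x) = (\<Sum>l<N. smul (g l x) (v l))" for x
  proof (cases "norm x \<le> r")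
    case True
    then have "smul (\<phi> x) (f x) = smul (\<phi> x) (\<Sum>l<N. smul (\<xi> l (f x)) (v l))" using rep[of x] by simp
    then show ?thesis by (simp add: V.scale_sum_right g_def)
  qed (use \<phi>(2) in \<open>simp add: g_def\<close>)
  define I where "I = (\<Sum>l<N. smul (integral\<^sup>L \<mu> (g l)) (v l))"
  have "has_vec_integral smul \<mu> (\<lambda>x. smul (\<phi> x) (f x)) I"
    unfolding has_vec_integral_def I_def using g F by blast
  then have "vec_integral smul \<mu> (\<lambda>x. smul (\<phi> x) (f x)) = I"
    unfolding vec_integral_def using has_vec_integral_unique[OF vector_space_smul] by blast
  moreover have "\<psi> I = (\<integral>x. \<phi> x * \<psi> (f x) \<partial>\<mu>)"
  proof -
    have "(\<integral>x. \<phi> x * \<psi> (f x) \<partial>\<mu>) = (\<integral>x. (\<Sum>l<N. g l x * \<psi> (v l)) \<partial>\<mu>)"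
    proof (rule Bochner_Integration.integral_cong[OF refl])
      fix x
      have "\<psi> (smul (\<phi> x) (f x)) = (\<Sum>l<N. g l x * \<psi> (v l))" unfolding F by (simp add: functional_simps[OF \<psi>])
      then show "\<phi> x * \<psi> (f x) = (\<Sum>l<N. g l x * \<psi> (v l))" by (simp add: functional_simps[OF \<psi>])
    qed
    also have "\<dots> = \<psi> I" using g by (simp add: I_def functional_simps[OF \<psi>])
    finally show ?thesis by simp
  qed
  ultimately show ?thesis by simp
qed

lemma vec_continuous_\<rho>s:
  fixes f :: "(real, 'n) vec \<Rightarrow> 'm"
  assumes "vec_continuous smul f"
  shows "vec_continuous smul (\<lambda>x. \<rho>s i j m (f x))"
proof (rule vec_continuousI)
  interpret r: Vector_Spaces.linear smul smul "\<rho>s i j m" by (rule \<rho>s_linear)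
  fix x
  obtain U and N :: nat and g v where U: "open U" "x \<in> U" and f: "\<And>y. y \<in> U \<Longrightarrow> f y = (\<Sum>l<N. smul (g l y) (v l))"
    using assms(1) unfolding vec_continuous_def by metis
  have "\<rho>s i j m (f y) \<in> V.span ((\<lambda>l. \<rho>s i j m (v l)) ` {..<N})" if "y \<in> U" for y
    unfolding f[OF that] r.sum r.scale by (intro V.span_sum V.span_scale V.span_base) auto
  then show "\<exists>U S. open U \<and> x \<in> U \<and> finite S \<and> (\<forall>y\<in>U. \<rho>s i j m (f y) \<in> V.span S)" using U by blast
qed (use vec_continuous_functional[OF assms functional_\<rho>s] in blast)

text \<open>The weak equation tested by \<psi>, with all terms on one side. The cut-off R stands for
  \<open>Sum_any\<close>: once it is at least twice the radius of the support, hyperplanes with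
  \<bar>m\<bar> > R contribute nothing.\<close>

definition weak_defect :: "((real, 'n) vec \<Rightarrow> complex) \<Rightarrow> int \<Rightarrow> complex \<Rightarrow> ((real, 'n) vec \<Rightarrow> 'm) \<Rightarrow> ('m \<Rightarrow> complex) \<Rightarrow> complex" where
  "weak_defect \<phi> R E f \<psi> =
    (\<integral>x. laplacian \<phi> x * \<psi> (f x) \<partial>lborel) + E * (\<integral>x. \<phi> x * \<psi> (f x) \<partial>lborel) +
    k * (\<Sum>(i, j)\<in>{(i, j). i < j}. \<Sum>m\<in>{-R..R}. complex_of_real (1 / sqrt 2) *
      (\<integral>x. \<phi> x * \<psi> (\<rho>s i j m (f x)) \<partial>affine_volume (hyperplane i j m)))"

lemma weak_functional:
  fixes f :: "(real, 'n) vec \<Rightarrow> 'm"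
  assumes f: "vec_continuous smul f" and \<phi>: "test_function \<phi>"
    and supp: "\<And>x i. norm x \<ge> r \<Longrightarrow> \<phi> x = 0 \<and> partial i \<phi> x = 0 \<and> partial i (partial i \<phi>) x = 0"
    and R: "2 * r \<le> of_int R"
  shows "(- vec_integral smul lborel (\<lambda>x. smul (laplacian \<phi> x) (f x))
      - smul k (\<Sum>(i, j)\<in>{(i, j). i < j}. Sum_any (\<lambda>m.
          smul (of_real (1 / sqrt 2)) (vec_integral smul (affine_volume (hyperplane i j m)) (\<lambda>x. smul (\<phi> x) (\<rho>s i j m (f x))))))
      = smul E (vec_integral smul lborel (\<lambda>x. smul (\<phi> x) (f x)))) \<longleftrightarrow>
    (\<forall>\<psi>. functional \<psi> \<longrightarrow> weak_defect \<phi> R E f \<psi> = 0)" (is "?lhs = ?rhs \<longleftrightarrow> _")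
proof -
  note c = test_functionD[OF \<phi>]
  have \<phi>0: "norm x \<ge> r \<Longrightarrow> \<phi> x = 0" for x using supp by blast
  have lap0: "norm x \<ge> r \<Longrightarrow> laplacian \<phi> x = 0" for x using supp by (simp add: laplacian_def)
  define X where "X i j m = smul (of_real (1 / sqrt 2)) (vec_integral smul (affine_volume (hyperplane i j m)) (\<lambda>x. smul (\<phi> x) (\<rho>s i j m (f x))))" for i j m
  have \<psi>X: "\<psi> (X i j m) = complex_of_real (1 / sqrt 2) * (\<integral>x. \<phi> x * \<psi> (\<rho>s i j m (f x)) \<partial>affine_volume (hyperplane i j m))"
    if "functional \<psi>" "i \<noteq> j" for \<psi> i j m
    unfolding X_def functional_simps(2)[OF that(1)]
    by (subst functional_vec_integral[OF vec_continuous_\<rho>s[OF f] c(3) \<phi>0 _ that(1)])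
      (auto intro: continuous_compact_support(4)[OF _ _ that(2)])
  have X0: "X i j m = 0" if "i < j" "m \<notin> {-R..R}" for i j m
  proof (rule functional_eqI)
    fix \<psi> assume \<psi>: "functional \<psi>"
    have ij: "i \<noteq> j" using that by simp
    have cont: "continuous_on UNIV (\<lambda>x. \<phi> x * \<psi> (\<rho>s i j m (f x)))"
      by (intro continuous_intros c vec_continuous_functional[OF vec_continuous_\<rho>s[OF f] \<psi>])
    have "\<phi> (hyper_proj i j m x) = 0" for x
    proof (rule \<phi>0)
      let ?y = "hyper_proj i j m x"
      have "?y $ j - ?y $ i = of_int m" using ij by (simp add: hyper_proj_def)
      moreover have "\<bar>of_int m :: real\<bar> > 2 * r" using that R by auto
      ultimately show "r \<le> norm ?y"
        using component_le_norm_cart[of ?y i] component_le_norm_cart[of ?y j] by linarith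
    qed
    then have "(\<integral>x. \<phi> x * \<psi> (\<rho>s i j m (f x)) \<partial>affine_volume (hyperplane i j m)) = 0"
      by (subst integral_affine_volume[OF ij borel_measurable_continuous_onI[OF cont]]) simp
    then show "\<psi> (X i j m) = \<psi> 0" by (simp add: \<psi>X[OF \<psi> ij] functional_simps[OF \<psi>])
  qed
  have any: "Sum_any (X i j) = (\<Sum>m\<in>{-R..R}. X i j m)" if "i < j" for i j
  proof (rule Sum_any.expand_superset)
    show "{m. X i j m \<noteq> 0} \<subseteq> {-R..R}" using X0[OF that] by blast
  qed simp
  have "\<psi> ?lhs - \<psi> ?rhs = - weak_defect \<phi> R E f \<psi>" if \<psi>: "functional \<psi>" for \<psi>
  proof -
    have "\<psi> (\<Sum>(i, j)\<in>{(i, j). i < j}. Sum_any (X i j)) = (\<Sum>(i, j)\<in>{(i, j). i < j}. \<Sum>m\<in>{-R..R}. complex_of_real (1 / sqrt 2) *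
      (\<integral>x. \<phi> x * \<psi> (\<rho>s i j m (f x)) \<partial>affine_volume (hyperplane i j m)))"
      unfolding functional_simps(6)[OF \<psi>]
      by (intro sum.cong refl) (auto simp: any functional_simps[OF \<psi>] \<psi>X[OF \<psi>])
    moreover have "\<psi> (vec_integral smul lborel (\<lambda>x. smul (\<phi> x) (f x))) = (\<integral>x. \<phi> x * \<psi> (f x) \<partial>lborel)"
      by (rule functional_vec_integral[where r = r, OF f c(3) \<phi>0 _ \<psi>]) (auto intro: continuous_compact_support(3))
    moreover have "\<psi> (vec_integral smul lborel (\<lambda>x. smul (laplacian \<phi> x) (f x))) = (\<integral>x. laplacian \<phi> x * \<psi> (f x) \<partial>lborel)"
      by (rule functional_vec_integral[where r = r, OF f c(6) lap0 _ \<psi>]) (auto intro: continuous_compact_support(3))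
    ultimately show ?thesis
      unfolding weak_defect_def X_def[symmetric] by (simp add: functional_simps(2,4,5)[OF \<psi>])
  qed
  note diff = this
  show ?thesis
  proof (intro iffI allI impI)
    fix \<psi> assume eq: "?lhs = ?rhs" and \<psi>: "functional \<psi>"
    show "weak_defect \<phi> R E f \<psi> = 0" using diff[OF \<psi>] unfolding eq by simp
  next
    assume 0: "\<forall>\<psi>. functional \<psi> \<longrightarrow> weak_defect \<phi> R E f \<psi> = 0"
    show "?lhs = ?rhs"
    proof (rule functional_eqI)
      fix \<psi> assume \<psi>: "functional \<psi>"
      have "weak_defect \<phi> R E f \<psi> = 0" using 0 \<psi> by blast
      from diff[OF \<psi>, unfolded this] show "\<psi> ?lhs = \<psi> ?rhs" by (simp only: minus_zero right_minus_eq)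
    qed
  qed
qed

end

text \<open>In the chart \<open>hyper_proj\<close> almost every point of the hyperplane is the image
  of a regular point, hence lies on no other hyperplane.\<close>

lemma integral_hyperplane_zero:
  fixes h :: "real ^ 'n::finite \<Rightarrow> complex"
  assumes ij: "i \<noteq> j" and h: "h \<in> borel_measurable borel"
    and z: "\<And>z. z \<in> hyperplane i j m \<Longrightarrow> semiregular i j z \<Longrightarrow> h z = 0"
  shows "(\<integral>x. h x \<partial>affine_volume (hyperplane i j m)) = 0"
proof -
  have "(\<integral>x. indicator {0..1::real} (x $ i) *\<^sub>R h (hyper_proj i j m x) \<partial>lborel) = (\<integral>x. 0 \<partial>(lborel :: (real ^ 'n) measure))"
  proof (rule integral_cong_AE)
    show "AE x in lborel. indicator {0..1::real} (x $ i) *\<^sub>R h (hyper_proj i j m x) = 0"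
      by (rule eventually_mono[OF AE_regular]) (simp add: z hyper_proj_in semiregular_hyper_proj ij)
  qed (use h in measurable)
  then show ?thesis by (simp add: integral_affine_volume[OF ij h])
qed

lemma open_null_imp_empty:
  fixes U :: "'a::euclidean_space set"
  assumes "open U" "AE x in lborel. x \<notin> U"
  shows "U = {}"
proof (rule ccontr)
  assume ne: "U \<noteq> {}"
  have "U \<in> sets lborel" using assms(1) by simp
  then have "U \<in> null_sets lborel" using assms(2) by (simp add: AE_iff_null_sets)
  then have "U \<in> null_sets lebesgue" by (rule null_sets_completionI)
  then have "negligible U" by (simp add: negligible_iff_null_sets)
  then show False using open_not_negligible[OF assms(1) ne] by simp
qed

lemma regular_dense:
  fixes U :: "(real ^ 'n::finite) set"
  assumes "open U" "U \<noteq> {}"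
  obtains y where "y \<in> U" "regular y"
proof -
  have "\<not> (\<forall>y\<in>U. \<not> regular y)"
  proof
    assume "\<forall>y\<in>U. \<not> regular y"
    then have "AE x in lborel. x \<notin> U" by (intro eventually_mono[OF AE_regular]) auto
    then show False using open_null_imp_empty[OF assms(1)] assms(2) by simp
  qed
  then show thesis using that by blast
qed

lemma integral_bump_nonzero:
  fixes y :: "real ^ 'n::finite"
  assumes ij: "i \<noteq> j" and y: "y \<in> hyperplane i j m" and e: "e > 0"
  shows "integrable lborel (\<lambda>x. indicator {0..1::real} (x $ i) * bump y e (hyper_proj i j m x))"
    and "(\<integral>x. indicator {0..1::real} (x $ i) * bump y e (hyper_proj i j m x) \<partial>lborel) > 0"
proof -
  let ?g = "\<lambda>x. indicator {0..1::real} (x $ i) * bump y e (hyper_proj i j m x)"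
  have tf: "test_function (\<lambda>x. complex_of_real (bump y e x))" by (rule test_function_bump[OF e])
  have supp: "bump y e x = 0" if "norm x \<ge> norm y + e" for x
  proof -
    have "dist x y \<ge> e" using that norm_triangle_ineq2[of x y] by (simp add: dist_norm)
    then show ?thesis using bump_pos_iff[OF e, of y x] bump_nonneg[of y e x] by linarith
  qed
  have m: "(\<lambda>x. complex_of_real (bump y e x)) \<in> borel_measurable borel"
    by (intro borel_measurable_continuous_onI test_functionD(3) tf)
  obtain B where B: "\<And>x. norm (complex_of_real (bump y e x)) \<le> B"
    using piecewise_bounded_measurable(2)[of "\<lambda>_ _. 1", OF continuous_on_const test_functionD(3)[OF tf], of "norm y + e"] supp by auto
  have "integrable lborel (\<lambda>x. indicator {0..1::real} (x $ i) *\<^sub>R complex_of_real (bump y e (hyper_proj i j m x)))"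
    using m B supp by (intro integrable_hyper_proj(1)[OF ij, where B = B and r = "norm y + e"]) auto
  then have "integrable lborel (\<lambda>x. Re (indicator {0..1::real} (x $ i) *\<^sub>R complex_of_real (bump y e (hyper_proj i j m x))))"
    by (rule integrable_Re)
  then show int: "integrable lborel ?g" by simp
  have nn: "AE x in lborel. 0 \<le> ?g x" using bump_nonneg by (intro always_eventually) (auto simp: indicator_def)
  have "(\<integral>x. ?g x \<partial>lborel) \<noteq> 0"
  proof
    assume "(\<integral>x. ?g x \<partial>lborel) = 0"
    then have ae: "AE x in lborel. ?g x = 0" using integral_nonneg_eq_0_iff_AE[OF int nn] by simp
    define U where "U = {x. 0 < x $ i} \<inter> {x. x $ i < 1} \<inter> {x. dist (hyper_proj i j m x) y < e}"
    have "continuous_on UNIV (hyper_proj i j m :: real ^ 'n \<Rightarrow> _)"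
      unfolding hyper_proj_eq[abs_def] by (intro continuous_intros)
    then have "open U" unfolding U_def
      by (intro open_Int open_Collect_less continuous_intros) (auto intro!: continuous_intros)
    moreover have "AE x in lborel. x \<notin> U"
      using ae
    proof eventually_elim
      case (elim x)
      show ?case
      proof
        assume x: "x \<in> U"
        then have "bump y e (hyper_proj i j m x) > 0" by (simp add: U_def bump_pos_iff[OF e])
        then show False using elim x by (simp add: U_def indicator_def)
      qed
    qed
    ultimately have "U = {}" by (rule open_null_imp_empty)
    \<comment> \<open>The preimage of y whose i-th coordinate is in the middle of the slab.\<close>
    moreover have "(\<chi> a. if a = i then 1/2 else y $ a) \<in> U"
    proof -
      have "hyper_proj i j m (\<chi> a. if a = i then 1/2 else y $ a) = y"
        using y ij by (auto simp: hyper_proj_def vec_eq_iff hyperplane_def)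
      then show ?thesis using e by (simp add: U_def)
    qed
    ultimately show False by simp
  qed
  moreover have "(\<integral>x. ?g x \<partial>lborel) \<ge> 0" by (rule integral_nonneg_AE[OF nn])
  ultimately show "(\<integral>x. ?g x \<partial>lborel) > 0" by simp
qed

text \<open>Test h against a bump inside a ball where h differs from h(y) by less than half the
  modulus of h(y): the vanishing integral would bound the positive mass of the bump by half of
  itself.\<close>

lemma zero_by_bumps:
  fixes h :: "real ^ 'n::finite \<Rightarrow> complex"
  assumes ij: "i \<noteq> j" and y: "y \<in> hyperplane i j m" and e0: "e0 > 0" and h: "continuous_on UNIV h"
    and z: "\<And>e. 0 < e \<Longrightarrow> e < e0 \<Longrightarrow>
      (\<integral>x. h x * complex_of_real (bump y e x) \<partial>affine_volume (hyperplane i j m)) = 0"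
  shows "h y = 0"
proof (rule ccontr)
  assume ne: "h y \<noteq> 0"
  have "isCont h y" using h by (simp add: continuous_on_eq_continuous_at)
  then obtain d where d: "d > 0" "\<And>x. dist x y < d \<Longrightarrow> dist (h x) (h y) < norm (h y) / 2"
    using ne unfolding continuous_at_eps_delta by (metis half_gt_zero zero_less_norm_iff)
  define e where "e = min d e0 / 2"
  have e: "0 < e" "e < e0" "e < d" using d e0 by (auto simp: e_def)
  let ?P = "hyper_proj i j m" and ?i = "\<lambda>x::real ^ 'n. indicator {0..1::real} (x $ i)"
  define g where "g x = ?i x * bump y e (?P x)" for x
  note g = integral_bump_nonzero[OF ij y e(1), folded g_def]
  have tf: "test_function (\<lambda>x. complex_of_real (bump y e x))" by (rule test_function_bump[OF e(1)])
  have supp: "bump y e x = 0" if "norm x \<ge> norm y + e" for x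
  proof -
    have "dist x y \<ge> e" using that norm_triangle_ineq2[of x y] by (simp add: dist_norm)
    then show ?thesis using bump_pos_iff[OF e(1), of y x] bump_nonneg[of y e x] by linarith
  qed
  have hb: "continuous_on UNIV (\<lambda>x. h x * complex_of_real (bump y e x))"
    by (intro continuous_intros h test_functionD(3)[OF tf])
  have m: "(\<lambda>x. h x * complex_of_real (bump y e x)) \<in> borel_measurable borel"
    by (intro borel_measurable_continuous_onI hb)
  obtain B where B: "\<And>x. norm (h x * complex_of_real (bump y e x)) \<le> B"
    using piecewise_bounded_measurable(2)[of "\<lambda>_ _. 1", OF continuous_on_const hb, of "norm y + e"] supp by auto
  have i1: "integrable lborel (\<lambda>x. ?i x *\<^sub>R (h (?P x) * complex_of_real (bump y e (?P x))))"
    using m B supp by (intro integrable_hyper_proj(1)[OF ij m, where B = B and r = "norm y + e"]) auto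
  have "(\<integral>x. ?i x *\<^sub>R (h (?P x) * complex_of_real (bump y e (?P x))) \<partial>lborel) = 0"
    using z[OF e(1,2)] integral_affine_volume[OF ij m] by simp
  moreover have eq: "?i x *\<^sub>R (h (?P x) * complex_of_real (bump y e (?P x))) = h (?P x) * of_real (g x)" for x
    by (simp add: g_def scaleR_conv_of_real)
  ultimately have 0: "(\<integral>x. h (?P x) * of_real (g x) \<partial>lborel) = 0" by simp
  have i1': "integrable lborel (\<lambda>x. h (?P x) * complex_of_real (g x))" using i1 unfolding eq .
  have i2: "integrable lborel (\<lambda>x. h y * complex_of_real (g x))" using g(1) by (intro integrable_mult_right integrable_of_real)
  have "h y * complex_of_real (\<integral>x. g x \<partial>lborel) = (\<integral>x. h y * of_real (g x) - h (?P x) * of_real (g x) \<partial>lborel)"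
    using i1' i2 0 by simp
  then have "norm (h y) * (\<integral>x. g x \<partial>lborel) = norm (\<integral>x. h y * of_real (g x) - h (?P x) * of_real (g x) \<partial>lborel)"
    using g(2) by (metis norm_mult norm_of_real abs_of_pos)
  also have "\<dots> \<le> (\<integral>x. norm (h y * of_real (g x) - h (?P x) * of_real (g x)) \<partial>lborel)"
    by (rule Bochner_Integration.integral_norm_bound)
  also have "\<dots> \<le> (\<integral>x. norm (h y) / 2 * g x \<partial>lborel)"
  proof (rule Bochner_Integration.integral_mono)
    show "integrable lborel (\<lambda>x. norm (h y * complex_of_real (g x) - h (?P x) * complex_of_real (g x)))"
      using i1' i2 by (intro integrable_norm Bochner_Integration.integrable_diff)
    show "integrable lborel (\<lambda>x. norm (h y) / 2 * g x)" using g(1) by simp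
    fix x
    have g0: "g x \<ge> 0" by (auto simp: g_def indicator_def bump_nonneg)
    have "norm (h y - h (?P x)) * g x \<le> norm (h y) / 2 * g x"
    proof (cases "g x = 0")
      case False
      then have "bump y e (?P x) \<noteq> 0" by (auto simp: g_def)
      then have "bump y e (?P x) > 0" using bump_nonneg[of y e "?P x"] by linarith
      then have "dist (?P x) y < d" using bump_pos_iff[OF e(1), of y "?P x"] e(3) by simp
      then have "norm (h y - h (?P x)) \<le> norm (h y) / 2"
        using d(2) by (metis dist_commute dist_norm less_imp_le)
      then show ?thesis using g0 by (rule mult_right_mono)
    qed simp
    then show "norm (h y * complex_of_real (g x) - h (?P x) * complex_of_real (g x)) \<le> norm (h y) / 2 * g x"
      using g0 by (simp add: left_diff_distrib[symmetric] norm_mult)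
  qed
  also have "\<dots> = norm (h y) / 2 * (\<integral>x. g x \<partial>lborel)" by simp
  finally show False using g(2) ne by simp
qed

text \<open>The jump of the derivative along e_i - e_j, that is sqrt 2 times the jump of the unit
  normal derivative. It collects the contributions of the directions e_i and e_j to the same
  hyperplane.\<close>

definition total_jump ::
  "'w set \<Rightarrow> ('w \<Rightarrow> complex ^ 'n::finite) \<Rightarrow> (('n \<Rightarrow> 'n \<Rightarrow> int) \<Rightarrow> 'w \<Rightarrow> complex) \<Rightarrow> 'n \<Rightarrow> 'n \<Rightarrow> real ^ 'n \<Rightarrow> complex" where
  "total_jump W \<mu> a i j y = pwsum W \<mu> (\<lambda>w. (a (side_of i j (alc y)) w - a (side_of j i (alc y)) w) * (\<mu> w $ i - \<mu> w $ j)) y"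

text \<open>Ordered pairs are grouped to i < j. The pair (j, i) at level m is the hyperplane of (i,
  j) at level - m, hence the reindexing of m.\<close>

lemma green_pairs:
  fixes \<mu> :: "'w \<Rightarrow> complex ^ 'n::{finite,linorder}"
  assumes pc: "piecewise W \<mu> a u" and \<phi>: "test_function \<phi>"
    and ev: "\<forall>w\<in>W. (\<Sum>i\<in>UNIV. (\<mu> w $ i)\<^sup>2) = E"
    and supp: "\<forall>z i. norm z \<ge> r \<longrightarrow> \<phi> z = 0 \<and> partial i \<phi> z = 0 \<and> partial i (partial i \<phi>) z = 0"
    and R: "2 * r \<le> of_int R"
  shows "(\<integral>x. laplacian \<phi> x * u x \<partial>lborel) = E * (\<integral>x. \<phi> x * u x \<partial>lborel) +
    (\<Sum>(i, j)\<in>{(i, j). i < j}. \<Sum>m\<in>{-R..R}. complex_of_real (1 / sqrt 2) *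
      (\<integral>y. total_jump W \<mu> a i j y * \<phi> y \<partial>affine_volume (hyperplane i j m)))"
    and "i \<noteq> j \<Longrightarrow> integrable (affine_volume (hyperplane i j m)) (\<lambda>y. total_jump W \<mu> a i j y * \<phi> y)"
    and "(\<lambda>y. total_jump W \<mu> a i j y * \<phi> y) \<in> borel_measurable borel"
proof -
  interpret piecewise W \<mu> a u by (rule pc)
  have tj: "total_jump W \<mu> a i j y * \<phi> y = jump i j y * \<phi> y + jump j i y * \<phi> y" for i j y
  proof -
    have "total_jump W \<mu> a i j y = jump i j y + jump j i y"
      unfolding total_jump_def jump_def pwsum_def sum.distrib[symmetric]
      by (intro sum.cong refl) (simp add: algebra_simps)
    then show ?thesis by (simp add: distrib_right)
  qed
  have \<phi>0: "norm z \<ge> r \<Longrightarrow> \<phi> z = 0" for z using supp by blast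
  note m = jump_bounded_measurable(1)[OF test_functionD(3)[OF \<phi>] \<phi>0]
  have int: "integrable (affine_volume (hyperplane i j m)) (\<lambda>y. jump p q y * \<phi> y)" if "i \<noteq> j" for i j p q m
  proof -
    obtain B where "\<And>y. norm (jump p q y * \<phi> y) \<le> B"
      using jump_bounded_measurable(2)[OF test_functionD(3)[OF \<phi>] \<phi>0] by blast
    then show ?thesis using that \<phi>0 m by (intro integrable_hyper_proj(2)[where r = r]) auto
  qed
  show "i \<noteq> j \<Longrightarrow> integrable (affine_volume (hyperplane i j m)) (\<lambda>y. total_jump W \<mu> a i j y * \<phi> y)"
    unfolding tj by (intro Bochner_Integration.integrable_add int)
  show "(\<lambda>y. total_jump W \<mu> a i j y * \<phi> y) \<in> borel_measurable borel"
    unfolding tj by (intro borel_measurable_add m)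
  define X where "X i j = (\<Sum>m\<in>{-R..R}. complex_of_real (1 / sqrt 2) *
      (\<integral>y. jump i j y * \<phi> y \<partial>affine_volume (hyperplane i j m)))" for i j
  have X': "X j i = (\<Sum>m\<in>{-R..R}. complex_of_real (1 / sqrt 2) *
      (\<integral>y. jump j i y * \<phi> y \<partial>affine_volume (hyperplane i j m)))" for i j
    unfolding X_def
    by (rule sum.reindex_bij_witness[of _ uminus uminus]) (auto simp: hyperplane_swap[of j i])
  have "X i j + X j i = (\<Sum>m\<in>{-R..R}. complex_of_real (1 / sqrt 2) *
      (\<integral>y. total_jump W \<mu> a i j y * \<phi> y \<partial>affine_volume (hyperplane i j m)))" if "i < j" for i j
  proof -
    have ne: "i \<noteq> j" using that by simp
    show ?thesis
      unfolding X'[of j i] X_def[of i j] sum.distrib[symmetric] tj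
      by (intro sum.cong refl) (simp add: Bochner_Integration.integral_add[OF int[OF ne] int[OF ne]] add_divide_distrib)
  qed
  then have "(\<Sum>i\<in>UNIV. \<Sum>j\<in>UNIV - {i}. X i j) = (\<Sum>(i, j)\<in>{(i, j). i < j}. \<Sum>m\<in>{-R..R}. complex_of_real (1 / sqrt 2) *
      (\<integral>y. total_jump W \<mu> a i j y * \<phi> y \<partial>affine_volume (hyperplane i j m)))"
    unfolding sum_off_diagonal by (intro sum.cong) auto
  then show "(\<integral>x. laplacian \<phi> x * u x \<partial>lborel) = E * (\<integral>x. \<phi> x * u x \<partial>lborel) +
    (\<Sum>(i, j)\<in>{(i, j). i < j}. \<Sum>m\<in>{-R..R}. complex_of_real (1 / sqrt 2) *
      (\<integral>y. total_jump W \<mu> a i j y * \<phi> y \<partial>affine_volume (hyperplane i j m)))"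
    using green[where r = r and E = E and R = R, OF \<phi> ev[rule_format] supp[rule_format] R] unfolding X_def by simp
qed

section \<open>Existence\<close>

text \<open>Stated for a floor table, so that a point of a hyperplane can be compared with every
  adjacent alcove.\<close>

definition in_closed_alcove :: "real ^ 'n::finite \<Rightarrow> ('n \<Rightarrow> 'n \<Rightarrow> int) \<Rightarrow> bool" where
  "in_closed_alcove x q \<longleftrightarrow> (\<forall>i j. of_int (q i j) \<le> x $ i - x $ j \<and> x $ i - x $ j \<le> of_int (q i j) + 1)"

lemma in_closed_alcove_self: "in_closed_alcove x (alc x)"
  unfolding in_closed_alcove_def alc_def by (auto intro: less_imp_le)

text \<open>Near x a floor can differ from the one at x only where the difference of coordinates is
  an integer, and there it drops by at most one.\<close>

lemma eventually_in_closed_alcove: "\<forall>\<^sub>F y in nhds x. in_closed_alcove x (alc y)"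
proof -
  have near: "\<forall>\<^sub>F s in nhds t. of_int \<lfloor>s\<rfloor> \<le> t \<and> t \<le> of_int \<lfloor>s\<rfloor> + 1" for t :: real
  proof (cases "t \<in> \<int>")
    case False
    show ?thesis using eventually_floor_nonint[OF False]
      by eventually_elim (auto intro: less_imp_le)
  next
    case True
    then obtain l where l: "t = of_int l" by (metis Ints_cases)
    have "\<forall>\<^sub>F s in nhds t. s \<in> {t - 1<..<t + 1}" by (intro eventually_nhds_in_open) auto
    then show ?thesis
    proof eventually_elim
      case (elim s)
      then have "of_int l - 1 < s" "s < of_int l + 1" using l by auto
      then have "l - 1 \<le> \<lfloor>s\<rfloor>" "\<lfloor>s\<rfloor> \<le> l" by linarith+
      then show ?case using l by linarith
    qed
  qed
  have "\<forall>\<^sub>F y in nhds x. \<forall>i j. of_int (alc y i j) \<le> x $ i - x $ j \<and> x $ i - x $ j \<le> of_int (alc y i j) + 1"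
    unfolding alc_def by (intro eventually_all_finite eventually_coordinate near)
  then show ?thesis by eventually_elim (auto simp: in_closed_alcove_def)
qed

section \<open>The fundamental alcove and its translates\<close>

lemma affine_act_reflection:
  "i \<noteq> j \<Longrightarrow> affine_act (affine_reflection i j m) x = reflect i j m x"
  by (subst affine_act_affine_reflection) (auto simp: vec_eq_iff reflect_nth axis_def field_simps)

lemma affine_act_nth: "affine_act (w, v) x $ a = x $ inv_into UNIV w a + of_int (v $ a)"
  by (simp add: affine_act_def permute_vec_def)

text \<open>In the fundamental alcove the coordinate differences lie in (0, 1) for i < j, hence in
  (-1, 0) for i > j.\<close>

definition base_floor :: "'n::linorder \<Rightarrow> 'n \<Rightarrow> int" where
  "base_floor i j = (if i \<le> j then 0 else - 1)"

lemma fundamental_alcove_iff: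
  fixes x :: "real ^ 'n::{finite,linorder}"
  shows "x \<in> fundamental_alcove \<longleftrightarrow> regular x \<and> alc x = base_floor"
proof
  assume x: "x \<in> fundamental_alcove"
  have d: "x $ i > x $ j" if "i < j" for i j using x that by (simp add: fundamental_alcove_def)
  have m: "x $ Max UNIV > x $ Min UNIV - 1" using x by (simp add: fundamental_alcove_def)
  have le: "x $ j \<le> x $ i" if "i \<le> j" for i j using d[of i j] that by (auto simp: le_less)
  have b: "0 < x $ i - x $ j \<and> x $ i - x $ j < 1" if "i < j" for i j
    using d[OF that] m le[of "Min UNIV" i] le[of j "Max UNIV"] by simp
  have f: "alc x i j = base_floor i j" for i j
  proof -
    consider "i < j" | "i = j" | "j < i" by (rule linorder_cases)
    then show ?thesis
    proof cases
      case 1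
      then show ?thesis using b[of i j] by (simp add: alc_def base_floor_def floor_eq_iff)
    next
      case 3
      then show ?thesis using b[of j i] by (simp add: alc_def base_floor_def floor_eq_iff)
    qed (simp add: base_floor_def)
  qed
  have "regular x" unfolding regular_def
  proof (intro allI impI notI)
    fix i j :: 'n assume ij: "i \<noteq> j" "x $ i - x $ j \<in> \<int>"
    then obtain l where l: "x $ i - x $ j = of_int l" by (metis Ints_cases)
    consider "i < j" | "j < i" using ij(1) by (metis linorder_neqE)
    then show False
    proof cases
      case 1
      then have "0 < real_of_int l \<and> real_of_int l < 1" using b[of i j] l by simp
      then have "0 < l" "l < 1" by simp_all
      then show False by simp
    next
      case 2
      then have "0 < real_of_int (- l) \<and> real_of_int (- l) < 1" using b[of j i] l by simp
      then have "0 < - l" "- l < 1" by (simp_all only: of_int_0_less_iff of_int_less_1_iff)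
      then show False by simp
    qed
  qed
  then show "regular x \<and> alc x = base_floor" using f by auto
next
  assume x: "regular x \<and> alc x = base_floor"
  have b: "0 < x $ i - x $ j \<and> x $ i - x $ j < 1" if "i < j" for i j
  proof -
    have "\<lfloor>x $ i - x $ j\<rfloor> = 0" using x that by (simp add: fun_eq_iff alc_def base_floor_def)
    moreover have "x $ i - x $ j \<notin> \<int>" using x that by (auto simp: regular_def)
    then have "x $ i - x $ j \<noteq> 0" by (metis Ints_0)
    ultimately show ?thesis by (auto simp: floor_eq_iff)
  qed
  have "x $ Min UNIV - 1 < x $ Max UNIV"
    using b[of "Min UNIV" "Max UNIV"] Min_le[of UNIV "Max UNIV"]
    by (cases "(Min UNIV :: 'n) = Max UNIV") (auto simp: less_le)
  then show "x \<in> fundamental_alcove" using b by (auto simp: fundamental_alcove_def)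
qed

lemma fundamental_alcove_nonempty: "(fundamental_alcove :: (real ^ 'n::{finite,linorder}) set) \<noteq> {}"
proof -
  let ?N = "real CARD('n)"
  \<comment> \<open>Equally spaced decreasing coordinates 0, -1/n, -2/n and so on.\<close>
  let ?x = "(\<chi> i. - real (card {k. k < i}) / ?N) :: (real, 'n) vec"
  have N: "?N > 0" by simp
  have "card {k. k < i} < card {k. k < j}" if "i < j" for i j :: 'n
    by (rule psubset_card_mono) (use that in auto)
  then have 1: "?x $ i > ?x $ j" if "i < j" for i j using that N by (simp add: divide_strict_right_mono)
  have "card {k. k < (Max UNIV :: 'n)} < CARD('n)"
    by (rule psubset_card_mono) auto
  then have "real (card {k. k < (Max UNIV :: 'n)}) / ?N < 1" using N by simp
  moreover have "real (card {k. k < (Min UNIV :: 'n)}) / ?N \<ge> 0" by simp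
  ultimately have "?x $ Max UNIV > ?x $ Min UNIV - 1"
    by (simp only: vec_lambda_beta minus_divide_left[symmetric])
  with 1 have "?x \<in> fundamental_alcove" by (simp add: fundamental_alcove_def)
  then show ?thesis by blast
qed

text \<open>A permutation relabels the floors, and an integral translation adds constants to
  them.\<close>

lemma affine_act_alcove:
  fixes g :: "('n::{finite,linorder} \<Rightarrow> 'n) \<times> (int ^ 'n::{finite,linorder})"
  assumes g: "g \<in> carrier affine_sym_group"
  shows "\<exists>q. \<forall>x\<in>affine_act g ` fundamental_alcove. regular x \<and> alc x = q"
proof -
  obtain w v where wv: "g = (w, v)" by (cases g)
  have w: "w permutes UNIV" using g wv by (simp add: affine_sym_group_def)
  let ?i = "inv_into UNIV w"
  have inj: "?i a \<noteq> ?i b" if "a \<noteq> b" for a b using that w by (metis permutes_inv_eq)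
  have diff: "affine_act g x $ a - affine_act g x $ b = (x $ ?i a - x $ ?i b) + of_int (v $ a - v $ b)" for x a b
    by (simp add: wv affine_act_nth)
  have "regular (affine_act g x) \<and> alc (affine_act g x) = (\<lambda>a b. base_floor (?i a) (?i b) + (v $ a - v $ b))"
    if "x \<in> fundamental_alcove" for x
  proof
    have x: "regular x" "alc x = base_floor" using that by (simp_all add: fundamental_alcove_iff)
    show "regular (affine_act g x)"
      unfolding regular_def diff
    proof (intro allI impI notI)
      fix a b :: 'n assume ab: "a \<noteq> b" "x $ ?i a - x $ ?i b + of_int (v $ a - v $ b) \<in> \<int>"
      then have "x $ ?i a - x $ ?i b + of_int (v $ a - v $ b) - of_int (v $ a - v $ b) \<in> \<int>"
        by (intro Ints_diff Ints_of_int)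
      then show False using x(1) inj[OF ab(1)] by (simp add: regular_def)
    qed
    show "alc (affine_act g x) = (\<lambda>a b. base_floor (?i a) (?i b) + (v $ a - v $ b))"
      using x(2) unfolding alc_def diff by (intro ext) (simp only: floor_add_int[symmetric] fun_eq_iff)
  qed
  then show ?thesis by (intro exI[of _ "\<lambda>a b. base_floor (?i a) (?i b) + (v $ a - v $ b)"]) auto
qed

text \<open>Cross walls towards the fundamental alcove and multiply the reflections met on the way.
  The whole alcove of x is treated at once, since one g has to serve all its points.\<close>

lemma alcove_translate:
  fixes x :: "real ^ 'n::{finite,linorder}"
  assumes "regular x"
  shows "\<exists>g\<in>carrier affine_sym_group. \<forall>z. regular z \<and> alc z = alc x \<longrightarrow> z \<in> affine_act g ` fundamental_alcove"
proof -
  obtain x0 :: "(real, 'n) vec" where x0: "x0 \<in> fundamental_alcove" using fundamental_alcove_nonempty by blast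
  then have reg0: "regular x0" and alc0: "alc x0 = base_floor" by (simp_all add: fundamental_alcove_iff)
  show ?thesis
    using assms
  proof (induction "alc_dist x x0" arbitrary: x rule: less_induct)
    case less
    show ?case
    proof (cases "alc x = alc x0")
      case True
      have one: "\<one>\<^bsub>affine_sym_group\<^esub> = (id, 0 :: (int, 'n) vec)" by (simp add: affine_sym_group_def)
      have "affine_act (\<one>\<^bsub>affine_sym_group\<^esub>) z = z" for z :: "(real, 'n) vec"
        unfolding one by (simp add: vec_eq_iff affine_act_nth inv_id)
      moreover have "\<one>\<^bsub>affine_sym_group\<^esub> \<in> carrier (affine_sym_group :: (('n \<Rightarrow> 'n) \<times> ((int, 'n) vec)) monoid)"
        using group_affine_sym_group by (intro monoid.one_closed group.is_monoid)
      ultimately show ?thesis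
        using True alc0 by (intro bexI[of _ "\<one>\<^bsub>affine_sym_group\<^esub>"]) (auto simp: fundamental_alcove_iff image_iff)
    next
      case False
      then obtain i j m where w: "wall i j m x" "x0 $ i + of_int m < x0 $ j"
        using exists_separating_wall[OF less.prems reg0] by metis
      have ij: "i \<noteq> j" using w by (simp add: wall_def)
      have "alc_dist (reflect i j m x) x0 < alc_dist x x0"
        using alc_dist_reflect[OF w(1) less.prems reg0 w(2)] by simp
      then obtain g where g: "g \<in> carrier affine_sym_group"
        "\<And>z. regular z \<Longrightarrow> alc z = alc (reflect i j m x) \<Longrightarrow> z \<in> affine_act g ` fundamental_alcove"
        using less.hyps[OF _ regular_reflect[OF ij less.prems]] by metis
      let ?s = "affine_reflection i j m"
      have "z \<in> affine_act (?s \<otimes>\<^bsub>affine_sym_group\<^esub> g) ` fundamental_alcove" if z: "regular z" "alc z = alc x" for z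
      proof -
        have wz: "wall i j m z" using wall_cong[OF z(1) less.prems z(2)] w by simp
        have "reflect i j m z \<in> affine_act g ` fundamental_alcove"
          using alc_reflect_cong[OF wz z(1) w(1) less.prems z(2)] regular_reflect[OF ij z(1)] by (intro g(2))
        then obtain p where p: "p \<in> fundamental_alcove" "reflect i j m z = affine_act g p" by blast
        have "z = affine_act (?s \<otimes>\<^bsub>affine_sym_group\<^esub> g) p"
          using ij p(2)[symmetric] by (simp add: affine_act_mult[OF affine_reflection_carrier g(1)] affine_act_reflection)
        then show ?thesis using p(1) by blast
      qed
      moreover have "?s \<otimes>\<^bsub>affine_sym_group\<^esub> g \<in> carrier affine_sym_group"
        using group_affine_sym_group affine_reflection_carrier g(1) by (intro monoid.m_closed group.is_monoid)
      ultimately show ?thesis by blast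
    qed
  qed
qed

text \<open>A value z_k + l between z_j and z_i + m, with k other than i and j, would force y_j -
  y_k < l and y_k - y_i < m - l, contradicting y_j - y_i = m.\<close>

lemma wall_of_side:
  assumes y: "y $ j - y $ i = of_int m" and ij: "i \<noteq> j" and z: "regular z" "alc z = side_of i j (alc y)"
  shows "wall i j m z" and "alc (reflect i j m z) = side_of j i (alc y)"
proof -
  have yji: "alc y j i = m" "alc y i j = - m" using y by (simp_all add: alc_def floor_eq_iff)
  have zji: "alc z j i = m - 1" using z(2) yji by (simp add: side_of_def)
  then have lt: "z $ j < z $ i + of_int m" using alc_less_iff[OF z(1) ij, of m] by simp
  have "v \<notin> vals z" if v: "z $ j < v" "v < z $ i + of_int m" for v
  proof
    assume "v \<in> vals z"
    then obtain k l where kl: "v = z $ k + of_int l" by (auto simp: vals_def)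
    have gap: "z $ i + of_int m - 1 \<le> z $ j"
      using zji unfolding alc_def by linarith
    consider "k = j" | "k = i" | "k \<noteq> i" "k \<noteq> j" by blast
    then show False
    proof cases
      case 1
      then have "0 < l" using v kl by simp
      then have "(1::real) \<le> of_int l" by linarith
      then show False using v kl gap 1 by simp
    next
      case 2
      then have "l < m" using v kl by simp
      then have "of_int l \<le> (of_int m :: real) - 1" by linarith
      then show False using v kl gap 2 by simp
    next
      case 3
      have "alc z j k < l" using alc_less_iff[OF z(1) 3(2), of l] v kl by simp
      then have 1: "alc y j k < l" using z(2) ij 3 by (simp add: side_of_def)
      have "z $ k < z $ i + of_int (m - l)" using v kl by simp
      then have "alc z k i < m - l" using alc_less_iff[OF z(1) 3(1)[symmetric], of "m - l"] by simp
      then have 2: "alc y k i < m - l" using z(2) ij 3 by (simp add: side_of_def)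
      have "y $ j - y $ k < of_int l" "y $ k - y $ i < of_int (m - l)"
        using 1 2 by (simp_all add: alc_def floor_less_iff)
      then show False using y by simp
    qed
  qed
  then show w: "wall i j m z" using lt ij by (auto simp: wall_def)
  show "alc (reflect i j m z) = side_of j i (alc y)"
    by (intro ext) (use alc_reflect[OF w z(1)] z(2) yji ij in \<open>auto simp: side_of_def\<close>)
qed

context bethe
begin

section \<open>The solution obtained by transport\<close>

lemma eigenvalue_Perms: "w \<in> Perms \<Longrightarrow> (\<Sum>i\<in>UNIV. (wl w $ i)\<^sup>2) = (\<Sum>j\<in>UNIV. (lam $ j)\<^sup>2)"
  unfolding permute_vec_def
  by (simp, rule sum.reindex_bij_betw[of "inv_into UNIV w" UNIV UNIV "\<lambda>i. (lam $ i)\<^sup>2"])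
    (simp add: permutes_inv permutes_imp_bij)

end

locale bethe_base = bethe smul \<rho> k lam
  for smul :: "complex \<Rightarrow> 'm::ab_group_add \<Rightarrow> 'm"
    and \<rho> :: "('n::{finite,linorder} \<Rightarrow> 'n) \<times> (int ^ 'n::{finite,linorder}) \<Rightarrow> 'm \<Rightarrow> 'm"
    and k :: complex
    and lam :: "complex ^ 'n::{finite,linorder}" +
  fixes x0 :: "real ^ 'n::{finite,linorder}" and mw :: "('n \<Rightarrow> 'n) \<Rightarrow> 'm"
  assumes x0: "x0 \<in> fundamental_alcove"
begin

sublocale crossing cross x0 mw
  using x0 by (intro crossing_cross) (simp add: fundamental_alcove_iff)

text \<open>A wall of y that separates it from y' contains x, since x belongs to both closed
  alcoves. Crossing it keeps x in the closure and, by \<open>pw_cross\<close>, keeps the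
  value.\<close>

lemma pw_transport_unique:
  "regular y \<Longrightarrow> regular y' \<Longrightarrow> in_closed_alcove x (alc y) \<Longrightarrow> in_closed_alcove x (alc y') \<Longrightarrow>
    pw (transport y) x = pw (transport y') x"
proof (induction "alc_dist y y'" arbitrary: y rule: less_induct)
  case less
  show ?case
  proof (cases "alc y = alc y'")
    case True
    then show ?thesis using transport_cong less.prems by metis
  next
    case False
    then obtain i j m where w: "wall i j m y" "y' $ i + of_int m < y' $ j"
      using exists_separating_wall less.prems by metis
    have ij: "i \<noteq> j" using w by (simp add: wall_def)
    have "alc y j i = m - 1" using wall_alc[OF w(1) less.prems(1)] by simp
    then have "x $ j - x $ i \<le> of_int m" using less.prems(3) unfolding in_closed_alcove_def by (metis add.commute diff_add_cancel of_int_1 of_int_add)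
    moreover have "m \<le> alc y' j i" using alc_greater_iff[OF less.prems(2) ij] w(2) by simp
    then have "of_int m \<le> x $ j - x $ i" using less.prems(4) unfolding in_closed_alcove_def by (meson of_int_le_iff order_trans)
    ultimately have x: "x $ j - x $ i = of_int m" by simp
    have "in_closed_alcove x (alc (reflect i j m y))"
      unfolding in_closed_alcove_def
    proof (intro allI)
      fix a b
      have "of_int (alc y a b) \<le> x $ a - x $ b \<and> x $ a - x $ b \<le> of_int (alc y a b) + 1"
        using less.prems(3) by (simp add: in_closed_alcove_def)
      then show "of_int (alc (reflect i j m y) a b) \<le> x $ a - x $ b \<and> x $ a - x $ b \<le> of_int (alc (reflect i j m y) a b) + 1"
        unfolding alc_reflect[OF w(1) less.prems(1)] using x by auto
    qed
    then have "pw (transport (reflect i j m y)) x = pw (transport y') x"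
      using alc_dist_reflect[OF w(1) less.prems(1,2) w(2)] less.prems regular_reflect[OF ij]
      by (intro less.hyps) auto
    then show ?thesis
      using transport_wall[OF less.prems(1) w(1)] pw_cross[OF ij x] by simp
  qed
qed

text \<open>On a hyperplane the value is taken from some adjacent alcove; that any of them will do
  is \<open>sol_eq\<close>.\<close>

definition sol :: "(real, 'n) vec \<Rightarrow> 'm" where
  "sol x = pw (transport (SOME y. regular y \<and> in_closed_alcove x (alc y))) x"

lemma sol_eq: "regular y \<Longrightarrow> in_closed_alcove x (alc y) \<Longrightarrow> sol x = pw (transport y) x"
  unfolding sol_def by (rule someI2[of _ y]) (auto intro: pw_transport_unique)

lemma sol_regular: "regular x \<Longrightarrow> sol x = pw (transport x) x"
  by (intro sol_eq in_closed_alcove_self)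

text \<open>Finitely many closed alcoves cover a neighbourhood of x, and on each of them
  \<open>sol\<close> is one sum of plane waves; continuous pieces on closed sets are pasted.\<close>

lemma functional_sol_continuous:
  fixes x :: "(real, 'n) vec"
  obtains U S where "open U" "x \<in> U" "finite S" "\<And>z. z \<in> U \<Longrightarrow> sol z \<in> V.span S"
    "\<And>\<psi>. functional \<psi> \<Longrightarrow> continuous_on U (\<lambda>z. \<psi> (sol z))"
proof -
  obtain U where U: "open U" "x \<in> U" "\<And>y. y \<in> U \<Longrightarrow> in_closed_alcove x (alc y)"
    using eventually_in_closed_alcove[of x] unfolding eventually_nhds by blast
  define Q where "Q = {alc y | y. y \<in> U \<and> regular y}"
  have "Q \<subseteq> {q. \<forall>i. q i \<in> {f. \<forall>j. f j \<in> {\<lfloor>- 2 * norm x\<rfloor> - 1..\<lceil>2 * norm x\<rceil>}}}"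
  proof
    fix q assume "q \<in> Q"
    then have "in_closed_alcove x q" using U by (auto simp: Q_def)
    then have "of_int (q i j) \<le> x $ i - x $ j" "x $ i - x $ j \<le> of_int (q i j) + 1" for i j
      by (auto simp: in_closed_alcove_def)
    moreover have "x $ i - x $ j \<le> 2 * norm x" "- 2 * norm x \<le> x $ i - x $ j" for i j
      using component_le_norm_cart[of x i] component_le_norm_cart[of x j] by auto
    ultimately have qb: "of_int (q i j) \<le> 2 * norm x" "- 2 * norm x \<le> of_int (q i j) + 1" for i j
      using order_trans by blast+
    have "q i j \<le> \<lceil>2 * norm x\<rceil> \<and> \<lfloor>- 2 * norm x\<rfloor> - 1 \<le> q i j" for i j
      using qb[of i j] by linarith
    then show "q \<in> {q. \<forall>i. q i \<in> {f. \<forall>j. f j \<in> {\<lfloor>- 2 * norm x\<rfloor> - 1..\<lceil>2 * norm x\<rceil>}}}" by simp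
  qed
  then have finQ: "finite Q"
    by (rule finite_subset) (intro finite_functions_into finite_atLeastAtMost_int)
  define yq where "yq q = (SOME y. y \<in> U \<and> regular y \<and> alc y = q)" for q
  have yq: "yq q \<in> U" "regular (yq q)" "alc (yq q) = q" if "q \<in> Q" for q
    using that someI_ex[of "\<lambda>y. y \<in> U \<and> regular y \<and> alc y = q"] unfolding Q_def yq_def by blast+
  \<comment> \<open>By density some regular point of U is so near to z that z belongs to its closed
    alcove.\<close>
  have cover: "\<exists>q\<in>Q. in_closed_alcove z q" if z: "z \<in> U" for z
  proof -
    obtain U' where U': "open U'" "z \<in> U'" "\<And>y. y \<in> U' \<Longrightarrow> in_closed_alcove z (alc y)"
      using eventually_in_closed_alcove[of z] unfolding eventually_nhds by blast
    obtain y where "y \<in> U \<inter> U'" "regular y"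
      using regular_dense[of "U \<inter> U'"] U U' z by blast
    then show ?thesis using U'(3) by (auto simp: Q_def)
  qed
  have val: "sol z = pw (transport (yq q)) z" if "q \<in> Q" "in_closed_alcove z q" for z q
    using that yq by (intro sol_eq) auto
  define S where "S = (\<Union>q\<in>Q. transport (yq q) ` Perms)"
  have "finite S" unfolding S_def using finQ finite_Perms by blast
  moreover have "sol z \<in> V.span S" if z: "z \<in> U" for z
  proof -
    obtain q where q: "q \<in> Q" "in_closed_alcove z q" using cover[OF z] by blast
    show ?thesis unfolding val[OF q] pw_def
      using q(1) by (intro V.span_sum V.span_scale V.span_base) (auto simp: S_def)
  qed
  moreover have "continuous_on U (\<lambda>z. \<psi> (sol z))" if \<psi>: "functional \<psi>" for \<psi>
  proof -
    have "continuous_on (\<Union>q\<in>Q. {z. in_closed_alcove z q}) (\<lambda>z. \<psi> (sol z))"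
    proof (rule continuous_on_closed_Union[OF finQ])
      fix q assume q: "q \<in> Q"
      show "closed {z. in_closed_alcove z q}"
        unfolding in_closed_alcove_def
        by (intro closed_Collect_all closed_Collect_conj closed_Collect_le continuous_intros)
      have "continuous_on {z. in_closed_alcove z q} (pwsum Perms wl (\<lambda>w. \<psi> (transport (yq q) w)))"
        by (intro continuous_intros)
      then show "continuous_on {z. in_closed_alcove z q} (\<lambda>z. \<psi> (sol z))"
        by (rule continuous_on_cong[THEN iffD1, rotated 2]) (simp_all add: val[OF q] functional_pw[OF \<psi>])
    qed
    then show ?thesis by (rule continuous_on_subset) (use cover in blast)
  qed
  ultimately show thesis using that U(1,2) by blast
qed

lemma vec_continuous_sol: "vec_continuous smul sol"
proof (rule vec_continuousI)
  fix x
  show "\<exists>U S. open U \<and> x \<in> U \<and> finite S \<and> (\<forall>y\<in>U. sol y \<in> V.span S)"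
    using functional_sol_continuous[of x] by metis
next
  fix \<psi> assume \<psi>: "functional \<psi>"
  have "isCont (\<lambda>x. \<psi> (sol x)) x" for x
    using functional_sol_continuous[of x] \<psi> continuous_on_eq_continuous_at by metis
  then show "continuous_on UNIV (\<lambda>x. \<psi> (sol x))" by (simp add: continuous_at_imp_continuous_on)
qed

definition coeff :: "('n \<Rightarrow> 'n \<Rightarrow> int) \<Rightarrow> ('n \<Rightarrow> 'n) \<Rightarrow> 'm" where
  "coeff q = transport (SOME y. regular y \<and> alc y = q)"

lemma coeff_alc: "regular x \<Longrightarrow> coeff (alc x) = transport x"
  unfolding coeff_def by (rule someI2[of _ x]) (auto intro: transport_cong)

text \<open>\<open>cross\<close> leads from the side x_j - x_i < m to the other one, whereas
  \<open>total_jump\<close> subtracts in the opposite order; hence the minus sign against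
  \<open>jump_cross\<close>.\<close>

lemma jump_sol:
  assumes \<psi>: "functional \<psi>" and semi: "semiregular i j y" and y: "y $ j - y $ i = of_int m"
  shows "total_jump Perms wl (\<lambda>q w. \<psi> (coeff q w)) i j y = - k * \<psi> (\<rho>s i j m (sol y))"
proof -
  have ij: "i \<noteq> j" using semi by (simp add: semiregular_def)
  obtain d where d: "d > 0" "\<And>t. \<bar>t\<bar> < d \<Longrightarrow> in_closed_alcove y (alc (y + t *\<^sub>R axis i 1)) \<and>
      (t > 0 \<longrightarrow> regular (y + t *\<^sub>R axis i 1) \<and> alc (y + t *\<^sub>R axis i 1) = side_of i j (alc y))"
  proof -
    have "\<forall>\<^sub>F z in nhds y. in_closed_alcove y (alc z) \<and>
       (z $ i - z $ j > y $ i - y $ j \<longrightarrow> regular z \<and> alc z = side_of i j (alc y))"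
      using eventually_in_closed_alcove[of y] eventually_side[OF semi] by eventually_elim blast
    then have "\<forall>\<^sub>F z in nhds (y + 0 *\<^sub>R axis i 1). in_closed_alcove y (alc z) \<and>
       (z $ i - z $ j > y $ i - y $ j \<longrightarrow> regular z \<and> alc z = side_of i j (alc y))" by simp
    from eventually_line[OF this] have "\<forall>\<^sub>F t in nhds 0. in_closed_alcove y (alc (y + t *\<^sub>R axis i 1)) \<and>
       (t > 0 \<longrightarrow> regular (y + t *\<^sub>R axis i 1) \<and> alc (y + t *\<^sub>R axis i 1) = side_of i j (alc y))"
      using ij by (simp add: axis_def)
    then show thesis using that unfolding eventually_nhds_metric by (auto simp: dist_real_def)
  qed
  \<comment> \<open>A small step along e_i enters the side x_j - x_i < m.\<close>
  define z where "z = y + (d / 2) *\<^sub>R axis i 1"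
  have z: "regular z" "alc z = side_of i j (alc y)" "in_closed_alcove y (alc z)"
    using d(2)[of "d / 2"] d(1) by (auto simp: z_def)
  note w = wall_of_side[OF y ij z(1,2)]
  have c1: "coeff (side_of i j (alc y)) = transport z" using coeff_alc[OF z(1)] z(2) by simp
  have c2: "coeff (side_of j i (alc y)) = cross i j m (transport z)"
    using coeff_alc[OF regular_reflect[OF ij z(1)], of m] w(2) transport_wall[OF z(1) w(1)] by simp
  have "total_jump Perms wl (\<lambda>q w. \<psi> (coeff q w)) i j y =
    - \<psi> (\<Sum>w\<in>Perms. smul ((wl w $ i - wl w $ j) * plane_wave (wl w) y) (cross i j m (transport z) w - transport z w))"
    unfolding total_jump_def c1 c2 pwsum_def functional_simps[OF \<psi>] sum_negf[symmetric]
    by (intro sum.cong refl) (simp add: algebra_simps)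
  also have "\<dots> = - k * \<psi> (\<rho>s i j m (pw (transport z) y))"
    unfolding jump_cross[OF ij y] by (simp add: functional_simps[OF \<psi>])
  also have "pw (transport z) y = sol y" using sol_eq[OF z(1,3)] by simp
  finally show ?thesis .
qed

text \<open>In Green's formula the jump at almost every point of a hyperplane is - k
  \<psi>(\<rho>(s) f), which cancels the interaction term of the weak equation.\<close>

lemma weak_sol: "weak_eigenfunction smul \<rho> k (- (\<Sum>j\<in>UNIV. (lam $ j)\<^sup>2)) sol"
  unfolding weak_eigenfunction_def
proof (intro allI impI)
  fix \<phi> :: "(real, 'n) vec \<Rightarrow> complex" assume \<phi>: "test_function \<phi>"
  obtain r where supp: "\<And>x i. norm x \<ge> r \<Longrightarrow> \<phi> x = 0 \<and> partial i \<phi> x = 0 \<and> partial i (partial i \<phi>) x = 0"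
    using test_function_support[OF \<phi>] by metis
  define R where "R = \<lceil>2 * r\<rceil>"
  have R: "2 * r \<le> of_int R" by (simp add: R_def)
  have \<phi>0: "norm x \<ge> r \<Longrightarrow> \<phi> x = 0" for x using supp by blast
  have "weak_defect \<phi> R (- (\<Sum>j\<in>UNIV. (lam $ j)\<^sup>2)) sol \<psi> = 0" if \<psi>: "functional \<psi>" for \<psi>
  proof -
    let ?a = "\<lambda>q w. \<psi> (coeff q w)" and ?u = "\<lambda>x. \<psi> (sol x)"
    have pc: "piecewise Perms wl ?a ?u"
      by unfold_locales (simp_all add: vec_continuous_functional[OF vec_continuous_sol \<psi>] sol_regular coeff_alc functional_pw[OF \<psi>])
    have ev: "\<forall>w\<in>Perms. (\<Sum>i\<in>UNIV. (wl w $ i)\<^sup>2) = (\<Sum>j\<in>UNIV. (lam $ j)\<^sup>2)"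
      using eigenvalue_Perms by blast
    have supp': "\<forall>z i. norm z \<ge> r \<longrightarrow> \<phi> z = 0 \<and> partial i \<phi> z = 0 \<and> partial i (partial i \<phi>) z = 0"
      using supp by blast
    note g = green_pairs[OF pc \<phi> ev supp' R]
    have "(\<integral>y. total_jump Perms wl ?a i j y * \<phi> y \<partial>affine_volume (hyperplane i j m)) +
        k * (\<integral>x. \<phi> x * \<psi> (\<rho>s i j m (sol x)) \<partial>affine_volume (hyperplane i j m)) = 0" if ij: "i \<noteq> j" for i j m
    proof -
      have c: "continuous_on UNIV (\<lambda>x. \<phi> x * \<psi> (\<rho>s i j m (sol x)))"
        by (intro continuous_intros test_functionD(3)[OF \<phi>] vec_continuous_functional[OF vec_continuous_\<rho>s[OF vec_continuous_sol] \<psi>])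
      have i2: "integrable (affine_volume (hyperplane i j m)) (\<lambda>x. \<phi> x * \<psi> (\<rho>s i j m (sol x)))"
        using \<phi>0 by (intro continuous_compact_support(4)[OF c _ ij]) auto
      have "(\<integral>y. total_jump Perms wl ?a i j y * \<phi> y + k * (\<phi> y * \<psi> (\<rho>s i j m (sol y))) \<partial>affine_volume (hyperplane i j m)) = 0"
      proof (rule integral_hyperplane_zero[OF ij])
        show "(\<lambda>y. total_jump Perms wl ?a i j y * \<phi> y + k * (\<phi> y * \<psi> (\<rho>s i j m (sol y)))) \<in> borel_measurable borel"
          by (intro borel_measurable_add g(3) borel_measurable_times[OF borel_measurable_const] borel_measurable_continuous_onI c)
      qed (simp add: jump_sol[OF \<psi>] hyperplane_def)
      then show ?thesis using g(2)[OF ij] i2 by simp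
    qed
    then have "(\<integral>y. total_jump Perms wl ?a i j y * \<phi> y \<partial>affine_volume (hyperplane i j m)) =
        - k * (\<integral>x. \<phi> x * \<psi> (\<rho>s i j m (sol x)) \<partial>affine_volume (hyperplane i j m))" if "i < j" for i j m
      using that by (simp add: eq_neg_iff_add_eq_0)
    then have "(\<Sum>(i, j)\<in>{(i, j). i < j}. \<Sum>m\<in>{-R..R}. complex_of_real (1 / sqrt 2) *
        (\<integral>y. total_jump Perms wl ?a i j y * \<phi> y \<partial>affine_volume (hyperplane i j m))) =
      - k * (\<Sum>(i, j)\<in>{(i, j). i < j}. \<Sum>m\<in>{-R..R}. complex_of_real (1 / sqrt 2) *
        (\<integral>x. \<phi> x * \<psi> (\<rho>s i j m (sol x)) \<partial>affine_volume (hyperplane i j m)))"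
      unfolding sum_distrib_left by (intro sum.cong refl) (auto simp: sum_distrib_left sum_negf mult_ac)
    then show ?thesis unfolding weak_defect_def g(1) by simp
  qed
  then show "- vec_integral smul lborel (\<lambda>x. smul (laplacian \<phi> x) (sol x))
      - smul k (\<Sum>(i, j)\<in>{(i, j). i < j}. Sum_any (\<lambda>m.
          smul (of_real (1 / sqrt 2)) (vec_integral smul (affine_volume (hyperplane i j m)) (\<lambda>x. smul (\<phi> x) (\<rho>s i j m (sol x))))))
      = smul (- (\<Sum>j\<in>UNIV. (lam $ j)\<^sup>2)) (vec_integral smul lborel (\<lambda>x. smul (\<phi> x) (sol x)))"
    using weak_functional[OF vec_continuous_sol \<phi> supp R] by blast
qed

end

section \<open>Uniqueness\<close>

text \<open>Move x_j and x_i + m to their midpoint. They are neighbours, so no other value is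
  passed, and the resulting point lies on this hyperplane only.\<close>

lemma wall_midpoint:
  assumes w: "wall i j m x" and reg: "regular x"
  obtains y where "semiregular i j y" "y $ j - y $ i = of_int m"
    "alc x = side_of i j (alc y)" "alc (reflect i j m x) = side_of j i (alc y)"
proof
  have ij: "i \<noteq> j" and lt: "x $ j < x $ i + of_int m" using w by (auto simp: wall_def)
  define s where "s = (x $ j + x $ i + of_int m) / 2"
  define y where "y = (\<chi> a. if a = i then s - of_int m else if a = j then s else x $ a)"
  have y_nth: "y $ i = s - of_int m" "y $ j = s" "\<And>k. k \<noteq> i \<Longrightarrow> k \<noteq> j \<Longrightarrow> y $ k = x $ k"
    using ij by (simp_all add: y_def)
  have s: "x $ j < s" "s < x $ i + of_int m" using lt by (simp_all add: s_def)
  have cmp: "x $ k + of_int l < x $ j \<or> x $ i + of_int m < x $ k + of_int l" if "k \<noteq> i" "k \<noteq> j" for k l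
    using wall_empty[OF w, of "x $ k + of_int l"] valsI[of x k l] regular_nth'[OF reg that(2), of l 0]
      regular_nth'[OF reg that(1), of l m] by fastforce
  show yH: "y $ j - y $ i = of_int m" by (simp add: y_nth)
  have "y $ i - y $ j = of_int (- m)" by (simp add: y_nth)
  then have yint: "y $ i - y $ j \<in> \<int>" by (metis Ints_of_int)
  have nint: "s - x $ k - of_int l \<noteq> 0" if "k \<noteq> i" "k \<noteq> j" for k l
    using cmp[OF that, of l] s by auto
  have n1: "s - x $ k \<notin> \<int>" if "k \<noteq> i" "k \<noteq> j" for k
    using nint[OF that] by (metis Ints_cases cancel_comm_monoid_add_class.diff_cancel)
  have n2: "t - of_int m \<notin> \<int>" if "t \<notin> \<int>" for t :: real
    using that by (metis Ints_add Ints_of_int diff_add_cancel)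
  show "semiregular i j y"
    unfolding semiregular_def
  proof (intro conjI allI impI)
    fix a b assume ab: "a \<noteq> b" "{a, b} \<noteq> {i, j}"
    have neg: "u - v \<notin> \<int> \<Longrightarrow> v - u \<notin> \<int>" for u v :: real by (metis Ints_minus minus_diff_eq)
    have pos: "y $ a - y $ b \<notin> \<int>" if "b \<noteq> i" "b \<noteq> j" "a \<noteq> b" for a b
    proof -
      consider "a = i" | "a = j" | "a \<noteq> i" "a \<noteq> j" by blast
      then show ?thesis
      proof cases
        case 1
        then show ?thesis using n2[OF n1[OF that(1,2)]] that by (simp add: y_nth algebra_simps)
      next
        case 2
        then show ?thesis using n1[OF that(1,2)] that by (simp add: y_nth)
      next
        case 3
        then show ?thesis using reg that by (simp add: y_nth regular_def)
      qed
    qed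
    have "(b \<noteq> i \<and> b \<noteq> j) \<or> (a \<noteq> i \<and> a \<noteq> j)" using ab by auto
    then show "y $ a - y $ b \<notin> \<int>" using pos[of b a] pos[of a b] neg ab(1) by metis
  qed (use ij yint in auto)
  have fl: "\<lfloor>u\<rfloor> = \<lfloor>v\<rfloor>" if "\<And>l::int. of_int l \<le> v \<Longrightarrow> of_int l \<le> u" "\<And>l::int. v < of_int l \<Longrightarrow> u < of_int l" for u v :: real
    using that(1)[of "\<lfloor>v\<rfloor>"] that(2)[of "\<lfloor>v\<rfloor> + 1"] by (simp add: floor_eq_iff)
  have same: "alc x a b = alc y a b" if ab: "a \<noteq> b" "{a, b} \<noteq> {i, j}" for a b
  proof -
    consider "a = i" "b \<noteq> i" "b \<noteq> j" | "a = j" "b \<noteq> i" "b \<noteq> j" | "b = i" "a \<noteq> i" "a \<noteq> j"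
      | "b = j" "a \<noteq> i" "a \<noteq> j" | "a \<noteq> i" "a \<noteq> j" "b \<noteq> i" "b \<noteq> j"
      using ab by (metis insert_commute)
    then show ?thesis
    proof cases
      case 1
      have c: "x $ b + of_int l + of_int m < x $ j \<or> x $ i < x $ b + of_int l" for l
        using cmp[OF 1(2,3), of "l + m"] by (simp add: add.assoc)
      show ?thesis unfolding alc_def
      proof (rule fl)
        fix l :: int
        show "of_int l \<le> y $ a - y $ b \<Longrightarrow> of_int l \<le> x $ a - x $ b"
          using c[of l] s 1 by (simp add: y_nth; linarith)
        show "y $ a - y $ b < of_int l \<Longrightarrow> x $ a - x $ b < of_int l"
          using c[of l] s 1 by (simp add: y_nth; linarith)
      qed
    next
      case 2
      have c: "x $ b + of_int l < x $ j \<or> x $ i + of_int m < x $ b + of_int l" for l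
        using cmp[OF 2(2,3), of l] by simp
      show ?thesis unfolding alc_def
      proof (rule fl)
        fix l :: int
        show "of_int l \<le> y $ a - y $ b \<Longrightarrow> of_int l \<le> x $ a - x $ b"
          using c[of l] s 2 by (simp add: y_nth; linarith)
        show "y $ a - y $ b < of_int l \<Longrightarrow> x $ a - x $ b < of_int l"
          using c[of l] s 2 by (simp add: y_nth; linarith)
      qed
    next
      case 3
      have c: "x $ a - of_int l + of_int m < x $ j \<or> x $ i < x $ a - of_int l" for l
        using cmp[OF 3(2,3), of "m - l"] by (simp add: algebra_simps)
      show ?thesis unfolding alc_def
      proof (rule fl)
        fix l :: int
        show "of_int l \<le> y $ a - y $ b \<Longrightarrow> of_int l \<le> x $ a - x $ b"
          using c[of l] s 3 by (simp add: y_nth; linarith)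
        show "y $ a - y $ b < of_int l \<Longrightarrow> x $ a - x $ b < of_int l"
          using c[of l] s 3 by (simp add: y_nth; linarith)
      qed
    next
      case 4
      have c: "x $ a - of_int l < x $ j \<or> x $ i + of_int m < x $ a - of_int l" for l
        using cmp[OF 4(2,3), of "- l"] by simp
      show ?thesis unfolding alc_def
      proof (rule fl)
        fix l :: int
        show "of_int l \<le> y $ a - y $ b \<Longrightarrow> of_int l \<le> x $ a - x $ b"
          using c[of l] s 4 by (simp add: y_nth; linarith)
        show "y $ a - y $ b < of_int l \<Longrightarrow> x $ a - x $ b < of_int l"
          using c[of l] s 4 by (simp add: y_nth; linarith)
      qed
    qed (simp add: y_nth alc_def)
  qed
  have yij: "alc y j i = m" "alc y i j = - m" using yH by (simp_all add: alc_def floor_eq_iff)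
  note xij = wall_alc[OF w reg]
  have x: "alc x a b = side_of i j (alc y) a b" for a b
    using same[of a b] yij xij ij by (cases "a = b"; cases "{a, b} = {i, j}") (auto simp: side_of_def doubleton_eq_iff)
  then show x': "alc x = side_of i j (alc y)" by (intro ext)
  show "alc (reflect i j m x) = side_of j i (alc y)"
    by (rule wall_of_side(2)[OF yH ij reg x'])
qed

context bethe
begin

text \<open>If two solutions agree on one side of a wall, Green's formula with bump functions concentrated
  at the wall shows that the normal derivative of the difference does not jump, and a combination of
  plane waves with vanishing Cauchy data on the wall is zero.\<close>

lemma vanish_across:
  fixes f f' :: "(real, 'n) vec \<Rightarrow> 'm"
  assumes f: "vec_continuous smul f" "weak_eigenfunction smul \<rho> k (- (\<Sum>j\<in>UNIV. (lam $ j)\<^sup>2)) f"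
      "\<And>x. regular x \<Longrightarrow> f x = pw (A (alc x)) x"
    and f': "vec_continuous smul f'" "weak_eigenfunction smul \<rho> k (- (\<Sum>j\<in>UNIV. (lam $ j)\<^sup>2)) f'"
      "\<And>x. regular x \<Longrightarrow> f' x = pw (A' (alc x)) x"
    and w: "wall i j m x" and reg: "regular x"
    and agree: "\<And>z. regular z \<Longrightarrow> alc z = alc (reflect i j m x) \<Longrightarrow> f z = f' z"
    and z0: "regular z0" "alc z0 = alc x"
  shows "f z0 = f' z0"
proof (rule functional_eqI)
  fix \<psi> assume \<psi>: "functional \<psi>"
  have ij: "i \<noteq> j" using w by (simp add: wall_def)
  obtain y where semi: "semiregular i j y" and yH: "y $ j - y $ i = of_int m"
    and lo: "alc x = side_of i j (alc y)" and hi: "alc (reflect i j m x) = side_of j i (alc y)"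
    using wall_midpoint[OF w reg] by blast
  obtain \<delta> where \<delta>: "\<delta> > 0" and near: "\<And>z. dist z y < \<delta> \<Longrightarrow>
      (z $ i - z $ j > y $ i - y $ j \<longrightarrow> regular z \<and> alc z = alc x) \<and>
      (z $ i - z $ j < y $ i - y $ j \<longrightarrow> regular z \<and> alc z = alc (reflect i j m x)) \<and>
      (z $ i - z $ j = y $ i - y $ j \<longrightarrow> semiregular i j z \<and> alc z = alc y)"
    using eventually_side[OF semi] unfolding eventually_nhds_metric lo hi by blast
  let ?E = "\<Sum>j\<in>UNIV. (lam $ j)\<^sup>2"
  \<comment> \<open>On alcoves where f and f' agree the coefficients of the difference are set to
    zero, so that \<open>A\<close> and \<open>A'\<close> need not be compared there.\<close>
  define a where "a \<psi> q w = (if \<forall>z. regular z \<and> alc z = q \<longrightarrow> f z = f' z then 0 else \<psi> (A q w) - \<psi> (A' q w))" for \<psi> :: "'m \<Rightarrow> complex" and q w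
  define u where "u \<psi> z = \<psi> (f z) - \<psi> (f' z)" for \<psi> :: "'m \<Rightarrow> complex" and z
  have pc: "piecewise Perms wl (a \<psi>) (u \<psi>)" if \<psi>: "functional \<psi>" for \<psi>
  proof unfold_locales
    show "continuous_on UNIV (u \<psi>)" unfolding u_def[abs_def]
      by (intro continuous_intros vec_continuous_functional[OF f(1) \<psi>] vec_continuous_functional[OF f'(1) \<psi>])
    fix z :: "(real, 'n) vec" assume z: "regular z"
    show "u \<psi> z = pwsum Perms wl (a \<psi> (alc z)) z"
    proof (cases "\<forall>z'. regular z' \<and> alc z' = alc z \<longrightarrow> f z' = f' z'")
      case True
      then have "f z = f' z" using z by blast
      then show ?thesis using True by (simp add: u_def a_def pwsum_def)
    next
      case False
      then have "a \<psi> (alc z) = (\<lambda>w. \<psi> (A (alc z) w) - \<psi> (A' (alc z) w))" unfolding a_def by (simp only: if_False)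
      then show ?thesis
        by (simp add: u_def f(3)[OF z] f'(3)[OF z] functional_pw[OF \<psi>] pwsum_def sum_subtractf left_diff_distrib)
    qed
  qed
  have uc: "continuous_on UNIV (u \<psi>)" if "functional \<psi>" for \<psi>
    using piecewise.u_cont[OF pc[OF that]] .
  have a_hi: "a \<psi> (alc (reflect i j m x)) w = 0" for \<psi> w using agree by (simp add: a_def)
  have aj: "axis i (1::real) $ j = 0" "axis i (1::real) $ i = 1" using ij by (simp_all add: axis_def)
  have line: "((\<lambda>t. u \<psi> (z + t *\<^sub>R axis i 1)) \<longlongrightarrow> u \<psi> z) (at 0 within S)" if "functional \<psi>" for \<psi> z and S :: "real set"
  proof -
    have "continuous_on UNIV (\<lambda>t. u \<psi> (z + t *\<^sub>R axis i 1))"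
      by (rule continuous_on_compose2[OF uc[OF that]]) (auto intro!: continuous_intros)
    then have "isCont (\<lambda>t. u \<psi> (z + t *\<^sub>R axis i 1)) 0" by (simp add: continuous_on_eq_continuous_at)
    then show ?thesis unfolding isCont_def by (auto intro: tendsto_within_subset[OF _ subset_UNIV])
  qed
  have nearline: "\<forall>\<^sub>F t in nhds 0. dist (z + t *\<^sub>R axis i 1) y < \<delta>" if z: "dist z y < \<delta>" for z
  proof -
    have "\<forall>\<^sub>F z' in nhds (z + 0 *\<^sub>R axis i 1). z' \<in> ball y \<delta>"
      using z by (intro eventually_nhds_in_open) (auto simp: dist_commute)
    from eventually_line[OF this] show ?thesis by (simp add: dist_commute)
  qed
  \<comment> \<open>By continuity along e_i, coming from the side where the two solutions
    agree.\<close>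
  have wallzero: "f z = f' z" if z: "z $ j - z $ i = of_int m" "dist z y < \<delta>" for z
  proof (rule functional_eqI)
    fix \<psi> assume \<psi>: "functional \<psi>"
    have "\<forall>\<^sub>F t in at_left 0. u \<psi> (z + t *\<^sub>R axis i 1) = 0"
    proof -
      have "\<forall>\<^sub>F t in at_left 0. dist (z + t *\<^sub>R axis i 1) y < \<delta> \<and> t < 0"
        using nearline[OF z(2)] by (auto simp: eventually_at_filter elim: eventually_mono)
      then show ?thesis
      proof eventually_elim
        case (elim t)
        have "(z + t *\<^sub>R axis i 1) $ i - (z + t *\<^sub>R axis i 1) $ j < y $ i - y $ j"
          using elim z(1) yH aj by simp
        then have "regular (z + t *\<^sub>R axis i 1)" "alc (z + t *\<^sub>R axis i 1) = alc (reflect i j m x)"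
          using near elim by blast+
        then show ?case using agree by (simp add: u_def)
      qed
    qed
    then have "((\<lambda>t. u \<psi> (z + t *\<^sub>R axis i 1)) \<longlongrightarrow> 0) (at_left 0)" by (rule tendsto_eventually)
    then have "u \<psi> z = 0" using line[OF \<psi>] by (intro tendsto_unique[OF trivial_limit_at_left_real]) auto
    then show "\<psi> (f z) = \<psi> (f' z)" by (simp add: u_def)
  qed
  \<comment> \<open>Coming from the other side, the limit is the wave sum belonging to the alcove of
    x.\<close>
  have val: "(\<Sum>w\<in>Perms. a \<psi> (alc x) w * plane_wave (wl w) z) = 0"
    if z: "z $ j - z $ i = of_int m" "dist z y < \<delta>" for z
  proof -
    have "\<forall>\<^sub>F t in at_right 0. u \<psi> (z + t *\<^sub>R axis i 1) = pwsum Perms wl (a \<psi> (alc x)) (z + t *\<^sub>R axis i 1)"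
    proof -
      have "\<forall>\<^sub>F t in at_right 0. dist (z + t *\<^sub>R axis i 1) y < \<delta> \<and> 0 < t"
        using nearline[OF z(2)] by (auto simp: eventually_at_filter elim: eventually_mono)
      then show ?thesis
      proof eventually_elim
        case (elim t)
        have "(z + t *\<^sub>R axis i 1) $ i - (z + t *\<^sub>R axis i 1) $ j > y $ i - y $ j"
          using elim z(1) yH aj by simp
        then have "regular (z + t *\<^sub>R axis i 1)" "alc (z + t *\<^sub>R axis i 1) = alc x"
          using near elim by blast+
        then show ?case using piecewise.u_eq[OF pc[OF \<psi>]] by metis
      qed
    qed
    moreover have "isCont (\<lambda>t. pwsum Perms wl (a \<psi> (alc x)) (z + t *\<^sub>R axis i 1)) 0"
      using pwsum_line_deriv has_vector_derivative_continuous by blast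
    then have "((\<lambda>t. pwsum Perms wl (a \<psi> (alc x)) (z + t *\<^sub>R axis i 1)) \<longlongrightarrow> pwsum Perms wl (a \<psi> (alc x)) z) (at_right 0)"
      unfolding isCont_def by (auto intro: tendsto_within_subset[OF _ subset_UNIV])
    ultimately have "((\<lambda>t. u \<psi> (z + t *\<^sub>R axis i 1)) \<longlongrightarrow> pwsum Perms wl (a \<psi> (alc x)) z) (at_right 0)"
      by (rule tendsto_cong[THEN iffD2])
    then have "u \<psi> z = pwsum Perms wl (a \<psi> (alc x)) z"
      using line[OF \<psi>] by (intro tendsto_unique[OF trivial_limit_at_right_real]) auto
    moreover have "u \<psi> z = 0" using wallzero[OF z] by (simp add: u_def)
    ultimately show ?thesis by (simp add: pwsum_def)
  qed
  have der: "(\<Sum>w\<in>Perms. a \<psi> (alc x) w * (wl w $ i - wl w $ j) * plane_wave (wl w) z) = 0"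
    if z: "z $ j - z $ i = of_int m" "dist z y < \<delta>" for z
  proof -
    \<comment> \<open>Near y this is the whole jump of the derivative along e_i - e_j, because the
      coefficients behind the wall are zero.\<close>
    define h where "h = pwsum Perms wl (\<lambda>w. a \<psi> (alc x) w * (wl w $ i - wl w $ j))"
    \<comment> \<open>Bumps at z of radius below e0 stay in the ball around y that meets no other
      hyperplane.\<close>
    define e0 where "e0 = \<delta> - dist z y"
    have "h z = 0"
    proof (rule zero_by_bumps[OF ij, where ?e0.0 = e0 and m = m])
      show "z \<in> hyperplane i j m" using z by (simp add: hyperplane_def)
      show "e0 > 0" using z by (simp add: e0_def)
      show "continuous_on UNIV h" unfolding h_def by (intro continuous_intros)
      fix e assume e: "0 < e" "e < e0"
      define \<phi> where "\<phi> v = complex_of_real (bump z e v)" for v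
      have \<phi>: "test_function \<phi>" unfolding \<phi>_def[abs_def] by (rule test_function_bump[OF e(1)])
      have \<phi>near: "dist v y < \<delta>" if "\<phi> v \<noteq> 0" for v
      proof -
        have "bump z e v > 0" using that bump_nonneg[of z e v] by (simp add: \<phi>_def)
        then have "dist v z < e" by (simp add: bump_pos_iff[OF e(1)])
        then show ?thesis using e(2) dist_triangle[of v y z] by (simp add: e0_def)
      qed
      have \<phi>z: "\<phi> z \<noteq> 0" using bump_pos_iff[OF e(1), of z z] e(1) by (simp add: \<phi>_def)
      obtain r where supp: "\<And>x i. norm x \<ge> r \<Longrightarrow> \<phi> x = 0 \<and> partial i \<phi> x = 0 \<and> partial i (partial i \<phi>) x = 0"
        using test_function_support[OF \<phi>] by metis
      have supp': "\<forall>z i. norm z \<ge> r \<longrightarrow> \<phi> z = 0 \<and> partial i \<phi> z = 0 \<and> partial i (partial i \<phi>) z = 0"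
        using supp by blast
      have \<phi>0: "norm x \<ge> r \<Longrightarrow> \<phi> x = 0" for x using supp by blast
      define R where "R = \<lceil>2 * r\<rceil>"
      have R: "2 * r \<le> of_int R" by (simp add: R_def)
      have zr: "norm z < r" using \<phi>0[of z] \<phi>z by (meson not_le)
      have mR: "m \<in> {-R..R}"
      proof -
        have "\<bar>of_int m :: real\<bar> \<le> 2 * norm z"
          using z(1) component_le_norm_cart[of z i] component_le_norm_cart[of z j] by auto
        then have "\<bar>of_int m :: real\<bar> \<le> of_int R" using zr R by simp
        then show ?thesis by auto
      qed
      have ev: "\<forall>w\<in>Perms. (\<Sum>i\<in>UNIV. (wl w $ i)\<^sup>2) = ?E" using eigenvalue_Perms by blast
      note g = green_pairs[OF pc[OF \<psi>] \<phi> ev supp' R]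
      let ?J = "\<lambda>p q v. total_jump Perms wl (a \<psi>) p q v * \<phi> v"
      have wd: "weak_defect \<phi> R (- ?E) f \<psi> = 0" "weak_defect \<phi> R (- ?E) f' \<psi> = 0"
        using f(2) f'(2) weak_functional[OF f(1) \<phi> supp R] weak_functional[OF f'(1) \<phi> supp R] \<phi> \<psi>
        unfolding weak_eigenfunction_def by blast+
      \<comment> \<open>Under the bump a point of any hyperplane lies on the wall, where f and f'
        coincide; so the interaction terms of the two equations cancel.\<close>
      have dz: "\<phi> v * \<psi> (\<rho>s p q n (f v)) - \<phi> v * \<psi> (\<rho>s p q n (f' v)) = 0"
        if v: "v \<in> hyperplane p q n" and pq: "p \<noteq> q" for v p q n
      proof (cases "\<phi> v = 0")
        case False
        note nv = near[OF \<phi>near[OF False]]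
        have "v $ p - v $ q \<in> \<int>"
          using v by (metis (mono_tags, lifting) Ints_minus Ints_of_int hyperplane_def mem_Collect_eq minus_diff_eq)
        then have "\<not> regular v" using pq by (auto simp: regular_def)
        then have "v $ i - v $ j = y $ i - y $ j" using nv by (metis linorder_neqE)
        then have "v $ j - v $ i = of_int m" using yH by simp
        then have "f v = f' v" using wallzero \<phi>near[OF False] by blast
        then show ?thesis by simp
      qed simp
      have I\<rho>: "(\<integral>v. \<phi> v * \<psi> (\<rho>s p q n (f v)) \<partial>affine_volume (hyperplane p q n)) =
          (\<integral>v. \<phi> v * \<psi> (\<rho>s p q n (f' v)) \<partial>affine_volume (hyperplane p q n))" if pq: "p < q" for p q n
      proof -
        have ne: "p \<noteq> q" using pq by simp
        have c: "continuous_on UNIV (\<lambda>v. \<phi> v * \<psi> (\<rho>s p q n (F v)))"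
          if "vec_continuous smul F" for F :: "(real, 'n) vec \<Rightarrow> 'm"
          by (intro continuous_intros test_functionD(3)[OF \<phi>] vec_continuous_functional[OF vec_continuous_\<rho>s[OF that] \<psi>])
        have int: "integrable (affine_volume (hyperplane p q n)) (\<lambda>v. \<phi> v * \<psi> (\<rho>s p q n (F v)))"
          if "vec_continuous smul F" for F :: "(real, 'n) vec \<Rightarrow> 'm"
          using \<phi>0 by (intro continuous_compact_support(4)[OF c[OF that] _ ne]) auto
        have "(\<integral>v. \<phi> v * \<psi> (\<rho>s p q n (f v)) - \<phi> v * \<psi> (\<rho>s p q n (f' v)) \<partial>affine_volume (hyperplane p q n)) = 0"
          by (rule integral_hyperplane_zero[OF ne])
            (use dz ne in \<open>auto intro!: borel_measurable_continuous_onI continuous_on_diff c f(1) f'(1)\<close>)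
        then show ?thesis using int[OF f(1)] int[OF f'(1)] by simp
      qed
      have int: "integrable lborel (\<lambda>v. h' v * \<psi> (F v))"
        if "vec_continuous smul F" "continuous_on UNIV h'" "\<And>v. norm v \<ge> r \<Longrightarrow> h' v = 0" for F :: "(real, 'n) vec \<Rightarrow> 'm" and h'
        by (rule continuous_compact_support(3)[where r = r])
          (use that vec_continuous_functional[OF that(1) \<psi>] in \<open>auto intro!: continuous_intros\<close>)
      have lap0: "norm v \<ge> r \<Longrightarrow> laplacian \<phi> v = 0" for v using supp by (simp add: laplacian_def)
      note cs = test_functionD[OF \<phi>]
      have "(\<integral>v. laplacian \<phi> v * u \<psi> v \<partial>lborel) - ?E * (\<integral>v. \<phi> v * u \<psi> v \<partial>lborel) = 0"
      proof -
        have A: "(\<integral>v. laplacian \<phi> v * u \<psi> v \<partial>lborel) = (\<integral>v. laplacian \<phi> v * \<psi> (f v) \<partial>lborel) - (\<integral>v. laplacian \<phi> v * \<psi> (f' v) \<partial>lborel)"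
          unfolding u_def right_diff_distrib
          by (rule Bochner_Integration.integral_diff) (intro int f f' cs lap0; assumption)+
        have B: "(\<integral>v. \<phi> v * u \<psi> v \<partial>lborel) = (\<integral>v. \<phi> v * \<psi> (f v) \<partial>lborel) - (\<integral>v. \<phi> v * \<psi> (f' v) \<partial>lborel)"
          unfolding u_def right_diff_distrib
          by (rule Bochner_Integration.integral_diff) (intro int f f' cs \<phi>0; assumption)+
        have S: "(\<Sum>(p, q)\<in>{(p, q). p < q}. \<Sum>n\<in>{-R..R}. complex_of_real (1 / sqrt 2) *
              (\<integral>v. \<phi> v * \<psi> (\<rho>s p q n (f v)) \<partial>affine_volume (hyperplane p q n))) =
            (\<Sum>(p, q)\<in>{(p, q). p < q}. \<Sum>n\<in>{-R..R}. complex_of_real (1 / sqrt 2) *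
              (\<integral>v. \<phi> v * \<psi> (\<rho>s p q n (f' v)) \<partial>affine_volume (hyperplane p q n)))"
          by (intro sum.cong refl) (auto simp: I\<rho>)
        have "weak_defect \<phi> R (- ?E) f \<psi> - weak_defect \<phi> R (- ?E) f' \<psi> =
            (\<integral>v. laplacian \<phi> v * u \<psi> v \<partial>lborel) - ?E * (\<integral>v. \<phi> v * u \<psi> v \<partial>lborel)"
          unfolding weak_defect_def S A B by (simp add: algebra_simps)
        then show ?thesis using wd by simp
      qed
      then have sum0: "(\<Sum>(p, q)\<in>{(p, q). p < q}. \<Sum>n\<in>{-R..R}. complex_of_real (1 / sqrt 2) *
          (\<integral>v. ?J p q v \<partial>affine_volume (hyperplane p q n))) = 0"
        unfolding g(1) by simp
      \<comment> \<open>The sum runs over pairs with p < q, so the wall is renamed accordingly;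
        reversing the pair negates the level.\<close>
      define p q n where "p = min i j" and "q = max i j" and "n = (if i < j then m else - m)"
      have pq: "p < q" "{p, q} = {i, j}" using ij by (auto simp: p_def q_def min_def max_def)
      have Heq: "hyperplane p q n = hyperplane i j m"
        using ij by (auto simp: p_def q_def n_def hyperplane_swap[of j i])
      have nR: "n \<in> {-R..R}" using mR by (auto simp: n_def)
      \<comment> \<open>A point of another hyperplane under the bump would also lie on the wall,
        hence on two hyperplanes.\<close>
      have other: "(\<integral>v. ?J p' q' v \<partial>affine_volume (hyperplane p' q' n')) = 0"
        if p'q': "p' < q'" and ne: "(p', q', n') \<noteq> (p, q, n)" for p' q' n'
      proof (rule integral_hyperplane_zero)
        show "p' \<noteq> q'" using p'q' by simp
        fix v assume v: "v \<in> hyperplane p' q' n'" "semiregular p' q' v"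
        show "?J p' q' v = 0"
        proof (rule ccontr)
          assume "?J p' q' v \<noteq> 0"
          then have nz: "\<phi> v \<noteq> 0" by auto
          have "v $ p' - v $ q' \<in> \<int>" using v(2) by (simp add: semiregular_def)
          then have "\<not> regular v" using less_imp_neq[OF p'q'] unfolding regular_def by blast
          then have eq: "v $ i - v $ j = y $ i - y $ j" using near[OF \<phi>near[OF nz]] by (blast dest: linorder_neqE intro: ccontr)
          then have "semiregular i j v" using near[OF \<phi>near[OF nz]] by blast
          then have "{p', q'} = {i, j}" using v(2) p'q' by (auto simp: semiregular_def)
          then have "p' = p \<and> q' = q" using pq p'q' by (auto simp: doubleton_eq_iff)
          moreover have "v \<in> hyperplane p q n" unfolding Heq using eq yH by (simp add: hyperplane_def)
          then have "n' = n" using v(1) calculation by (simp add: hyperplane_def)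
          ultimately show False using ne by simp
        qed
      qed (rule g(3))
      have inner: "(\<Sum>n'\<in>{-R..R}. complex_of_real (1 / sqrt 2) * (\<integral>v. ?J p' q' v \<partial>affine_volume (hyperplane p' q' n'))) =
          (if (p', q') = (p, q) then complex_of_real (1 / sqrt 2) * (\<integral>v. ?J p q v \<partial>affine_volume (hyperplane p q n)) else 0)"
        if "p' < q'" for p' q'
      proof (cases "(p', q') = (p, q)")
        case True
        have "(\<Sum>n'\<in>{-R..R}. complex_of_real (1 / sqrt 2) * (\<integral>v. ?J p q v \<partial>affine_volume (hyperplane p q n'))) =
          (\<Sum>n'\<in>{-R..R}. if n' = n then complex_of_real (1 / sqrt 2) * (\<integral>v. ?J p q v \<partial>affine_volume (hyperplane p q n)) else 0)"
          by (intro sum.cong refl) (auto simp: other[OF pq(1)])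
        then show ?thesis using True nR by simp
      next
        case False
        then have "(\<integral>v. ?J p' q' v \<partial>affine_volume (hyperplane p' q' n')) = 0" for n'
          using that by (intro other) auto
        then show ?thesis using False by auto
      qed
      have "(\<Sum>(p', q')\<in>{(p, q). p < q}. \<Sum>n'\<in>{-R..R}. complex_of_real (1 / sqrt 2) *
          (\<integral>v. ?J p' q' v \<partial>affine_volume (hyperplane p' q' n'))) =
        (\<Sum>P\<in>{(p, q). p < q}. if P = (p, q) then complex_of_real (1 / sqrt 2) * (\<integral>v. ?J p q v \<partial>affine_volume (hyperplane p q n)) else 0)"
      proof (intro sum.cong refl)
        fix P :: "'n \<times> 'n" assume "P \<in> {(p, q). p < q}"
        then obtain p' q' where P: "P = (p', q')" "p' < q'" by blast
        show "(case P of (p', q') \<Rightarrow> \<Sum>n'\<in>{-R..R}. complex_of_real (1 / sqrt 2) *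
            (\<integral>v. ?J p' q' v \<partial>affine_volume (hyperplane p' q' n'))) =
          (if P = (p, q) then complex_of_real (1 / sqrt 2) * (\<integral>v. ?J p q v \<partial>affine_volume (hyperplane p q n)) else 0)"
          unfolding P(1) by (simp only: case_prod_conv inner[OF P(2)])
      qed
      also have "\<dots> = complex_of_real (1 / sqrt 2) * (\<integral>v. ?J p q v \<partial>affine_volume (hyperplane p q n))"
        using pq(1) by (subst sum.delta) auto
      finally have "(\<integral>v. ?J p q v \<partial>affine_volume (hyperplane i j m)) = 0" using sum0 by (simp add: Heq)
      moreover have "total_jump Perms wl (a \<psi>) p q v = total_jump Perms wl (a \<psi>) i j v" for v
      proof (cases "i < j")
        case False
        then have "p = j" "q = i" using ij by (auto simp: p_def q_def)
        then show ?thesis by (simp add: total_jump_def pwsum_def algebra_simps)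
      qed (simp add: p_def q_def)
      ultimately have J0: "(\<integral>v. ?J i j v \<partial>affine_volume (hyperplane i j m)) = 0" by simp
      have hc: "continuous_on UNIV (\<lambda>v. h v * \<phi> v)" unfolding h_def by (intro continuous_intros cs)
      have "(\<integral>v. ?J i j v - h v * \<phi> v \<partial>affine_volume (hyperplane i j m)) = 0"
      proof (rule integral_hyperplane_zero[OF ij])
        show "(\<lambda>v. ?J i j v - h v * \<phi> v) \<in> borel_measurable borel"
          by (intro borel_measurable_diff g(3) borel_measurable_continuous_onI hc)
        fix v assume v: "v \<in> hyperplane i j m"
        show "?J i j v - h v * \<phi> v = 0"
        proof (cases "\<phi> v = 0")
          case False
          have "v $ i - v $ j = y $ i - y $ j" using v yH by (simp add: hyperplane_def)
          then have "alc v = alc y" using near[OF \<phi>near[OF False]] by blast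
          then have "total_jump Perms wl (a \<psi>) i j v = h v"
            by (simp add: total_jump_def h_def lo[symmetric] hi[symmetric] a_hi)
          then show ?thesis by simp
        qed simp
      qed
      moreover have "integrable (affine_volume (hyperplane i j m)) (\<lambda>v. h v * \<phi> v)"
        using \<phi>0 by (intro continuous_compact_support(4)[OF hc _ ij]) auto
      ultimately have "(\<integral>v. h v * \<phi> v \<partial>affine_volume (hyperplane i j m)) = 0"
        using g(2)[OF ij, of m] J0 by simp
      then show "(\<integral>v. h v * complex_of_real (bump z e v) \<partial>affine_volume (hyperplane i j m)) = 0"
        by (simp add: \<phi>_def)
    qed
    then show ?thesis by (simp add: h_def pwsum_def)
  qed
  have "a \<psi> (alc x) w = 0" if "w permutes UNIV" for w
    by (rule coefficients_zero[OF ij yH \<delta> val der that])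
  then have "u \<psi> z0 = 0"
    using piecewise.u_eq[OF pc[OF \<psi>] z0(1)] z0(2) by (simp add: pwsum_def)
  then show "\<psi> (f z0) = \<psi> (f' z0)" by (simp add: u_def)
qed

definition solution :: "(('n \<Rightarrow> 'n) \<Rightarrow> 'm) \<Rightarrow> ((real, 'n) vec \<Rightarrow> 'm) \<Rightarrow> bool" where
  "solution mw f \<longleftrightarrow> vec_continuous smul f \<and>
    weak_eigenfunction smul \<rho> k (- (\<Sum>j\<in>UNIV. (lam $ j)\<^sup>2)) f \<and>
    (\<forall>g\<in>carrier affine_sym_group. \<exists>c. \<forall>x\<in>affine_act g ` fundamental_alcove. f x = pw c x) \<and>
    (\<forall>x\<in>fundamental_alcove. f x = pw mw x)"

text \<open>By \<open>alcove_translate\<close> the points with a given floor table lie in one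
  translate, which supplies their coefficients.\<close>

lemma solution_coefficients:
  assumes "solution mw f"
  obtains A where "\<And>x. regular x \<Longrightarrow> f x = pw (A (alc x)) x"
proof -
  have "\<exists>c. \<forall>x. regular x \<and> alc x = q \<longrightarrow> f x = pw c x" for q
  proof (cases "\<exists>x. regular x \<and> alc x = q")
    case True
    then obtain x where x: "regular x" "alc x = q" by blast
    obtain g where "g \<in> carrier affine_sym_group" "\<And>z. regular z \<Longrightarrow> alc z = alc x \<Longrightarrow> z \<in> affine_act g ` fundamental_alcove"
      using alcove_translate[OF x(1)] by blast
    then show ?thesis using assms x(2) unfolding solution_def by metis
  qed blast
  then show thesis using that by metis
qed

text \<open>Equality spreads from the fundamental alcove by induction on the number of separating
  hyperplanes; the remaining points follow by continuity, as regular points are dense.\<close>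

lemma solution_unique:
  assumes f: "solution mw f" and f': "solution mw f'"
  shows "f = f'"
proof -
  obtain A where A: "\<And>x. regular x \<Longrightarrow> f x = pw (A (alc x)) x" using solution_coefficients[OF f] by blast
  obtain A' where A': "\<And>x. regular x \<Longrightarrow> f' x = pw (A' (alc x)) x" using solution_coefficients[OF f'] by blast
  obtain x0 :: "(real, 'n) vec" where x0: "x0 \<in> fundamental_alcove" using fundamental_alcove_nonempty by blast
  then have reg0: "regular x0" and alc0: "alc x0 = base_floor" by (simp_all add: fundamental_alcove_iff)
  note sf = f[unfolded solution_def] and sf' = f'[unfolded solution_def]
  have reg: "f x = f' x" if "regular x" for x
    using that
  proof (induction "alc_dist x x0" arbitrary: x rule: less_induct)
    case less
    show ?case
    proof (cases "alc x = alc x0")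
      case True
      then have "x \<in> fundamental_alcove" using less.prems alc0 by (simp add: fundamental_alcove_iff)
      then show ?thesis using sf sf' by simp
    next
      case False
      then obtain i j m where w: "wall i j m x" "x0 $ i + of_int m < x0 $ j"
        using exists_separating_wall[OF less.prems reg0] by metis
      have lt: "alc_dist (reflect i j m x) x0 < alc_dist x x0"
        using alc_dist_reflect[OF w(1) less.prems reg0 w(2)] by simp
      show ?thesis
      proof (rule vanish_across[OF _ _ A _ _ A' w(1) less.prems _ less.prems refl])
        fix z assume z: "regular z" "alc z = alc (reflect i j m x)"
        have "alc_dist z x0 = alc_dist (reflect i j m x) x0" using z(2) by (simp add: alc_dist_def)
        then show "f z = f' z" using less.hyps z(1) lt by simp
      qed (use sf sf' in auto)
    qed
  qed
  have "f x = f' x" for x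
  proof (rule functional_eqI)
    fix \<psi> assume \<psi>: "functional \<psi>"
    define u where "u z = \<psi> (f z) - \<psi> (f' z)" for z
    have "continuous_on UNIV u" unfolding u_def[abs_def]
      using sf sf' by (intro continuous_intros vec_continuous_functional[OF _ \<psi>]) auto
    then have "open (u -` (- {0}))" by (intro open_vimage) auto
    moreover have "\<not> regular z" if "z \<in> u -` (- {0})" for z using that reg[of z] by (auto simp: u_def)
    ultimately have "u -` (- {0}) = {}" using regular_dense by blast
    then have "u x = 0" by blast
    then show "\<psi> (f x) = \<psi> (f' x)" by (simp add: u_def)
  qed
  then show ?thesis by blast
qed

end

lemma (in bethe_base) solution_sol: "solution mw sol"
  unfolding solution_def
proof (intro conjI ballI)
  fix g :: "('n \<Rightarrow> 'n) \<times> ((int, 'n) vec)" assume "g \<in> carrier affine_sym_group"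
  then obtain q where q: "\<And>x. x \<in> affine_act g ` fundamental_alcove \<Longrightarrow> regular x \<and> alc x = q"
    using affine_act_alcove by metis
  have "\<forall>x\<in>affine_act g ` fundamental_alcove. sol x = pw (coeff q) x"
    using q sol_regular coeff_alc by metis
  then show "\<exists>c. \<forall>x\<in>affine_act g ` fundamental_alcove. sol x = pw c x" by blast
next
  fix x :: "(real, 'n) vec" assume "x \<in> fundamental_alcove"
  then have "regular x" "alc x = alc x0" using x0 by (simp_all add: fundamental_alcove_iff)
  then show "sol x = pw mw x" using sol_regular transport_base by simp
qed (rule vec_continuous_sol weak_sol)+

theorem theorem1p1:
  fixes smul :: "complex \<Rightarrow> 'm::ab_group_add \<Rightarrow> 'm"
    and \<rho> :: "('n::{finite,linorder} \<Rightarrow> 'n) \<times> (int ^ 'n::{finite,linorder}) \<Rightarrow> 'm \<Rightarrow> 'm"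
    and k :: complex
    and lam :: "complex ^ 'n::{finite,linorder}"
    and mw :: "('n \<Rightarrow> 'n) \<Rightarrow> 'm"
  assumes "vector_space smul"
    and "\<rho> \<in> hom affine_sym_group (general_linear_group smul)"
    and "\<And>i j. i \<noteq> j \<Longrightarrow> lam $ i \<noteq> lam $ j"
  shows "\<exists>!f :: real ^ 'n::{finite,linorder} \<Rightarrow> 'm.
    vec_continuous smul f \<and>
    weak_eigenfunction smul \<rho> k (- (\<Sum>j\<in>UNIV. (lam $ j)\<^sup>2)) f \<and>
    (\<forall>g\<in>carrier affine_sym_group. \<exists>c :: ('n \<Rightarrow> 'n) \<Rightarrow> 'm.
       \<forall>x\<in>affine_act g ` fundamental_alcove.
         f x = (\<Sum>w | w permutes UNIV. smul (plane_wave (permute_vec w lam) x) (c w))) \<and>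
    (\<forall>x\<in>fundamental_alcove.
       f x = (\<Sum>w | w permutes UNIV. smul (plane_wave (permute_vec w lam) x) (mw w)))"
proof -
  interpret bethe smul \<rho> k lam by (intro bethe.intro assms)
  obtain x0 :: "(real, 'n) vec" where "x0 \<in> fundamental_alcove" using fundamental_alcove_nonempty by blast
  then interpret bethe_base smul \<rho> k lam x0 mw by unfold_locales
  have "\<exists>!f. solution mw f" using solution_sol solution_unique by blast
  then show ?thesis unfolding solution_def pw_def .
qed

end
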